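(* Suppose that the $\mathbb Z$-valued random variable $\kappa$ satisfies $\mathbb E[e^{\lambda|\kappa|}]<\infty$ for some $\lambda>0$, and that $\mathbb E[\kappa]\ge1/3$. Let $(\tilde Z_k)_{k\in\mathbb Z_+}$ be the embedded process of the noisy simple harmonic urn with noise $\kappa$, and let $\tau_q=\min\{k\in\mathbb N:\tilde Z_k=1\}$. Then $\mathbb E[\tau_q^p]<\infty$ for $p<3\mathbb E[\kappa]-1$ and $\mathbb E[\tau_q^p]=\infty$ for $p>3\mathbb E[\kappa]-1$.
   Context: $\mathbb Z_+=\{0,1,2,\dots\}$, $\mathbb N=\{1,2,\dots\}$, $\min\varnothing=\infty$, and $\operatorname{sgn}(x)=-1,0,1$ according as $x<0$, $x=0$, $x>0$. Let $\kappa,\kappa_1,\kappa_2,\dots$ be i.i.d. $\mathbb Z$-valued random variables. The noisy simple harmonic urn is the Markov chain $(\tilde X_n,\tilde Y_n)_{n\in\mathbb Z_+}$ on $\mathbb Z^2\setminus\{(0,0)\}$ with $(\tilde X_0,\tilde Y_0)=(z_0,1)$, $z_0\in\mathbb N$, and the following transition law, where $\kappa_n$ is independent of all other randomness up to time $n$. Given $(\tilde X_n,\tilde Y_n)=(x,y)$ with $xy\neq0$, $$(\tilde X_{n+1},\tilde Y_{n+1})=\begin{cases}(x,y+\operatorname{sgn}(x)) & \text{with probability } \frac{|x|}{|x|+|y|},\\ (x-\operatorname{sgn}(y),y) & \text{with probability } \frac{|y|}{|x|+|y|};\end{cases}$$ if $x=0$, then $(\tilde X_{n+1},\tilde Y_{n+1})=(-\operatorname{sgn}(y),\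 \operatorname{sgn}(y)\max(1,|y|-\kappa_n))$; if $y=0$, then $(\tilde X_{n+1},\tilde Y_{n+1})=(\operatorname{sgn}(x)\max(1,|x|-\kappa_n),\ \operatorname{sgn}(x))$. Set $\tilde\nu_0=-1$ and $\tilde\nu_k=\min\{n>\tilde\nu_{k-1}:\tilde X_n\tilde Y_n=0\}$ for $k\in\mathbb N$. Set $\tilde Z_0=z_0$ and, for $k\in\mathbb N$, $\tilde Z_k=\max\{|\tilde X_{1+\tilde\nu_k}|,|\tilde Y_{1+\tilde\nu_k}|\}=|\tilde X_{1+\tilde\nu_k}|+|\tilde Y_{1+\tilde\nu_k}|-1$; $(\tilde Z_k)$ is a Markov chain on $\mathbb N$. *)

theory Defs
  imports "HOL-Probability.Probability" "HOL-Library.Extended_Nat"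
begin

text \<open>
  The noise variables are i.i.d. and each \<open>\<kappa>\<^sub>n\<close> is independent of the randomness up to time \<open>n\<close>,
  so the noise enters the transition law only through the common law \<open>\<kappa>\<close>.
  The value at \<open>(0, 0)\<close> is junk: this point is outside the state space and is never reached from it.
\<close>

definition urn_step :: "int pmf \<Rightarrow> int \<times> int \<Rightarrow> (int \<times> int) pmf" where
  "urn_step \<kappa> = (\<lambda>(x, y).
     if x \<noteq> 0 \<and> y \<noteq> 0 then
       map_pmf (\<lambda>b. if b then (x, y + sgn x) else (x - sgn y, y))
         (bernoulli_pmf (real_of_int \<bar>x\<bar> / real_of_int (\<bar>x\<bar> + \<bar>y\<bar>)))
     else if x = 0 then
       map_pmf (\<lambda>k. (- sgn y, sgn y * max 1 (\<bar>y\<bar> - k))) \<kappa>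
     else
       map_pmf (\<lambda>k. (sgn x * max 1 (\<bar>x\<bar> - k), sgn x)) \<kappa>)"

text \<open>
  The Markov property is stated through conditional probabilities given the whole history, which
  is adequate because the state space is countable.
\<close>

definition markov_chain ::
    "'a measure \<Rightarrow> ('s \<Rightarrow> 's pmf) \<Rightarrow> 's \<Rightarrow> (nat \<Rightarrow> 'a \<Rightarrow> 's::countable) \<Rightarrow> bool" where
  "markov_chain M K s0 S \<longleftrightarrow>
     prob_space M \<and>
     (\<forall>n. S n \<in> measurable M (count_space UNIV)) \<and>
     (AE \<omega> in M. S 0 \<omega> = s0) \<and>
     (\<forall>n h s. \<P>(\<omega> in M. \<forall>i\<le>n. S i \<omega> = h i) > 0 \<longrightarrow>
        \<P>(\<omega> in M. S (Suc n) \<omega> = s \<bar> \<forall>i\<le>n. S i \<omega> = h i) = pmf (K (h n)) s)"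

definition noisy_urn :: "'a measure \<Rightarrow> int pmf \<Rightarrow> nat \<Rightarrow> (nat \<Rightarrow> 'a \<Rightarrow> int \<times> int) \<Rightarrow> bool" where
  "noisy_urn M \<kappa> z0 S \<longleftrightarrow> markov_chain M (urn_step \<kappa>) (int z0, 1) S"

text \<open>
  In the following, \<open>s\<close> is a single trajectory. To stay within \<^typ>\<open>enat\<close> we use
  \<open>succ_nu s k = 1 + \<nu>\<^sub>k\<close>, so that \<open>\<nu>\<^sub>0 = -1\<close> becomes \<open>0\<close> and \<open>n > \<nu>\<^sub>k\<close> becomes
  \<open>succ_nu s k \<le> n\<close>. An infimum in \<^typ>\<open>enat\<close> is a minimum, with \<open>Inf {} = \<infinity>\<close>.
\<close>

primrec succ_nu :: "(nat \<Rightarrow> int \<times> int) \<Rightarrow> nat \<Rightarrow> enat" where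
  "succ_nu s 0 = 0"
| "succ_nu s (Suc k) = eSuc (Inf {enat n | n. succ_nu s k \<le> enat n \<and> fst (s n) * snd (s n) = 0})"

text \<open>
  The embedded process is \<open>\<nat>\<close>-valued with \<open>\<nat> = {1, 2, \<dots>}\<close>. The value \<open>0\<close> stands for \<open>undefined\<close>
  and is taken if \<open>\<nu>\<^sub>k = \<infinity>\<close>; in particular this never counts as a visit to \<open>1\<close>.
\<close>

definition embedded :: "nat \<Rightarrow> (nat \<Rightarrow> int \<times> int) \<Rightarrow> nat \<Rightarrow> nat" where
  "embedded z0 s k =
     (if k = 0 then z0
      else case succ_nu s k of
             enat n \<Rightarrow> nat (max \<bar>fst (s n)\<bar> \<bar>snd (s n)\<bar>)
           | \<infinity> \<Rightarrow> 0)"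

definition tau_q :: "nat \<Rightarrow> (nat \<Rightarrow> int \<times> int) \<Rightarrow> enat" where
  "tau_q z0 s = Inf {enat k | k. 1 \<le> k \<and> embedded z0 s k = 1}"

text \<open>
  Real powers of a positive extended natural number, with \<open>\<infinity>\<^sup>p = \<infinity>\<close> for \<open>p > 0\<close>, \<open>\<infinity>\<^sup>0 = 1\<close>,
  and \<open>\<infinity>\<^sup>p = 0\<close> for \<open>p < 0\<close>.
\<close>

definition enat_powr :: "enat \<Rightarrow> real \<Rightarrow> ennreal" where
  "enat_powr t p =
     (case t of
        enat n \<Rightarrow> ennreal (real n powr p)
      | \<infinity> \<Rightarrow> (if p > 0 then \<infinity> else if p = 0 then 1 else 0))"

end

theory Submission
  imports Defs "HOL-Real_Asymp.Real_Asymp"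
begin

text \<open>
  Rotating each quadrant to the first, the urn is a walk that raises one coordinate and lowers the
  other until it meets the axis. This walk has explicit harmonic functions: polynomials, which give
  the first two moments of the increment of \<open>Z\<close> over a quadrant, and products
  \<open>\<Prod>(1 + t j) / \<Prod>(1 - t i)\<close>, which give exponential tails on the scale \<open>\<surd>z\<close>. With the noise,
  the embedded chain has drift \<open>2/3 - E \<kappa> + o(1)\<close> and variance \<open>(2/3 + o(1)) z\<close> from \<open>z\<close>, so
  that \<open>E Z\<^sub>1\<^sup>\<alpha> - z\<^sup>\<alpha> = (\<alpha>/3) (\<alpha> - \<theta> + o(1)) z\<^sup>\<alpha>\<^sup>-\<^sup>1\<close> with \<open>\<theta> = 3 E \<kappa> - 1\<close>.

  For \<open>0 < \<alpha> < \<theta>\<close> the function \<open>min 1 (C (z/k)\<^sup>\<alpha>)\<close> of the elapsed time \<open>k\<close> and the starting point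
  \<open>z\<close> is, up to a change near \<open>z = 1\<close>, a supersolution of the recursion for \<open>P(\<tau> > k)\<close>, whence
  \<open>P(\<tau> > k) \<le> C k\<^sup>-\<^sup>\<alpha>\<close>. For \<open>\<beta> > \<theta>\<close>, a bounded submartingale built from \<open>z\<^sup>\<beta>\<close> shows that \<open>Z\<close>
  reaches order \<open>k\<close> before \<open>1\<close> with probability at least of order \<open>k\<^sup>-\<^sup>\<beta>\<close>, and from there it
  survives for time \<open>k\<close> with probability at least \<open>1/2\<close>.
\<close>

text \<open>A bounded drift and a variance proportional to \<open>z\<close> make space and time
  scale alike: from \<open>z\<close> the chain needs a time of order \<open>z\<close> to change by a
  fixed factor. Hence \<open>z/k\<close> is the natural variable, and the exponent at which the
  power of \<open>z\<close> has no drift to leading order is also the tail exponent in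
  \<open>k\<close>.

  Increments have no uniform bound and the exponents are arbitrary, so moments of all orders on the
  scale \<open>sqrt z\<close> are needed. The polynomials alone do not close: the identity for the
  second moment contains the third and the fourth, and only the exponential bounds show these to be
  negligible.

  The probability space carries the urn alone, and no embedded chain is constructed on it. The event
  \<open>\<tau> \<le> k\<close> is an increasing union of events that depend on finitely many urn
  steps. Their probabilities obey a recursion whose limit is harmonic inside a quadrant, and this is
  where the exit law enters.\<close>

section \<open>The law of the exit from a quadrant\<close>

text \<open>
  Up to rotation a state is a pair \<open>(a, c)\<close>, where \<open>a\<close> is the decreasing coordinate and \<open>c + 1\<close>
  the increasing one. \<open>surv a c n\<close> is the probability of at least \<open>n\<close> raises of \<open>c\<close> before \<open>a\<close>
  drops, and \<open>exit_law a c\<close> the law of \<open>c\<close> when \<open>a\<close> reaches \<open>0\<close>.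
\<close>

definition surv :: "nat \<Rightarrow> nat \<Rightarrow> nat \<Rightarrow> real" where
  "surv a c n = (\<Prod>j<n. real a / real (a + c + j + 1))"

lemma surv_0 [simp]: "surv a c 0 = 1"
  by (simp add: surv_def)

lemma surv_Suc: "surv a c (Suc n) = surv a c n * (real a / real (a + c + n + 1))"
  by (simp add: surv_def)

lemma surv_nonneg: "0 \<le> surv a c n"
  unfolding surv_def by (intro prod_nonneg) auto

lemma surv_pos: "0 < surv (Suc a) c n"
  unfolding surv_def by (intro prod_pos) auto

lemma surv_diff: "surv a c n - surv a c (Suc n) = surv a c n * (real (c + n + 1) / real (a + c + n + 1))"
  by (simp add: surv_Suc field_simps)

lemma surv_le: "surv a c n \<le> (real a / real (a + 1)) ^ n"
proof -
  have "surv a c n \<le> (\<Prod>j<n. real a / real (a + 1))"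
    unfolding surv_def by (intro prod_mono) (auto intro!: divide_left_mono)
  then show ?thesis by simp
qed

lemma surv_tendsto: "surv a c \<longlonglongrightarrow> 0"
proof (rule tendsto_sandwich[OF _ _ tendsto_const LIMSEQ_power_zero])
  show "norm (real a / real (a + 1)) < 1" by simp
  show "\<forall>\<^sub>F n in sequentially. surv a c n \<le> (real a / real (a + 1)) ^ n"
    by (rule always_eventually) (rule allI, rule surv_le)
qed (simp add: surv_nonneg)

text \<open>The number of raises before the next drop: \<open>surv\<close> decreases from 1 to 0, so
  its successive differences form a probability mass function.\<close>

definition run :: "nat \<Rightarrow> nat \<Rightarrow> nat pmf" where
  "run a c = embed_pmf (\<lambda>n. surv a c n - surv a c (Suc n))"

lemma pmf_run: "pmf (run a c) n = surv a c n * (real (c + n + 1) / real (a + c + n + 1))"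
proof -
  have nn: "0 \<le> surv a c n - surv a c (Suc n)" for n
    by (simp add: surv_diff surv_nonneg del: of_nat_add of_nat_Suc)
  have s: "(\<lambda>n. surv a c n - surv a c (Suc n)) sums 1"
    using telescope_sums'[OF surv_tendsto, of a c] by simp
  have "(\<integral>\<^sup>+ n. ennreal (surv a c n - surv a c (Suc n)) \<partial>count_space UNIV) = 1"
    using suminf_ennreal_eq[OF nn s] by (simp add: nn_integral_count_space_nat)
  then have "pmf (run a c) n = surv a c n - surv a c (Suc n)"
    unfolding run_def by (intro pmf_embed_pmf nn) auto
  then show ?thesis by (simp only: surv_diff)
qed

primrec exit_law :: "nat \<Rightarrow> nat \<Rightarrow> nat pmf" where
  "exit_law 0 c = return_pmf c"
| "exit_law (Suc a) c = bind_pmf (run (Suc a) c) (\<lambda>n. exit_law a (c + n))"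

section \<open>Harmonic functions of the quadrant walk and their integrals over the exit law\<close>

text \<open>Harmonicity is asked only at heights up to \<open>A\<close>, because the products over
  \<open>1 - t i\<close> used below may fail to be positive for large \<open>a\<close>. Values in
  \<open>ennreal\<close> make nonnegativity part of the type.\<close>

definition harmonic_upto :: "nat \<Rightarrow> (nat \<Rightarrow> nat \<Rightarrow> ennreal) \<Rightarrow> bool" where
  "harmonic_upto A F \<longleftrightarrow> (\<forall>a<A. \<forall>c. F (Suc a) c =
     ennreal (real (Suc a) / real (Suc a + c + 1)) * F (Suc a) (Suc c)
     + ennreal (real (c + 1) / real (Suc a + c + 1)) * F a c)"

text \<open>Optional stopping at the first drop or after \<open>n\<close> raises, whichever comes
  first; the extra term carries the paths that have not dropped yet.\<close>

lemma harmonic_partial_sum: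
  assumes "harmonic_upto A F" and "a < A"
  shows "(\<Sum>i<n. ennreal (pmf (run (Suc a) c) i) * F a (c + i))
           + ennreal (surv (Suc a) c n) * F (Suc a) (c + n) = F (Suc a) c"
proof (induction n)
  case (Suc n)
  let ?p = "real (Suc a) / real (Suc a + (c + n) + 1)"
  let ?q = "real (c + n + 1) / real (Suc a + (c + n) + 1)"
  have "ennreal (surv (Suc a) c n) * F (Suc a) (c + n)
      = ennreal (surv (Suc a) c n) * (ennreal ?p * F (Suc a) (Suc (c + n)) + ennreal ?q * F a (c + n))"
    using assms unfolding harmonic_upto_def by metis
  also have "\<dots> = ennreal (surv (Suc a) c n * ?p) * F (Suc a) (Suc (c + n))
                + ennreal (surv (Suc a) c n * ?q) * F a (c + n)"
    by (simp only: distrib_left mult.assoc ennreal_mult'[OF surv_nonneg])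
  also have "surv (Suc a) c n * ?p = surv (Suc a) c (Suc n)"
    by (simp add: surv_Suc add_ac)
  also have "surv (Suc a) c n * ?q = pmf (run (Suc a) c) n"
    by (simp add: pmf_run add_ac)
  finally show ?case
    using Suc.IH by (simp add: add_ac)
qed simp

lemma nn_integral_run:
  "(\<integral>\<^sup>+ n. f n \<partial>run a c) = (\<Sum>n. ennreal (pmf (run a c) n) * f n)"
  by (simp add: nn_integral_measure_pmf nn_integral_count_space_nat)

text \<open>Discarding the nonnegative term of the paths that have not dropped leaves an inequality
  without any growth condition on \<open>F\<close>. This suffices for the exponential
  functions.\<close>

lemma harmonic_exit_law_le:
  assumes "harmonic_upto A F" and "a \<le> A"
  shows "(\<integral>\<^sup>+ y. F 0 y \<partial>exit_law a c) \<le> F a c"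
  using assms(2)
proof (induction a arbitrary: c)
  case (Suc a)
  have "(\<integral>\<^sup>+ y. F 0 y \<partial>exit_law (Suc a) c)
      = (\<integral>\<^sup>+ n. (\<integral>\<^sup>+ y. F 0 y \<partial>exit_law a (c + n)) \<partial>run (Suc a) c)"
    by simp
  also have "\<dots> \<le> (\<integral>\<^sup>+ n. F a (c + n) \<partial>run (Suc a) c)"
    using Suc.prems by (intro nn_integral_mono Suc.IH) auto
  also have "\<dots> \<le> F (Suc a) c"
    unfolding nn_integral_run
  proof (rule suminf_le_const)
    fix n
    show "(\<Sum>i<n. ennreal (pmf (run (Suc a) c) i) * F a (c + i)) \<le> F (Suc a) c"
      using harmonic_partial_sum[OF assms(1), of a c n] Suc.prems
      by (metis Suc_le_lessD le_iff_add)
  qed auto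
  finally show ?case .
qed simp

text \<open>\<open>lim\<close> makes the term of the paths that have not dropped vanish, so that no
  mass is lost on any level.\<close>

lemma harmonic_exit_law:
  assumes F: "harmonic_upto A F" and "a \<le> A"
    and lim: "\<And>a c. a < A \<Longrightarrow> (\<lambda>n. ennreal (surv (Suc a) c n) * F (Suc a) (c + n)) \<longlonglongrightarrow> 0"
  shows "(\<integral>\<^sup>+ y. F 0 y \<partial>exit_law a c) = F a c"
  using assms(2)
proof (induction a arbitrary: c)
  case (Suc a)
  then have a: "a < A" by simp
  have "(\<lambda>n. (\<Sum>i<n. ennreal (pmf (run (Suc a) c) i) * F a (c + i))
           + ennreal (surv (Suc a) c n) * F (Suc a) (c + n))
        \<longlonglongrightarrow> (\<Sum>i. ennreal (pmf (run (Suc a) c) i) * F a (c + i)) + 0"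
    using a by (intro tendsto_add lim summable_LIMSEQ) auto
  then have "(\<Sum>i. ennreal (pmf (run (Suc a) c) i) * F a (c + i)) = F (Suc a) c"
    unfolding harmonic_partial_sum[OF F a] by (simp add: LIMSEQ_const_iff)
  then show ?case
    using a by (simp add: Suc.IH nn_integral_run)
qed simp

lemma exit_law_start: "c \<in> set_pmf (exit_law a c)"
proof (induction a arbitrary: c)
  case (Suc a)
  have "0 \<in> set_pmf (run (Suc a) c)"
    by (simp add: set_pmf_iff pmf_run)
  then show ?case
    using Suc.IH[of c] by force
qed simp

text \<open>All \<open>n\<close> raises occur on the first level, and every later level drops at
  once.\<close>

lemma exit_law_support: "c + n \<in> set_pmf (exit_law (Suc a) c)"
proof -
  have "n \<in> set_pmf (run (Suc a) c)"
    using surv_pos[of a c n] by (simp add: set_pmf_iff pmf_run add_nonneg_eq_0_iff)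
  then show ?thesis
    using exit_law_start[of "c + n" a] by auto
qed

lemma harmonic_upto_ennreal:
  assumes nonneg: "\<And>a c. a \<le> A \<Longrightarrow> 0 \<le> F a c"
    and step: "\<And>a c. a < A \<Longrightarrow> (real a + c + 2) * F (Suc a) c
           = (real a + 1) * F (Suc a) (Suc c) + (real c + 1) * F a c"
  shows "harmonic_upto A (\<lambda>a c. ennreal (F a c))"
  unfolding harmonic_upto_def
proof (intro allI impI)
  fix a c :: nat
  assume a: "a < A"
  have "F (Suc a) c = real (Suc a) / real (Suc a + c + 1) * F (Suc a) (Suc c)
          + real (c + 1) / real (Suc a + c + 1) * F a c"
  proof -
    have "F (Suc a) c = ((real a + 1) * F (Suc a) (Suc c) + (real c + 1) * F a c) / (real a + c + 2)"
      using step[OF a, of c] by (simp add: eq_divide_eq mult.commute)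
    then show ?thesis
      by (simp add: add_divide_distrib algebra_simps)
  qed
  then show "ennreal (F (Suc a) c) = ennreal (real (Suc a) / real (Suc a + c + 1)) * ennreal (F (Suc a) (Suc c))
          + ennreal (real (c + 1) / real (Suc a + c + 1)) * ennreal (F a c)"
    using nonneg a by (simp flip: ennreal_mult' ennreal_plus del: of_nat_Suc of_nat_add)
qed

text \<open>The tail of \<open>surv\<close> is at most geometric, so functions of polynomial growth
  are admissible. Asking for every ratio \<rho> leaves a limit with a symbolic base.\<close>

lemma surv_times_tendsto_0:
  assumes "\<And>\<rho>::real. 0 < \<rho> \<Longrightarrow> \<rho> < 1 \<Longrightarrow> (\<lambda>n. \<rho> ^ n * f n) \<longlonglongrightarrow> 0"
    and nonneg: "\<And>n. 0 \<le> f n"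
  shows "(\<lambda>n. ennreal (surv (Suc a) c n) * ennreal (f n)) \<longlonglongrightarrow> 0"
proof -
  let ?\<rho> = "real (Suc a) / real (Suc a + 1)"
  have lim: "(\<lambda>n. ?\<rho> ^ n * f n) \<longlonglongrightarrow> 0"
    by (rule assms(1)) auto
  have "(\<lambda>n. surv (Suc a) c n * f n) \<longlonglongrightarrow> 0"
  proof (rule tendsto_sandwich[OF _ _ tendsto_const lim])
    show "\<forall>\<^sub>F n in sequentially. 0 \<le> surv (Suc a) c n * f n"
      by (simp add: surv_nonneg nonneg)
    show "\<forall>\<^sub>F n in sequentially. surv (Suc a) c n * f n \<le> ?\<rho> ^ n * f n"
      by (intro always_eventually allI mult_right_mono surv_le nonneg)
  qed
  then have "(\<lambda>n. ennreal (surv (Suc a) c n * f n)) \<longlonglongrightarrow> ennreal 0"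
    by (rule tendsto_ennrealI)
  then show ?thesis
    by (simp add: ennreal_mult' surv_nonneg)
qed

section \<open>Polynomial harmonic functions\<close>

text \<open>For \<open>c (c + 1) + a (a + 1)\<close> a raise adds \<open>2 (c + 1)\<close> with
  weight \<open>a\<close>, and a drop subtracts \<open>2 a\<close> with weight \<open>c + 1\<close>;
  the two cancel.\<close>

lemma nn_integral_exit_law_quadratic:
  "(\<integral>\<^sup>+ y. ennreal (real y * (real y + 1)) \<partial>exit_law z 0) = ennreal (real z * (real z + 1))"
proof -
  let ?F = "\<lambda>a c. real c * (real c + 1) + real a * (real a + 1)"
  have "harmonic_upto z (\<lambda>a c. ennreal (?F a c))"
    by (rule harmonic_upto_ennreal) (simp_all add: algebra_simps)
  then have "(\<integral>\<^sup>+ y. ennreal (?F 0 y) \<partial>exit_law z 0) = ennreal (?F z 0)"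
  proof (rule harmonic_exit_law[OF _ order_refl], goal_cases)
    case (1 a c)
    show ?case
      by (rule surv_times_tendsto_0) (real_asymp, simp)
  qed
  then show ?thesis by simp
qed

text \<open>
  With \<open>Q = c (c + 1) + a (a + 1)\<close>, which is harmonic, the conditional variance of the increment of
  \<open>Q\<close> is \<open>4 a (c + 1)\<close>; the cubic terms compensate \<open>Q\<^sup>2\<close> for it.
\<close>

definition quartic :: "real \<Rightarrow> real \<Rightarrow> real" where
  "quartic a c = (c * (c + 1) + a * (a + 1))\<^sup>2 - (2/3) * (c * (c + 1) * (2 * c + 1))
      + (2/3) * (a * (a + 1) * (2 * a + 1))"

text \<open>Needed to use \<open>quartic\<close> as an \<open>ennreal\<close>-valued harmonic
  function. Its part in \<open>c\<close> alone is \<open>c (c + 1) (c - 1) (c + 2/3)\<close>, which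
  is negative for real \<open>c\<close> strictly between 0 and 1, so the integrality of
  \<open>c\<close> matters.\<close>

lemma quartic_nonneg: "0 \<le> quartic (real a) (real c)"
proof -
  let ?a = "real a" and ?c = "real c"
  have "0 \<le> ?c * (?c + 1) * ((?c - 1) * (?c + 2/3))"
    by (cases c) auto
  moreover have "0 \<le> (?a * (?a + 1))\<^sup>2 + 2 * (?a * (?a + 1)) * (?c * (?c + 1))
      + (2/3) * (?a * (?a + 1) * (2 * ?a + 1))"
    by (intro add_nonneg_nonneg mult_nonneg_nonneg) auto
  moreover have "quartic ?a ?c = ?c * (?c + 1) * ((?c - 1) * (?c + 2/3)) + ((?a * (?a + 1))\<^sup>2
      + 2 * (?a * (?a + 1)) * (?c * (?c + 1)) + (2/3) * (?a * (?a + 1) * (2 * ?a + 1)))"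
    unfolding quartic_def by algebra
  ultimately show ?thesis by linarith
qed

lemma nn_integral_exit_law_quartic:
  "(\<integral>\<^sup>+ y. ennreal (quartic 0 (real y)) \<partial>exit_law z 0) = ennreal (quartic (real z) 0)"
proof -
  let ?F = "\<lambda>a c. quartic (real a) (real c)"
  have "harmonic_upto z (\<lambda>a c. ennreal (?F a c))"
  proof (rule harmonic_upto_ennreal)
    show "(real a + c + 2) * ?F (Suc a) c
           = (real a + 1) * ?F (Suc a) (Suc c) + (real c + 1) * ?F a c" for a c
      unfolding quartic_def of_nat_Suc by algebra
  qed (rule quartic_nonneg)
  then have "(\<integral>\<^sup>+ y. ennreal (?F 0 y) \<partial>exit_law z 0) = ennreal (?F z 0)"
  proof (rule harmonic_exit_law[OF _ order_refl], goal_cases)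
    case (1 a c)
    show ?case
    proof (rule surv_times_tendsto_0[OF _ quartic_nonneg], goal_cases)
      case (1 \<rho>)
      then show ?case unfolding quartic_def by real_asymp
    qed
  qed
  then show ?thesis by simp
qed

section \<open>Exponential harmonic functions and concentration on the scale
  \<open>sqrt z\<close>\<close>

text \<open>
  For negative \<open>t\<close> the product changes sign in general. This is avoided by taking \<open>t = - 1 / M\<close> with
  an integer \<open>M\<close>: the product then vanishes from \<open>M\<close> on.
\<close>

definition exp_prod :: "real \<Rightarrow> nat \<Rightarrow> real" where
  "exp_prod t n = (\<Prod>j=1..n. 1 + t * real j)"

lemma exp_prod_0 [simp]: "exp_prod t 0 = 1"
  by (simp add: exp_prod_def)

lemma exp_prod_Suc: "exp_prod t (Suc n) = exp_prod t n * (1 + t * (real n + 1))"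
  by (simp add: exp_prod_def add.commute)

text \<open>A raise multiplies \<open>exp_prod t c / exp_prod (- t) a\<close> by
  \<open>1 + t (c + 1)\<close> and a drop by \<open>1 - t a\<close>; with weights \<open>a\<close>
  and \<open>c + 1\<close> gain and loss balance. The quotient is a discrete counterpart of
  \<open>exp (t (c^2 + a^2) / 2)\<close>.\<close>

lemma nn_integral_exit_law_exp_prod:
  assumes "\<And>n. 0 \<le> exp_prod t n" and "\<And>i. i \<le> z \<Longrightarrow> 0 < 1 - t * real i"
  shows "(\<integral>\<^sup>+ y. ennreal (exp_prod t y) \<partial>exit_law z 0) \<le> ennreal (1 / exp_prod (- t) z)"
proof -
  have pos: "0 < exp_prod (- t) a" if "a \<le> z" for a
    unfolding exp_prod_def using assms(2) that by (intro prod_pos) auto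
  let ?F = "\<lambda>a c. exp_prod t c / exp_prod (- t) a"
  have "harmonic_upto z (\<lambda>a c. ennreal (?F a c))"
  proof (rule harmonic_upto_ennreal)
    show "0 \<le> ?F a c" if "a \<le> z" for a c
      using assms(1) pos[OF that] by simp
    show "(real a + c + 2) * ?F (Suc a) c
           = (real a + 1) * ?F (Suc a) (Suc c) + (real c + 1) * ?F a c" if "a < z" for a c
    proof -
      define r where "r = 1 - t * (real a + 1)"
      have r: "r \<noteq> 0" "exp_prod (- t) a \<noteq> 0"
        using assms(2)[of "Suc a"] pos[of a] that by (auto simp: r_def add.commute)
      have 1: "?F a c = r * ?F (Suc a) c"
        using r by (simp add: exp_prod_Suc r_def)
      have 2: "?F (Suc a) (Suc c) = (1 + t * (real c + 1)) * ?F (Suc a) c"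
        by (simp add: exp_prod_Suc)
      show ?thesis
        unfolding 1 2 r_def by algebra
    qed
  qed
  from harmonic_exit_law_le[OF this order_refl, of 0] show ?thesis by simp
qed

text \<open>Every factor beyond \<open>z\<close> is at least \<open>1 + t z\<close>, and
  \<open>exp u \<le> 1 + 2 u\<close> for \<open>u = t z / 2\<close>.\<close>

lemma exp_prod_lower_pos:
  assumes "0 \<le> t" "t * real z \<le> 1" "z \<le> y"
  shows "exp ((real y - real z) * (t * real z / 2)) * exp_prod t z \<le> exp_prod t y"
  using assms(3)
proof (induction y rule: dec_induct)
  case (step y)
  have "exp (t * real z / 2) \<le> 1 + t * real z"
  proof -
    define u where "u = t * real z / 2"
    have u: "0 \<le> u" "u \<le> 1" using assms by (auto simp: u_def)
    have "exp u \<le> 1 + u + u\<^sup>2"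
      using u by (rule exp_bound)
    moreover have "u\<^sup>2 \<le> u"
      using u by (simp add: power2_eq_square mult_left_le)
    ultimately show ?thesis by (simp add: u_def)
  qed
  also have "\<dots> \<le> 1 + t * (real y + 1)"
    using assms step by (simp add: mult_left_mono)
  finally have e: "exp (t * real z / 2) \<le> 1 + t * (real y + 1)" .
  have "exp ((real (Suc y) - real z) * (t * real z / 2)) * exp_prod t z
      = exp (t * real z / 2) * (exp ((real y - real z) * (t * real z / 2)) * exp_prod t z)"
  proof -
    have eq: "(real (Suc y) - real z) * (t * real z / 2)
        = t * real z / 2 + (real y - real z) * (t * real z / 2)"
      by (simp add: field_simps)
    show ?thesis unfolding eq exp_add by (rule mult.assoc)
  qed
  also have "\<dots> \<le> (1 + t * (real y + 1)) * exp_prod t y"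
  proof (intro mult_mono)
    show "0 \<le> 1 + t * (real y + 1)" using assms by simp
    show "0 \<le> exp ((real y - real z) * (t * real z / 2)) * exp_prod t z"
      unfolding exp_prod_def using assms by (intro mult_nonneg_nonneg prod_nonneg) auto
  qed (use step.IH e in auto)
  finally show ?case by (simp add: exp_prod_Suc mult.commute)
qed simp

lemma exp_prod_neg_nonneg:
  assumes "0 \<le> t" "t * real z \<le> 1" "y \<le> z"
  shows "0 \<le> exp_prod (- t) y"
  unfolding exp_prod_def using assms
  by (intro prod_nonneg) (auto intro!: order_trans[OF mult_left_mono[of _ "real z" t]])

text \<open>The factors with \<open>y < j \<le> z\<close> satisfy
  \<open>1 - t j \<le> exp (- t j)\<close>, and these \<open>j\<close> add up to
  \<open>(z - y) (z + y + 1) / 2\<close>, which is at least \<open>(z - y) z / 2\<close>.\<close>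

lemma exp_prod_lower_neg:
  assumes "0 \<le> t" "t * real z \<le> 1" "y \<le> z"
  shows "exp ((real z - real y) * (t * real z / 2)) * exp_prod (- t) z \<le> exp_prod (- t) y"
proof -
  have "exp_prod (- t) w \<le> exp (t * (real y * (real y + 1) - real w * (real w + 1)) / 2) * exp_prod (- t) y"
    if "y \<le> w" "w \<le> z" for w
    using that
  proof (induction w rule: dec_induct)
    case (step w)
    have tw: "t * (real w + 1) \<le> 1"
      using assms step by (intro order_trans[OF mult_left_mono[of "real w + 1" "real z" t]]) auto
    have p: "0 \<le> exp_prod (- t) w"
      using assms step by (intro exp_prod_neg_nonneg[of t z]) auto
    have "exp_prod (- t) (Suc w) = (1 - t * (real w + 1)) * exp_prod (- t) w"
      by (simp add: exp_prod_Suc algebra_simps)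
    also have "\<dots> \<le> exp (- (t * (real w + 1))) *
        (exp (t * (real y * (real y + 1) - real w * (real w + 1)) / 2) * exp_prod (- t) y)"
      using step tw exp_ge_add_one_self[of "- (t * (real w + 1))"]
      by (intro mult_mono) (auto intro: p)
    also have "\<dots> = exp (t * (real y * (real y + 1) - real (Suc w) * (real (Suc w) + 1)) / 2) * exp_prod (- t) y"
    proof -
      have eq: "t * (real y * (real y + 1) - real (Suc w) * (real (Suc w) + 1)) / 2
          = - (t * (real w + 1)) + t * (real y * (real y + 1) - real w * (real w + 1)) / 2"
        by (simp add: field_simps)
      show ?thesis unfolding eq exp_add by (rule mult.assoc[symmetric])
    qed
    finally show ?case .
  qed simp
  from this[of z] assms have *: "exp_prod (- t) z \<le> exp (t * (real y * (real y + 1) - real z * (real z + 1)) / 2) * exp_prod (- t) y"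
    by simp
  have p: "0 \<le> exp_prod (- t) y"
    using assms by (intro exp_prod_neg_nonneg[of t z]) auto
  have "exp ((real z - real y) * (t * real z / 2)) * exp_prod (- t) z
      \<le> exp ((real z - real y) * (t * real z / 2)) *
         (exp (t * (real y * (real y + 1) - real z * (real z + 1)) / 2) * exp_prod (- t) y)"
    using * by simp
  also have "\<dots> = exp (- (t * (real z - real y) * (real y + 1) / 2)) * exp_prod (- t) y"
  proof -
    have eq: "- (t * (real z - real y) * (real y + 1) / 2) = (real z - real y) * (t * real z / 2)
        + t * (real y * (real y + 1) - real z * (real z + 1)) / 2"
      by (simp add: field_simps)
    show ?thesis unfolding eq exp_add by (rule mult.assoc[symmetric])
  qed
  also have "\<dots> \<le> 1 * exp_prod (- t) y"
    using assms p by (intro mult_right_mono) auto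
  finally show ?thesis by simp
qed

text \<open>The two products combine to the product of the \<open>1 - (t j)^2\<close>, which
  Bernoulli's inequality bounds below as long as \<open>t z\<close> is at most of order
  \<open>1 / sqrt z\<close>. This constraint on \<open>t\<close> is the origin of the scale
  \<open>sqrt z\<close>.\<close>

lemma exp_prod_mult_ge:
  assumes "1 \<le> z" and "0 \<le> t" and "(t * real z)\<^sup>2 \<le> 1 / (4 * real z)"
  shows "3 / 4 \<le> exp_prod t z * exp_prod (- t) z"
proof -
  have "3 / 4 \<le> 1 + real z * (- (1 / (4 * real z)))"
    using assms by simp
  also have "\<dots> \<le> (1 + (- (1 / (4 * real z)))) ^ z"
    using assms by (intro Bernoulli_inequality) (auto simp: field_simps)
  also have "\<dots> = (\<Prod>j=1..z. 1 - 1 / (4 * real z))"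
    by simp
  also have "\<dots> \<le> (\<Prod>j=1..z. (1 + t * real j) * (1 + - t * real j))"
  proof (intro prod_mono conjI)
    fix j assume j: "j \<in> {1..z}"
    show "0 \<le> 1 - 1 / (4 * real z)"
      using assms by (auto simp: field_simps)
    have "(t * real j)\<^sup>2 \<le> (t * real z)\<^sup>2"
      using j assms by (intro power_mono mult_left_mono) auto
    also note assms(3)
    finally show "1 - 1 / (4 * real z) \<le> (1 + t * real j) * (1 + - t * real j)"
      by (simp add: algebra_simps power2_eq_square)
  qed
  finally show ?thesis
    by (simp add: exp_prod_def prod.distrib)
qed

lemma exit_law_exp_moment:
  assumes z: "1 \<le> z"
  shows "(\<integral>\<^sup>+ y. ennreal (exp (\<bar>real y - real z\<bar> / (6 * sqrt z))) \<partial>exit_law z 0) \<le> ennreal 3"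
proof -
  \<comment> \<open>An integer of order \<open>z sqrt z\<close>: at least \<open>2 z sqrt z\<close>
    for \<open>exp_prod_mult_ge\<close>, and at most \<open>3 z sqrt z\<close> so that
    \<open>t z / 2 \<ge> 1 / (6 sqrt z)\<close>.\<close>
  define M where "M = nat \<lceil>2 * real z * sqrt z\<rceil>"
  define t where "t = 1 / real M"
  have sq: "1 \<le> sqrt z" "sqrt z * sqrt z = real z"
    using z by auto
  have M1: "2 * real z * sqrt z \<le> real M" and M2: "real M \<le> 2 * real z * sqrt z + 1"
    unfolding M_def using sq z by (auto simp: of_nat_nat intro: less_imp_le)
  have "1 * 1 \<le> real z * sqrt z"
    using sq z by (intro mult_mono) auto
  then have M3: "real M \<le> 3 * (real z * sqrt z)" and Mpos: "0 < real M"
    using M1 M2 by auto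
  have tnn: "0 \<le> t" by (simp add: t_def)
  have tz: "t * real z \<le> 1 / (2 * sqrt z)"
    using M1 Mpos sq z by (simp add: t_def field_simps)
  have tz': "t * real z \<le> 1 / 2"
    using sq by (intro order_trans[OF tz]) (simp add: field_simps)
  have "(t * real z)\<^sup>2 \<le> (1 / (2 * sqrt z))\<^sup>2"
    using tz tnn by (intro power_mono) auto
  then have tz2: "(t * real z)\<^sup>2 \<le> 1 / (4 * real z)"
    using sq by (simp add: power2_eq_square)
  have tz3: "1 / (6 * sqrt z) \<le> t * real z / 2"
    using M3 Mpos sq z by (simp add: t_def field_simps)
  have lt: "t * real i < 1" if "i \<le> z" for i
    using mult_left_mono[of "real i" "real z" t] that tnn tz' by simp
  have pos: "0 < exp_prod t z" "0 < exp_prod (- t) z"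
    unfolding exp_prod_def using tnn lt by (auto intro!: prod_pos add_pos_nonneg)
  have nn1: "0 \<le> exp_prod t n" for n
    unfolding exp_prod_def using tnn by (intro prod_nonneg) auto
  have nn2: "0 \<le> exp_prod (- t) n" for n
  proof (cases "n \<ge> M")
    case True
    then have "(\<Prod>j=1..n. 1 + - t * real j) = 0"
      using Mpos by (intro prod_zero) (auto simp: t_def intro!: bexI[of _ M])
    then show ?thesis unfolding exp_prod_def by (simp only: order_refl)
  next
    case False
    then have "t * real n \<le> 1" using Mpos by (simp add: t_def)
    then show ?thesis using tnn by (intro exp_prod_neg_nonneg[of t n]) auto
  qed
  have prod: "3 / 4 \<le> exp_prod t z * exp_prod (- t) z"
    by (rule exp_prod_mult_ge[OF z tnn tz2])
  \<comment> \<open>The first quotient dominates for \<open>y \<ge> z\<close>, the second for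
    \<open>y < z\<close>; both are normalised to 1 at \<open>y = z\<close>.\<close>
  have bound: "exp (\<bar>real y - real z\<bar> / (6 * sqrt z))
      \<le> exp_prod t y / exp_prod t z + exp_prod (- t) y / exp_prod (- t) z" for y
  proof -
    have "exp (\<bar>real y - real z\<bar> / (6 * sqrt z)) \<le> exp (\<bar>real y - real z\<bar> * (t * real z / 2))"
      using mult_left_mono[OF tz3, of "\<bar>real y - real z\<bar>"] by simp
    also have "\<dots> \<le> exp_prod t y / exp_prod t z + exp_prod (- t) y / exp_prod (- t) z"
    proof (cases "z \<le> y")
      case True
      then have "exp (\<bar>real y - real z\<bar> * (t * real z / 2)) \<le> exp_prod t y / exp_prod t z"
        using exp_prod_lower_pos[of t z y] tnn tz' pos by (simp add: pos_le_divide_eq)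
      moreover have "0 \<le> exp_prod (- t) y / exp_prod (- t) z"
        using nn2 by simp
      ultimately show ?thesis by linarith
    next
      case False
      then have "exp (\<bar>real y - real z\<bar> * (t * real z / 2)) \<le> exp_prod (- t) y / exp_prod (- t) z"
        using exp_prod_lower_neg[of t z y] tnn tz' pos by (simp add: pos_le_divide_eq)
      moreover have "0 \<le> exp_prod t y / exp_prod t z"
        using nn1 by simp
      ultimately show ?thesis by linarith
    qed
    finally show ?thesis .
  qed
  have i1: "(\<integral>\<^sup>+ y. ennreal (exp_prod t y / exp_prod t z) \<partial>exit_law z 0)
      \<le> ennreal (1 / (exp_prod t z * exp_prod (- t) z))"
  proof -
    have "(\<integral>\<^sup>+ y. ennreal (exp_prod t y / exp_prod t z) \<partial>exit_law z 0)
        = ennreal (1 / exp_prod t z) * (\<integral>\<^sup>+ y. ennreal (exp_prod t y) \<partial>exit_law z 0)"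
      using pos nn1 by (simp add: nn_integral_cmult[symmetric] ennreal_mult''[symmetric])
    also have "\<dots> \<le> ennreal (1 / exp_prod t z) * ennreal (1 / exp_prod (- t) z)"
      using lt by (intro mult_left_mono nn_integral_exit_law_exp_prod nn1) auto
    also have "\<dots> = ennreal (1 / (exp_prod t z * exp_prod (- t) z))"
      using pos by (simp add: ennreal_mult''[symmetric])
    finally show ?thesis .
  qed
  have i2: "(\<integral>\<^sup>+ y. ennreal (exp_prod (- t) y / exp_prod (- t) z) \<partial>exit_law z 0)
      \<le> ennreal (1 / (exp_prod t z * exp_prod (- t) z))"
  proof -
    have "(\<integral>\<^sup>+ y. ennreal (exp_prod (- t) y / exp_prod (- t) z) \<partial>exit_law z 0)
        = ennreal (1 / exp_prod (- t) z) * (\<integral>\<^sup>+ y. ennreal (exp_prod (- t) y) \<partial>exit_law z 0)"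
      using pos nn2 by (simp add: nn_integral_cmult[symmetric] ennreal_mult''[symmetric])
    also have "\<dots> \<le> ennreal (1 / exp_prod (- t) z) * ennreal (1 / exp_prod (- (- t)) z)"
      using tnn by (intro mult_left_mono nn_integral_exit_law_exp_prod nn2) (auto intro!: add_pos_nonneg)
    also have "\<dots> = ennreal (1 / (exp_prod t z * exp_prod (- t) z))"
      using pos by (simp add: ennreal_mult''[symmetric] mult.commute)
    finally show ?thesis .
  qed
  have "(\<integral>\<^sup>+ y. ennreal (exp (\<bar>real y - real z\<bar> / (6 * sqrt z))) \<partial>exit_law z 0)
      \<le> (\<integral>\<^sup>+ y. ennreal (exp_prod t y / exp_prod t z) + ennreal (exp_prod (- t) y / exp_prod (- t) z) \<partial>exit_law z 0)"
    using nn1 nn2 by (intro nn_integral_mono) (simp add: ennreal_plus[symmetric] bound del: ennreal_plus)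
  also have "\<dots> \<le> ennreal (1 / (exp_prod t z * exp_prod (- t) z)) + ennreal (1 / (exp_prod t z * exp_prod (- t) z))"
    using i1 i2 by (simp add: nn_integral_add add_mono)
  also have "\<dots> = ennreal (2 / (exp_prod t z * exp_prod (- t) z))"
    using pos by (simp flip: ennreal_plus)
  also have "\<dots> \<le> ennreal 3"
    using prod pos by (intro ennreal_leI) (simp add: divide_le_eq)
  finally show ?thesis .
qed

lemma power_le_fact_mult_exp:
  fixes x :: real
  assumes "0 \<le> x"
  shows "x ^ n \<le> fact n * exp x"
proof -
  have "(\<Sum>k\<in>{n}. x ^ k /\<^sub>R fact k) \<le> (\<Sum>k. x ^ k /\<^sub>R fact k)"
    using assms by (intro sum_le_suminf summable_exp_generic) auto
  then show ?thesis
    by (simp add: exp_def field_simps)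
qed

text \<open>From \<open>u^N \<le> N! exp u\<close> with \<open>u = |y - z| / (6 sqrt z)\<close>: in
  every moment the deviation is at most of order \<open>sqrt z\<close>.\<close>

lemma exit_law_abs_moment:
  assumes z: "1 \<le> z"
  shows "integrable (exit_law z 0) (\<lambda>y. \<bar>real y - real z\<bar> ^ N)"
    and "measure_pmf.expectation (exit_law z 0) (\<lambda>y. \<bar>real y - real z\<bar> ^ N)
           \<le> 3 * fact N * 6 ^ N * sqrt z ^ N"
proof -
  define B where "B = fact N * (6 * sqrt z) ^ N"
  have B: "0 \<le> B" by (simp add: B_def)
  have "\<bar>real y - real z\<bar> ^ N \<le> B * exp (\<bar>real y - real z\<bar> / (6 * sqrt z))" for y
    using power_le_fact_mult_exp[of "\<bar>real y - real z\<bar> / (6 * sqrt z)" N] z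
    by (simp add: B_def power_divide field_simps)
  then have "(\<integral>\<^sup>+ y. ennreal (\<bar>real y - real z\<bar> ^ N) \<partial>exit_law z 0)
     \<le> (\<integral>\<^sup>+ y. ennreal B * ennreal (exp (\<bar>real y - real z\<bar> / (6 * sqrt z))) \<partial>exit_law z 0)"
    using B by (intro nn_integral_mono) (auto simp flip: ennreal_mult)
  also have "\<dots> \<le> ennreal B * ennreal 3"
    using exit_law_exp_moment[OF z] by (simp add: nn_integral_cmult mult_left_mono)
  also have "\<dots> = ennreal (3 * fact N * 6 ^ N * sqrt z ^ N)"
    unfolding ennreal_mult'[OF B, symmetric] by (simp only: B_def power_mult_distrib mult_ac)
  finally have *: "(\<integral>\<^sup>+ y. ennreal (\<bar>real y - real z\<bar> ^ N) \<partial>exit_law z 0)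
      \<le> ennreal (3 * fact N * 6 ^ N * sqrt z ^ N)" .
  show i: "integrable (exit_law z 0) (\<lambda>y. \<bar>real y - real z\<bar> ^ N)"
    using le_less_trans[OF *] by (intro integrableI_nonneg) auto
  show "measure_pmf.expectation (exit_law z 0) (\<lambda>y. \<bar>real y - real z\<bar> ^ N)
           \<le> 3 * fact N * 6 ^ N * sqrt z ^ N"
    using * by (subst (asm) nn_integral_eq_integral[OF i]) auto
qed

section \<open>Moments of one step of the embedded chain\<close>

lemma integral_eq_of_nn_integral:
  fixes f :: "'a \<Rightarrow> real"
  assumes "integrable M f" "\<And>x. 0 \<le> f x" "0 \<le> r" "(\<integral>\<^sup>+ x. ennreal (f x) \<partial>M) = ennreal r"
  shows "integral\<^sup>L M f = r"
  using assms by (simp add: nn_integral_eq_integral integral_nonneg_AE)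

section \<open>Moments of the exit law about \<open>z\<close>\<close>

definition exit_moment :: "nat \<Rightarrow> nat \<Rightarrow> real" where
  "exit_moment N z = measure_pmf.expectation (exit_law z 0) (\<lambda>y. (real y - real z) ^ N)"

lemma integrable_exit_power:
  assumes "1 \<le> z"
  shows "integrable (exit_law z 0) (\<lambda>y. (real y - real z) ^ N)"
  by (rule Bochner_Integration.integrable_bound[OF exit_law_abs_moment(1)[OF assms, of N]])
     (auto simp: power_abs)

lemma abs_exit_moment_le:
  assumes "1 \<le> z"
  shows "\<bar>exit_moment N z\<bar> \<le> 3 * fact N * 6 ^ N * sqrt z ^ N"
proof -
  have "\<bar>exit_moment N z\<bar> \<le> measure_pmf.expectation (exit_law z 0) (\<lambda>y. \<bar>(real y - real z) ^ N\<bar>)"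
    unfolding exit_moment_def by (rule integral_abs_bound)
  then show ?thesis
    using exit_law_abs_moment(2)[OF assms, of N] by (simp add: power_abs)
qed

lemma exit_moment_0: "exit_moment 0 z = 1"
  by (simp add: exit_moment_def)

lemma exit_moment_combination:
  assumes "1 \<le> z"
  shows "integrable (exit_law z 0) (\<lambda>y. \<Sum>N\<le>n. w N * (real y - real z) ^ N)"
    and "measure_pmf.expectation (exit_law z 0) (\<lambda>y. \<Sum>N\<le>n. w N * (real y - real z) ^ N)
         = (\<Sum>N\<le>n. w N * exit_moment N z)"
proof -
  show "integrable (exit_law z 0) (\<lambda>y. \<Sum>N\<le>n. w N * (real y - real z) ^ N)"
    by (intro Bochner_Integration.integrable_sum integrable_mult_right integrable_exit_power assms)
  show "measure_pmf.expectation (exit_law z 0) (\<lambda>y. \<Sum>N\<le>n. w N * (real y - real z) ^ N)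
         = (\<Sum>N\<le>n. w N * exit_moment N z)"
    unfolding exit_moment_def
    by (subst Bochner_Integration.integral_sum)
       (auto intro!: integrable_mult_right integrable_exit_power assms)
qed

text \<open>Expanding \<open>E y (y + 1) = z (z + 1)\<close> about \<open>z\<close> leaves
  \<open>(2 z + 1) m1 + m2 = 0\<close>: the second moment determines the mean displacement.\<close>

lemma exit_moment_1:
  assumes z: "1 \<le> z"
  shows "exit_moment 1 z = - exit_moment 2 z / (2 * real z + 1)"
proof -
  define w where "w = (\<lambda>N::nat. if N = 0 then real z * (real z + 1) else if N = 1 then 2 * real z + 1 else 1)"
  have eq: "real y * (real y + 1) = (\<Sum>N\<le>2. w N * (real y - real z) ^ N)" for y
    by (simp add: w_def numeral_eq_Suc algebra_simps)
  have "measure_pmf.expectation (exit_law z 0) (\<lambda>y. real y * (real y + 1)) = real z * (real z + 1)"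
  proof (rule integral_eq_of_nn_integral[OF _ _ _ nn_integral_exit_law_quadratic])
    show "integrable (exit_law z 0) (\<lambda>y. real y * (real y + 1))"
      unfolding eq by (rule exit_moment_combination(1)[OF z])
  qed auto
  then have "(\<Sum>N\<le>2. w N * exit_moment N z) = real z * (real z + 1)"
    unfolding eq exit_moment_combination(2)[OF z] .
  then have "(2 * real z + 1) * exit_moment 1 z + exit_moment 2 z = 0"
    by (simp add: w_def numeral_eq_Suc exit_moment_0)
  then show ?thesis by (simp add: field_simps)
qed

text \<open>The quartic identity expanded about \<open>z\<close>, with the first moment eliminated.
  As the moment of order \<open>N\<close> is \<open>O(z^(N/2))\<close>, every term on the right
  except \<open>4/3 A s\<close> is \<open>O(z^(5/2))\<close>, while \<open>A s\<close> is of order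
  \<open>z^3\<close>.\<close>

lemma exit_moment_2:
  fixes z :: nat
  assumes z: "1 \<le> z"
  defines "s \<equiv> 2 * real z + 1" and "A \<equiv> real z * (real z + 1)"
  shows "exit_moment 2 z * s\<^sup>2 = 4 / 3 * A * s + 2 * s * exit_moment 2 z
     - 2 / 3 * (6 * A + 1) * exit_moment 2 z / s - (2 * s - 4 / 3) * exit_moment 3 z - exit_moment 4 z"
proof -
  \<comment> \<open>The Taylor coefficients of \<open>quartic 0\<close> at \<open>z\<close>.\<close>
  define w where "w = (\<lambda>N::nat. if N = 0 then A\<^sup>2 - 2 / 3 * A * s else
     if N = 1 then 2 * A * s - 2 / 3 * (6 * A + 1) else
     if N = 2 then 2 * A + s\<^sup>2 - 2 * s else if N = 3 then 2 * s - 4 / 3 else 1)"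
  have eq: "quartic 0 (real y) = (\<Sum>N\<le>4. w N * (real y - real z) ^ N)" for y
  proof -
    have "(\<Sum>N\<le>4. w N * (real y - real z) ^ N) = A\<^sup>2 - 2 / 3 * A * s
      + (2 * A * s - 2 / 3 * (6 * A + 1)) * (real y - real z)
      + (2 * A + s\<^sup>2 - 2 * s) * (real y - real z) ^ 2 + (2 * s - 4 / 3) * (real y - real z) ^ 3
      + (real y - real z) ^ 4"
      by (simp add: w_def numeral_eq_Suc)
    then show ?thesis
      unfolding quartic_def A_def s_def by algebra
  qed
  have "measure_pmf.expectation (exit_law z 0) (\<lambda>y. quartic 0 (real y)) = quartic (real z) 0"
  proof (rule integral_eq_of_nn_integral[OF _ _ _ nn_integral_exit_law_quartic])
    show "integrable (exit_law z 0) (\<lambda>y. quartic 0 (real y))"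
      unfolding eq by (rule exit_moment_combination(1)[OF z])
  qed (use quartic_nonneg[of 0] quartic_nonneg[of z 0] in auto)
  then have "(\<Sum>N\<le>4. w N * exit_moment N z) = quartic (real z) 0"
    unfolding eq exit_moment_combination(2)[OF z] .
  moreover have "(\<Sum>N\<le>4. w N * exit_moment N z) = A\<^sup>2 - 2 / 3 * A * s
      + (2 * A * s - 2 / 3 * (6 * A + 1)) * exit_moment 1 z
      + (2 * A + s\<^sup>2 - 2 * s) * exit_moment 2 z + (2 * s - 4 / 3) * exit_moment 3 z
      + exit_moment 4 z"
    by (simp add: w_def numeral_eq_Suc exit_moment_0)
  moreover have "quartic (real z) 0 = A\<^sup>2 + 2 / 3 * A * s"
    unfolding quartic_def A_def s_def by algebra
  ultimately have e: "(2 * A * s - 2 / 3 * (6 * A + 1)) * exit_moment 1 z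
      + (2 * A + s\<^sup>2 - 2 * s) * exit_moment 2 z + (2 * s - 4 / 3) * exit_moment 3 z
      + exit_moment 4 z = 4 / 3 * A * s"
    by linarith
  have s: "s \<noteq> 0" unfolding s_def by linarith
  have m1: "exit_moment 1 z = - (exit_moment 2 z / s)"
    using exit_moment_1[OF z] by (simp add: s_def)
  have "(2 * A * s - 2 / 3 * (6 * A + 1)) * exit_moment 1 z
      = - (2 * A * exit_moment 2 z) + 2 / 3 * (6 * A + 1) * exit_moment 2 z / s"
    unfolding m1 using s by (simp add: field_simps)
  then show ?thesis using e by (simp add: algebra_simps)
qed

lemma exit_moment_2_tendsto: "(\<lambda>z. exit_moment 2 z / real z) \<longlonglongrightarrow> 2 / 3"
proof -
  let ?s = "\<lambda>z::nat. 2 * real z + 1" and ?A = "\<lambda>z::nat. real z * (real z + 1)"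
  define K2 K3 K4 :: real where "K2 = 3 * fact 2 * 6 ^ 2" and "K3 = 3 * fact 3 * 6 ^ 3" and "K4 = 3 * fact 4 * 6 ^ 4"
  have K: "0 < K2" "0 < K3" "0 < K4" by (auto simp: K2_def K3_def K4_def)
  \<comment> \<open>The total of the lower-order terms relative to \<open>s^2 z\<close>; it is of
    order \<open>1 / sqrt z\<close>.\<close>
  define R where "R = (\<lambda>z::nat. (2 * ?s z * (K2 * sqrt z ^ 2) + 2 / 3 * (6 * ?A z + 1) * (K2 * sqrt z ^ 2) / ?s z
      + (2 * ?s z) * (K3 * sqrt z ^ 3) + K4 * sqrt z ^ 4) / ((?s z)\<^sup>2 * real z))"
  have bound: "\<bar>exit_moment 2 z / real z - 4 / 3 * ?A z / (?s z * real z)\<bar> \<le> R z" if z: "1 \<le> z" for z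
  proof -
    define s A where "s = ?s z" and "A = ?A z"
    have s: "1 \<le> s" "0 \<le> A" by (auto simp: s_def A_def)
    define r where "r = 2 * s * exit_moment 2 z - 2 / 3 * (6 * A + 1) * exit_moment 2 z / s
        - (2 * s - 4 / 3) * exit_moment 3 z - exit_moment 4 z"
    have noise_mean: "\<bar>exit_moment 2 z\<bar> \<le> K2 * sqrt z ^ 2" "\<bar>exit_moment 3 z\<bar> \<le> K3 * sqrt z ^ 3"
      "\<bar>exit_moment 4 z\<bar> \<le> K4 * sqrt z ^ 4"
      unfolding K2_def K3_def K4_def by (intro abs_exit_moment_le z)+
    have "exit_moment 2 z * s\<^sup>2 = 4 / 3 * A * s + r"
      using exit_moment_2[OF z] unfolding r_def s_def A_def by linarith
    then have "exit_moment 2 z = (4 / 3 * A * s + r) / s\<^sup>2"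
      using s by (simp add: eq_divide_eq)
    then have "exit_moment 2 z / real z - 4 / 3 * A / (s * real z) = r / (s\<^sup>2 * real z)"
      using s by (simp add: add_divide_distrib power2_eq_square)
    then have "\<bar>exit_moment 2 z / real z - 4 / 3 * A / (s * real z)\<bar> = \<bar>r\<bar> / (s\<^sup>2 * real z)"
      by (simp add: abs_mult)
    also have "\<bar>r\<bar> \<le> \<bar>2 * s * exit_moment 2 z\<bar> + \<bar>2 / 3 * (6 * A + 1) * exit_moment 2 z / s\<bar>
        + \<bar>(2 * s - 4 / 3) * exit_moment 3 z\<bar> + \<bar>exit_moment 4 z\<bar>"
      unfolding r_def by linarith
    also have "\<dots> \<le> 2 * s * (K2 * sqrt z ^ 2) + 2 / 3 * (6 * A + 1) * (K2 * sqrt z ^ 2) / s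
      + (2 * s) * (K3 * sqrt z ^ 3) + K4 * sqrt z ^ 4"
    proof (intro add_mono)
      show "\<bar>2 * s * exit_moment 2 z\<bar> \<le> 2 * s * (K2 * sqrt z ^ 2)"
        using s noise_mean by (simp add: abs_mult)
      have "\<bar>2 / 3 * (6 * A + 1) * exit_moment 2 z / s\<bar> = 2 / 3 * (6 * A + 1) * \<bar>exit_moment 2 z\<bar> / s"
        using s by (simp add: abs_mult)
      also have "\<dots> \<le> 2 / 3 * (6 * A + 1) * (K2 * sqrt z ^ 2) / s"
        using s noise_mean by (intro divide_right_mono mult_left_mono) auto
      finally show "\<bar>2 / 3 * (6 * A + 1) * exit_moment 2 z / s\<bar> \<le> 2 / 3 * (6 * A + 1) * (K2 * sqrt z ^ 2) / s" .
      show "\<bar>(2 * s - 4 / 3) * exit_moment 3 z\<bar> \<le> (2 * s) * (K3 * sqrt z ^ 3)"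
        unfolding abs_mult using s noise_mean by (intro mult_mono) auto
    qed (rule noise_mean)
    finally show ?thesis
      unfolding R_def s_def[symmetric] A_def[symmetric] by (simp add: divide_right_mono)
  qed
  have "R \<longlonglongrightarrow> 0"
    unfolding R_def using K by real_asymp
  then have "(\<lambda>z. exit_moment 2 z / real z - 4 / 3 * ?A z / (?s z * real z)) \<longlonglongrightarrow> 0"
    by (rule Lim_null_comparison[rotated]) (rule eventually_sequentiallyI[of 1], unfold real_norm_def, rule bound)
  moreover have "(\<lambda>z. 4 / 3 * ?A z / (?s z * real z)) \<longlonglongrightarrow> 2 / 3"
    by real_asymp
  ultimately have "(\<lambda>z. (exit_moment 2 z / real z - 4 / 3 * ?A z / (?s z * real z))
       + 4 / 3 * ?A z / (?s z * real z)) \<longlonglongrightarrow> 0 + 2 / 3"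
    by (rule tendsto_add)
  then show ?thesis by simp
qed

lemma exit_moment_1_tendsto: "exit_moment 1 \<longlonglongrightarrow> - (1 / 3)"
proof -
  have "(\<lambda>z. real z / (2 * real z + 1)) \<longlonglongrightarrow> 1 / 2" by real_asymp
  from tendsto_mult[OF exit_moment_2_tendsto this]
  have "(\<lambda>z. - (exit_moment 2 z / real z * (real z / (2 * real z + 1)))) \<longlonglongrightarrow> - (2 / 3 * (1 / 2))"
    by (rule tendsto_minus)
  moreover have "\<forall>\<^sub>F z in sequentially. - (exit_moment 2 z / real z * (real z / (2 * real z + 1))) = exit_moment 1 z"
    using eventually_ge_at_top[of 1] by eventually_elim (simp add: exit_moment_1 del: One_nat_def)
  ultimately show ?thesis
    by (auto elim: Lim_transform_eventually)
qed

section \<open>The transition kernel of the embedded chain\<close>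

text \<open>On the axis the nonzero coordinate has modulus \<open>c + 1\<close>; this shift
  contributes \<open>+ 1\<close> to the drift.\<close>

definition noisy_restart :: "nat \<Rightarrow> int \<Rightarrow> nat" where
  "noisy_restart c k = nat (max 1 (int c + 1 - k))"

lemma noisy_restart_ge_1: "1 \<le> noisy_restart c k"
  by (simp add: noisy_restart_def)

text \<open>A restart with value \<open>z\<close> leaves the moduli \<open>z\<close>, about to
  decrease, and 1, about to increase; this is the state \<open>a = z\<close>,
  \<open>c = 0\<close>.\<close>

definition urn_kernel :: "int pmf \<Rightarrow> nat \<Rightarrow> nat pmf" where
  "urn_kernel \<kappa> z = map_pmf (\<lambda>(c, k). noisy_restart c k) (pair_pmf (exit_law z 0) \<kappa>)"

lemma urn_kernel_ge_1: "z' \<in> set_pmf (urn_kernel \<kappa> z) \<Longrightarrow> 1 \<le> z'"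
  using noisy_restart_ge_1 by (auto simp: urn_kernel_def)

lemma real_noisy_restart:
  "real (noisy_restart c k) - real z = (real c - real z) + (1 - real_of_int k + max 0 (real_of_int k - real c))"
  by (auto simp: noisy_restart_def max_def)

lemma abs_noisy_restart_le:
  assumes "1 \<le> z"
  shows "\<bar>real (noisy_restart c k) - real z\<bar> \<le> \<bar>real c - real z\<bar> + (1 + \<bar>real_of_int k\<bar>)"
  using assms by (auto simp: noisy_restart_def max_def)

locale urn_noise =
  fixes \<kappa> :: "int pmf"
  assumes exp_moment: "\<exists>\<theta>>0. integrable (measure_pmf \<kappa>) (\<lambda>k. exp (\<theta> * real_of_int \<bar>k\<bar>))"
begin

definition noise_mean where "noise_mean = measure_pmf.expectation \<kappa> real_of_int"

lemma integrable_noise_power: "integrable \<kappa> (\<lambda>k. (1 + \<bar>real_of_int k\<bar>) ^ N)"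
proof -
  obtain \<theta> where t: "0 < \<theta>" and i: "integrable \<kappa> (\<lambda>k. exp (\<theta> * real_of_int \<bar>k\<bar>))"
    using exp_moment by blast
  have "(1 + \<bar>real_of_int k\<bar>) ^ N \<le> fact N / \<theta> ^ N * exp \<theta> * exp (\<theta> * real_of_int \<bar>k\<bar>)" for k
    using power_le_fact_mult_exp[of "\<theta> * (1 + \<bar>real_of_int k\<bar>)" N] t
    unfolding power_mult_distrib by (simp add: field_simps exp_add)
  then show ?thesis
    using t by (intro Bochner_Integration.integrable_bound[OF integrable_mult_right[OF i, of "fact N / \<theta> ^ N * exp \<theta>"]])
      auto
qed

lemma integrable_noise: "integrable \<kappa> real_of_int"
  by (rule Bochner_Integration.integrable_bound[OF integrable_noise_power[of 1]]) auto

text \<open>\<open>1 + |k|\<close> bounds the distance from \<open>c\<close> to the restart value,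
  whether or not the floor at 1 is active.\<close>

definition noise_moment where
  "noise_moment N = measure_pmf.expectation \<kappa> (\<lambda>k. (1 + \<bar>real_of_int k\<bar>) ^ N)"

lemma noise_moment_nonneg: "0 \<le> noise_moment N"
  unfolding noise_moment_def by (intro integral_nonneg_AE) auto

abbreviation "P \<equiv> urn_kernel \<kappa>"
abbreviation "J z \<equiv> pair_pmf (exit_law z 0) \<kappa>"

lemma integrable_J_fst: "integrable (exit_law z 0) f \<Longrightarrow> integrable (J z) (\<lambda>x. f (fst x))" for f :: "nat \<Rightarrow> real"
  by (subst (asm) map_fst_pair_pmf[of "exit_law z 0" \<kappa>, symmetric]) simp

lemma integrable_J_snd: "integrable \<kappa> f \<Longrightarrow> integrable (J z) (\<lambda>x. f (snd x))" for f :: "int \<Rightarrow> real"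
  by (subst (asm) map_snd_pair_pmf[of "exit_law z 0" \<kappa>, symmetric]) simp

lemma kernel_increment_power:
  assumes z: "1 \<le> z"
  shows "integrable (P z) (\<lambda>z'. \<bar>real z' - real z\<bar> ^ N)"
    and "measure_pmf.expectation (P z) (\<lambda>z'. \<bar>real z' - real z\<bar> ^ N)
       \<le> 2 ^ N * (3 * fact N * 6 ^ N + noise_moment N) * sqrt z ^ N"
proof -
  let ?g = "\<lambda>x. 2 ^ N * (\<bar>real (fst x) - real z\<bar> ^ N + (1 + \<bar>real_of_int (snd x)\<bar>) ^ N)"
  have le: "\<bar>real (noisy_restart c k) - real z\<bar> ^ N \<le> ?g (c, k)" for c k
  proof -
    define u v where "u = \<bar>real c - real z\<bar>" and "v = 1 + \<bar>real_of_int k\<bar>"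
    have uv: "0 \<le> u" "0 \<le> v" by (auto simp: u_def v_def)
    have "\<bar>real (noisy_restart c k) - real z\<bar> ^ N \<le> (u + v) ^ N"
      unfolding u_def v_def using abs_noisy_restart_le[OF z] by (intro power_mono) auto
    also have "\<dots> \<le> (2 * max u v) ^ N"
      using uv by (intro power_mono) auto
    also have "\<dots> \<le> 2 ^ N * (u ^ N + v ^ N)"
      using uv by (auto simp: power_mult_distrib max_def)
    finally show ?thesis by (simp add: u_def v_def)
  qed
  have i1: "integrable (J z) (\<lambda>x. \<bar>real (fst x) - real z\<bar> ^ N)"
    by (rule integrable_J_fst[OF exit_law_abs_moment(1)[OF z]])
  have i2: "integrable (J z) (\<lambda>x. (1 + \<bar>real_of_int (snd x)\<bar>) ^ N)"
    by (rule integrable_J_snd[OF integrable_noise_power])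
  have ig: "integrable (J z) ?g"
    by (intro integrable_mult_right Bochner_Integration.integrable_add i1 i2)
  have ih: "integrable (J z) (\<lambda>x. \<bar>real (noisy_restart (fst x) (snd x)) - real z\<bar> ^ N)"
    using le by (intro Bochner_Integration.integrable_bound[OF ig]) (auto simp: case_prod_unfold)
  then show "integrable (P z) (\<lambda>z'. \<bar>real z' - real z\<bar> ^ N)"
    by (simp add: urn_kernel_def case_prod_unfold)
  have "measure_pmf.expectation (P z) (\<lambda>z'. \<bar>real z' - real z\<bar> ^ N)
      = measure_pmf.expectation (J z) (\<lambda>x. \<bar>real (noisy_restart (fst x) (snd x)) - real z\<bar> ^ N)"
    by (simp add: urn_kernel_def case_prod_unfold)
  also have "\<dots> \<le> measure_pmf.expectation (J z) ?g"
    using le by (intro integral_mono ih ig) auto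
  also have "\<dots> = 2 ^ N * (measure_pmf.expectation (J z) (\<lambda>x. \<bar>real (fst x) - real z\<bar> ^ N)
      + measure_pmf.expectation (J z) (\<lambda>x. (1 + \<bar>real_of_int (snd x)\<bar>) ^ N))"
    using i1 i2 by simp
  also have "\<dots> = 2 ^ N * (measure_pmf.expectation (exit_law z 0) (\<lambda>y. \<bar>real y - real z\<bar> ^ N) + noise_moment N)"
    unfolding noise_moment_def
    using expectation_pair_pmf_fst[of "exit_law z 0" \<kappa> "\<lambda>y. \<bar>real y - real z\<bar> ^ N"]
      expectation_pair_pmf_snd[of "exit_law z 0" \<kappa> "\<lambda>k. (1 + \<bar>real_of_int k\<bar>) ^ N"] by simp
  also have "\<dots> \<le> 2 ^ N * (3 * fact N * 6 ^ N * sqrt z ^ N + noise_moment N * sqrt z ^ N)"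
    using exit_law_abs_moment(2)[OF z, of N] z noise_moment_nonneg[of N]
    by (intro mult_left_mono add_mono) (auto simp: mult_le_cancel_left1 one_le_power)
  finally show "measure_pmf.expectation (P z) (\<lambda>z'. \<bar>real z' - real z\<bar> ^ N)
       \<le> 2 ^ N * (3 * fact N * 6 ^ N + noise_moment N) * sqrt z ^ N"
    by (simp add: algebra_simps)
qed

definition drift where "drift z = measure_pmf.expectation (P z) (\<lambda>z'. real z' - real z)"
definition spread where "spread z = measure_pmf.expectation (P z) (\<lambda>z'. (real z' - real z)\<^sup>2)"

lemma integrable_kernel_increment:
  "1 \<le> z \<Longrightarrow> integrable (P z) (\<lambda>z'. real z' - real z)"
  "1 \<le> z \<Longrightarrow> integrable (P z) (\<lambda>z'. (real z' - real z)\<^sup>2)"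
proof -
  assume z: "1 \<le> z"
  show "integrable (P z) (\<lambda>z'. real z' - real z)"
    by (rule Bochner_Integration.integrable_bound[OF kernel_increment_power(1)[OF z, of 1]]) auto
  show "integrable (P z) (\<lambda>z'. (real z' - real z)\<^sup>2)"
    using kernel_increment_power(1)[OF z, of 2] by simp
qed

text \<open>The left side is the effect of the floor at 1. It is positive only if
  \<open>k > c\<close>, and then either \<open>c \<ge> z/2\<close> and the noise exceeds
  \<open>z/2\<close>, or the exit position deviates from \<open>z\<close> by more than
  \<open>z/2\<close>. The right side involves only squares of the noise and of the deviation, and
  its mean tends to 0.\<close>

lemma truncation_le:
  assumes "1 \<le> z"
  shows "max 0 (real_of_int k - real c)
     \<le> 2 * (1 + \<bar>real_of_int k\<bar>)\<^sup>2 / real z + ((1 + \<bar>real_of_int k\<bar>)\<^sup>2 + (real c - real z)\<^sup>2 / real z) / sqrt z"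
proof (cases "real_of_int k \<le> real c")
  case False
  define x where "x = 1 + \<bar>real_of_int k\<bar>"
  have x: "real_of_int k - real c \<le> x" "1 \<le> x" "real c \<le> x" using False by (auto simp: x_def)
  have sq: "0 < sqrt z" "sqrt z * sqrt z = real z" using assms by auto
  show ?thesis
  proof (cases "real z \<le> 2 * real c")
    case True
    have "x * real z \<le> x * (2 * x)"
      using True x by (intro mult_left_mono) auto
    then have "x \<le> 2 * x\<^sup>2 / real z"
      using assms by (simp add: field_simps power2_eq_square)
    then have "x \<le> 2 * x\<^sup>2 / real z + (x\<^sup>2 + (real c - real z)\<^sup>2 / real z) / sqrt z"
      using assms by (intro order_trans[OF _ add_increasing2]) auto
    with x False show ?thesis by (simp add: x_def)
  next
    case c: False
    define d where "d = real z - real c"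
    have d: "real z \<le> 2 * d" "0 \<le> d" using c by (auto simp: d_def)
    have "2 * (x * sqrt z) * d \<le> (x * sqrt z)\<^sup>2 + d\<^sup>2"
      by (rule sum_squares_bound)
    moreover have "(x * sqrt z) * real z \<le> (x * sqrt z) * (2 * d)"
      using d x by (intro mult_left_mono) auto
    ultimately have "x * sqrt z * real z \<le> x\<^sup>2 * real z + d\<^sup>2"
      using sq by (simp add: power_mult_distrib)
    then have "x * sqrt z \<le> x\<^sup>2 + d\<^sup>2 / real z"
      using assms by (simp add: field_simps)
    then have "x \<le> (x\<^sup>2 + (real c - real z)\<^sup>2 / real z) / sqrt z"
      using sq by (simp add: d_def field_simps power2_commute)
    then have "x \<le> 2 * x\<^sup>2 / real z + (x\<^sup>2 + (real c - real z)\<^sup>2 / real z) / sqrt z"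
      by (intro order_trans[OF _ add_increasing]) auto
    with x False show ?thesis by (simp add: x_def)
  qed
qed (auto intro!: add_nonneg_nonneg)

lemma expectation_J_fst: "measure_pmf.expectation (J z) (\<lambda>x. f (fst x)) = measure_pmf.expectation (exit_law z 0) f"
  for f :: "nat \<Rightarrow> real"
  by simp

lemma expectation_J_snd: "measure_pmf.expectation (J z) (\<lambda>x. f (snd x)) = measure_pmf.expectation \<kappa> f"
  for f :: "int \<Rightarrow> real"
  by simp

text \<open>The limit collects \<open>- 1/3\<close> from the exit law, \<open>+ 1\<close> from the
  restart at \<open>c + 1 - k\<close> and \<open>- E \<kappa>\<close> from the noise; the floor at 1
  contributes \<open>O(1 / sqrt z)\<close>.\<close>

lemma drift_tendsto: "drift \<longlonglongrightarrow> 2 / 3 - noise_mean"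
proof -
  define R where "R = (\<lambda>z::nat. 2 * noise_moment 2 / real z + (noise_moment 2 + exit_moment 2 z / real z) / sqrt z)"
  have bound: "\<bar>drift z - (exit_moment 1 z + 1 - noise_mean)\<bar> \<le> R z" if z: "1 \<le> z" for z
  proof -
    let ?e = "\<lambda>x. max 0 (real_of_int (snd x) - real (fst x))"
    let ?g = "\<lambda>x. 2 * (1 + \<bar>real_of_int (snd x)\<bar>)\<^sup>2 / real z
        + ((1 + \<bar>real_of_int (snd x)\<bar>)\<^sup>2 + (real (fst x) - real z)\<^sup>2 / real z) / sqrt z"
    have i1: "integrable (J z) (\<lambda>x. real (fst x) - real z)"
      using integrable_J_fst[OF integrable_exit_power[OF z, of 1]] by simp
    have i2: "integrable (J z) (\<lambda>x. real_of_int (snd x))"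
      by (rule integrable_J_snd[OF integrable_noise])
    have i3: "integrable (J z) (\<lambda>x. (1 + \<bar>real_of_int (snd x)\<bar>)\<^sup>2)"
      by (rule integrable_J_snd[OF integrable_noise_power])
    have i4: "integrable (J z) (\<lambda>x. (real (fst x) - real z)\<^sup>2)"
      by (rule integrable_J_fst[OF integrable_exit_power[OF z]])
    have ig: "integrable (J z) ?g"
      using i3 i4 by simp
    have ie: "integrable (J z) ?e"
      using truncation_le[OF z] by (intro Bochner_Integration.integrable_bound[OF ig]) (auto simp: order_trans[OF _ abs_ge_self])
    have "drift z = measure_pmf.expectation (J z) (\<lambda>x. (real (fst x) - real z) + (1 - real_of_int (snd x) + ?e x))"
      by (simp add: drift_def urn_kernel_def case_prod_unfold real_noisy_restart)
    also have "\<dots> = measure_pmf.expectation (J z) (\<lambda>x. real (fst x) - real z)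
        + (1 - measure_pmf.expectation (J z) (\<lambda>x. real_of_int (snd x)) + measure_pmf.expectation (J z) ?e)"
      using i1 i2 ie by simp
    also have "measure_pmf.expectation (J z) (\<lambda>x. real (fst x) - real z) = exit_moment 1 z"
      unfolding exit_moment_def using expectation_J_fst[of z "\<lambda>y. real y - real z"] by simp
    also have "measure_pmf.expectation (J z) (\<lambda>x. real_of_int (snd x)) = noise_mean"
      unfolding noise_mean_def by (rule expectation_J_snd)
    finally have d: "drift z - (exit_moment 1 z + 1 - noise_mean) = measure_pmf.expectation (J z) ?e" by simp
    have "measure_pmf.expectation (J z) ?e \<le> measure_pmf.expectation (J z) ?g"
      using truncation_le[OF z] by (intro integral_mono ie ig) auto
    also have "\<dots> = R z"
      unfolding R_def noise_moment_def exit_moment_def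
      using i3 i4 expectation_J_snd[of z "\<lambda>k. (1 + \<bar>real_of_int k\<bar>)\<^sup>2"]
        expectation_J_fst[of z "\<lambda>y. (real y - real z)\<^sup>2"] by simp
    finally have "measure_pmf.expectation (J z) ?e \<le> R z" .
    moreover have "0 \<le> measure_pmf.expectation (J z) ?e"
      by (intro integral_nonneg_AE) auto
    ultimately show ?thesis using d by simp
  qed
  have s: "(\<lambda>z::nat. 1 / sqrt z) \<longlonglongrightarrow> 0" "(\<lambda>z::nat. 2 * noise_moment 2 / real z) \<longlonglongrightarrow> 0"
    by real_asymp+
  have "(\<lambda>z. 2 * noise_moment 2 / real z + (noise_moment 2 + exit_moment 2 z / real z) * (1 / sqrt z))
      \<longlonglongrightarrow> 0 + (noise_moment 2 + 2 / 3) * 0"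
    by (intro tendsto_intros s exit_moment_2_tendsto)
  then have "R \<longlonglongrightarrow> 0" by (simp add: R_def)
  then have 1: "(\<lambda>z. drift z - (exit_moment 1 z + 1 - noise_mean)) \<longlonglongrightarrow> 0"
    by (rule Lim_null_comparison[rotated]) (rule eventually_sequentiallyI[of 1], unfold real_norm_def, rule bound)
  have "(\<lambda>z. (drift z - (exit_moment 1 z + 1 - noise_mean)) + (exit_moment 1 z + 1 - noise_mean)) \<longlonglongrightarrow> 0 + (- (1/3) + 1 - noise_mean)"
    by (intro tendsto_intros 1 exit_moment_1_tendsto)
  then show ?thesis by simp
qed

text \<open>The restart changes the deviation \<open>d\<close> by some \<open>w\<close> with
  \<open>|w| \<le> 1 + |k|\<close>. Splitting the cross term as
  \<open>2 |d| |w| \<le> d^2 / sqrt z + w^2 sqrt z\<close> makes both halves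
  \<open>O(sqrt z)\<close> in mean, negligible against \<open>z\<close>.\<close>

lemma spread_tendsto: "(\<lambda>z. spread z / real z) \<longlonglongrightarrow> 2 / 3"
proof -
  define R where "R = (\<lambda>z::nat. exit_moment 2 z / real z / sqrt z + noise_moment 2 * (sqrt z + 1) / real z)"
  have bound: "\<bar>spread z / real z - exit_moment 2 z / real z\<bar> \<le> R z" if z: "1 \<le> z" for z
  proof -
    let ?D = "\<lambda>x. real (fst x) - real z" and ?h = "\<lambda>x. real (noisy_restart (fst x) (snd x)) - real z"
    let ?g = "\<lambda>x. (?D x)\<^sup>2 / sqrt z + (1 + \<bar>real_of_int (snd x)\<bar>)\<^sup>2 * (sqrt z + 1)"
    have sq: "0 < sqrt z" "sqrt z * sqrt z = real z" using z by auto
    have le: "\<bar>(?h x)\<^sup>2 - (?D x)\<^sup>2\<bar> \<le> ?g x" for x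
    proof -
      define d w v where "d = ?D x" and "w = ?h x - ?D x" and "v = 1 + \<bar>real_of_int (snd x)\<bar>"
      have "\<bar>w\<bar> \<le> v"
        by (auto simp: w_def v_def noisy_restart_def max_def)
      then have w: "\<bar>w\<bar> * \<bar>w\<bar> \<le> v\<^sup>2"
        unfolding power2_eq_square by (intro mult_mono) auto
      have "2 * \<bar>d\<bar> * (\<bar>w\<bar> * sqrt z) \<le> \<bar>d\<bar>\<^sup>2 + (\<bar>w\<bar> * sqrt z)\<^sup>2"
        by (rule sum_squares_bound)
      then have "2 * \<bar>d\<bar> * \<bar>w\<bar> \<le> (d\<^sup>2 + (\<bar>w\<bar> * sqrt z)\<^sup>2) / sqrt z"
        using sq by (simp add: field_simps)
      also have "\<dots> = d\<^sup>2 / sqrt z + w\<^sup>2 * sqrt z"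
        using sq by (simp add: field_simps power2_eq_square)
      also have "\<dots> \<le> d\<^sup>2 / sqrt z + v\<^sup>2 * sqrt z"
        using sq w by (intro add_left_mono mult_right_mono) (auto simp: power2_eq_square)
      finally have "2 * \<bar>d\<bar> * \<bar>w\<bar> + \<bar>w\<bar> * \<bar>w\<bar> \<le> d\<^sup>2 / sqrt z + v\<^sup>2 * (sqrt z + 1)"
        using w by (simp add: algebra_simps)
      moreover have "(?h x)\<^sup>2 - (?D x)\<^sup>2 = 2 * d * w + w * w"
        by (simp add: d_def w_def power2_eq_square algebra_simps)
      moreover have "\<bar>2 * d * w + w * w\<bar> \<le> 2 * \<bar>d\<bar> * \<bar>w\<bar> + \<bar>w\<bar> * \<bar>w\<bar>"
        by (rule order_trans[OF abs_triangle_ineq]) (simp add: abs_mult)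
      ultimately show ?thesis by (simp add: d_def v_def)
    qed
    have i3: "integrable (J z) (\<lambda>x. (1 + \<bar>real_of_int (snd x)\<bar>)\<^sup>2)"
      by (rule integrable_J_snd[OF integrable_noise_power])
    have i4: "integrable (J z) (\<lambda>x. (?D x)\<^sup>2)"
      by (rule integrable_J_fst[OF integrable_exit_power[OF z]])
    have i5: "integrable (J z) (\<lambda>x. (?h x)\<^sup>2)"
      using integrable_kernel_increment(2)[OF z] by (simp add: urn_kernel_def case_prod_unfold)
    have ig: "integrable (J z) ?g"
      using i3 i4 by simp
    have "spread z - exit_moment 2 z = measure_pmf.expectation (J z) (\<lambda>x. (?h x)\<^sup>2)
        - measure_pmf.expectation (J z) (\<lambda>x. (?D x)\<^sup>2)"
      using expectation_J_fst[of z "\<lambda>y. (real y - real z)\<^sup>2"]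
      by (simp add: spread_def urn_kernel_def case_prod_unfold exit_moment_def)
    also have "\<dots> = measure_pmf.expectation (J z) (\<lambda>x. (?h x)\<^sup>2 - (?D x)\<^sup>2)"
      using i4 i5 by simp
    finally have "\<bar>spread z - exit_moment 2 z\<bar> \<le> measure_pmf.expectation (J z) (\<lambda>x. \<bar>(?h x)\<^sup>2 - (?D x)\<^sup>2\<bar>)"
      by (simp only: integral_abs_bound)
    also have "\<dots> \<le> measure_pmf.expectation (J z) ?g"
      using le i4 i5 by (intro integral_mono ig) auto
    also have "\<dots> = exit_moment 2 z / sqrt z + noise_moment 2 * (sqrt z + 1)"
      unfolding noise_moment_def exit_moment_def
      using i3 i4 expectation_J_snd[of z "\<lambda>k. (1 + \<bar>real_of_int k\<bar>)\<^sup>2"]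
        expectation_J_fst[of z "\<lambda>y. (real y - real z)\<^sup>2"] by simp
    finally have "\<bar>spread z - exit_moment 2 z\<bar> / real z \<le> (exit_moment 2 z / sqrt z + noise_moment 2 * (sqrt z + 1)) / real z"
      using z by (intro divide_right_mono) auto
    then show ?thesis
      by (simp add: R_def add_divide_distrib diff_divide_distrib[symmetric] mult.commute)
  qed
  have s: "(\<lambda>z::nat. 1 / sqrt z) \<longlonglongrightarrow> 0" "(\<lambda>z::nat. (sqrt z + 1) / real z) \<longlonglongrightarrow> 0"
    by real_asymp+
  have "(\<lambda>z. exit_moment 2 z / real z * (1 / sqrt z) + noise_moment 2 * ((sqrt z + 1) / real z))
      \<longlonglongrightarrow> 2 / 3 * 0 + noise_moment 2 * 0"
    by (intro tendsto_intros s exit_moment_2_tendsto)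
  then have "R \<longlonglongrightarrow> 0" by (simp add: R_def)
  then have 1: "(\<lambda>z. spread z / real z - exit_moment 2 z / real z) \<longlonglongrightarrow> 0"
    by (rule Lim_null_comparison[rotated]) (rule eventually_sequentiallyI[of 1], unfold real_norm_def, rule bound)
  have "(\<lambda>z. (spread z / real z - exit_moment 2 z / real z) + exit_moment 2 z / real z) \<longlonglongrightarrow> 0 + 2 / 3"
    by (intro tendsto_intros 1 exit_moment_2_tendsto)
  then show ?thesis by simp
qed

end

section \<open>Second-order expansion of real powers\<close>

lemma powr_Taylor_near:
  fixes \<alpha> :: real
  obtains C where "0 \<le> C"
    and "\<And>d. \<bar>d\<bar> \<le> 1/2 \<Longrightarrow> \<bar>(1 + d) powr \<alpha> - 1 - \<alpha> * d - \<alpha> * (\<alpha> - 1) / 2 * d\<^sup>2\<bar> \<le> C * \<bar>d\<bar> ^ 3"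
proof
  \<comment> \<open>The derivative of order \<open>n\<close> of
    \<open>x powr \<alpha>\<close>.\<close>
  define diff where "diff = (\<lambda>n x. (\<Prod>i<n. \<alpha> - real i) * x powr (\<alpha> - real n))"
  \<comment> \<open>\<open>t powr (\<alpha> - 3)\<close> is monotone in \<open>t\<close>, so on the
    interval from 1/2 to 3/2 it is at most one of its endpoint values; their sum covers both signs
    of \<open>\<alpha> - 3\<close>.\<close>
  define C where "C = \<bar>\<Prod>i<3. \<alpha> - real i\<bar> * ((1/2) powr (\<alpha> - 3) + (3/2) powr (\<alpha> - 3))"
  show "0 \<le> C" by (simp add: C_def)
  fix d :: real
  assume d: "\<bar>d\<bar> \<le> 1/2"
  show "\<bar>(1 + d) powr \<alpha> - 1 - \<alpha> * d - \<alpha> * (\<alpha> - 1) / 2 * d\<^sup>2\<bar> \<le> C * \<bar>d\<bar> ^ 3"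
  proof (cases "d = 0")
    case False
    have "\<exists>t. (if 1 + d < 1 then 1 + d < t \<and> t < 1 else 1 < t \<and> t < 1 + d) \<and>
        (1 + d) powr \<alpha> = (\<Sum>n<3. diff n 1 / fact n * (1 + d - 1) ^ n) + diff 3 t / fact 3 * (1 + d - 1) ^ 3"
    proof (rule Taylor[of 3 diff "\<lambda>x. x powr \<alpha>" "1/2" "3/2" 1 "1 + d"])
      show "diff 0 = (\<lambda>x. x powr \<alpha>)" by (simp add: diff_def)
      show "\<forall>n t. n < 3 \<and> 1/2 \<le> t \<and> t \<le> 3/2 \<longrightarrow> DERIV (diff n) t :> diff (Suc n) t"
        unfolding diff_def by (auto intro!: derivative_eq_intros simp: algebra_simps)
    qed (use d False in auto)
    then obtain t where t: "if 1 + d < 1 then 1 + d < t \<and> t < 1 else 1 < t \<and> t < 1 + d"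
      and e: "(1 + d) powr \<alpha> = (\<Sum>n<3. diff n 1 / fact n * (1 + d - 1) ^ n) + diff 3 t / fact 3 * (1 + d - 1) ^ 3"
      by blast
    have t: "1/2 \<le> t" "t \<le> 3/2"
      using t d by (auto split: if_splits)
    have e: "(1 + d) powr \<alpha> = (\<Sum>n<3. diff n 1 / fact n * d ^ n) + diff 3 t / fact 3 * d ^ 3"
      using e by simp
    have "(\<Sum>n<3. diff n 1 / fact n * d ^ n) = 1 + \<alpha> * d + \<alpha> * (\<alpha> - 1) / 2 * d\<^sup>2"
      by (simp add: diff_def numeral_eq_Suc)
    then have "\<bar>(1 + d) powr \<alpha> - 1 - \<alpha> * d - \<alpha> * (\<alpha> - 1) / 2 * d\<^sup>2\<bar> = \<bar>diff 3 t\<bar> / fact 3 * \<bar>d\<bar> ^ 3"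
      using e by (simp add: abs_mult power_abs)
    also have "\<dots> \<le> C * \<bar>d\<bar> ^ 3"
    proof (intro mult_right_mono)
      have "t powr (\<alpha> - 3) \<le> (1/2) powr (\<alpha> - 3) + (3/2) powr (\<alpha> - 3)"
      proof (cases "\<alpha> \<ge> 3")
        case True
        then have "t powr (\<alpha> - 3) \<le> (3/2) powr (\<alpha> - 3)"
          using t by (intro powr_mono2) auto
        then show ?thesis by (rule order_trans) simp
      next
        case False
        then have "t powr (\<alpha> - 3) \<le> (1/2) powr (\<alpha> - 3)"
          using t by (intro powr_mono2') auto
        then show ?thesis by (rule order_trans) simp
      qed
      then have "\<bar>diff 3 t\<bar> \<le> C"
        unfolding diff_def C_def by (simp add: abs_mult mult_left_mono)
      moreover have "\<bar>diff 3 t\<bar> / fact 3 \<le> \<bar>diff 3 t\<bar>"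
        by (simp add: fact_numeral)
      ultimately show "\<bar>diff 3 t\<bar> / fact 3 \<le> C" by simp
    qed simp
    finally show ?thesis .
  qed simp
qed

text \<open>Beyond 1/2 all powers of \<open>|d|\<close> up to the \<open>N\<close>-th are at most
  \<open>2^N |d|^N\<close>, and \<open>1 + |d| \<le> 3 |d|\<close>.\<close>

lemma powr_Taylor_far:
  fixes \<alpha> d :: real
  assumes "0 < \<alpha>" and "\<alpha> \<le> real N" and "3 \<le> N" and "- 1 \<le> d" and "1/2 < \<bar>d\<bar>"
  shows "\<bar>(1 + d) powr \<alpha> - 1 - \<alpha> * d - \<alpha> * (\<alpha> - 1) / 2 * d\<^sup>2\<bar>
     \<le> (3 ^ N + (1 + \<alpha> + \<alpha> * \<bar>\<alpha> - 1\<bar>) * 2 ^ N) * \<bar>d\<bar> ^ N"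
proof -
  have k: "\<bar>d\<bar> ^ k \<le> 2 ^ N * \<bar>d\<bar> ^ N" if "k \<le> N" for k
  proof -
    have "\<bar>d\<bar> ^ k \<le> (2 * \<bar>d\<bar>) ^ k"
      by (intro power_mono) auto
    also have "\<dots> \<le> (2 * \<bar>d\<bar>) ^ N"
      using assms that by (intro power_increasing) auto
    finally show ?thesis by (simp add: power_mult_distrib)
  qed
  have "(1 + d) powr \<alpha> \<le> (1 + \<bar>d\<bar>) powr \<alpha>"
    using assms by (intro powr_mono2) auto
  also have "\<dots> \<le> (1 + \<bar>d\<bar>) powr real N"
    using assms by (intro powr_mono) auto
  also have "\<dots> = (1 + \<bar>d\<bar>) ^ N"
    by (intro powr_realpow) auto
  also have "\<dots> \<le> (3 * \<bar>d\<bar>) ^ N"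
    using assms by (intro power_mono) auto
  finally have 1: "(1 + d) powr \<alpha> \<le> 3 ^ N * \<bar>d\<bar> ^ N"
    by (simp add: power_mult_distrib)
  have 2: "1 \<le> 2 ^ N * \<bar>d\<bar> ^ N" using k[of 0] by simp
  have 3: "\<bar>\<alpha> * d\<bar> \<le> \<alpha> * (2 ^ N * \<bar>d\<bar> ^ N)"
    unfolding abs_mult using k[of 1] assms by (intro mult_mono) auto
  have "\<bar>\<alpha> * (\<alpha> - 1) / 2 * d\<^sup>2\<bar> = \<alpha> * \<bar>\<alpha> - 1\<bar> / 2 * \<bar>d\<bar>\<^sup>2"
    using assms by (simp add: abs_mult)
  also have "\<dots> \<le> \<alpha> * \<bar>\<alpha> - 1\<bar> * (2 ^ N * \<bar>d\<bar> ^ N)"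
    using k[of 2] assms by (intro mult_mono) auto
  finally have 4: "\<bar>\<alpha> * (\<alpha> - 1) / 2 * d\<^sup>2\<bar> \<le> \<alpha> * \<bar>\<alpha> - 1\<bar> * (2 ^ N * \<bar>d\<bar> ^ N)" .
  have "0 \<le> (1 + d) powr \<alpha>" by simp
  then have "\<bar>(1 + d) powr \<alpha> - 1 - \<alpha> * d - \<alpha> * (\<alpha> - 1) / 2 * d\<^sup>2\<bar>
      \<le> 3 ^ N * \<bar>d\<bar> ^ N + 2 ^ N * \<bar>d\<bar> ^ N + \<alpha> * (2 ^ N * \<bar>d\<bar> ^ N) + \<alpha> * \<bar>\<alpha> - 1\<bar> * (2 ^ N * \<bar>d\<bar> ^ N)"
    using 1 2 3 4 by linarith
  then show ?thesis by (simp add: algebra_simps)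
qed

text \<open>A single remainder bound for all \<open>d \<ge> -1\<close>, polynomial in
  \<open>|d|\<close>, can be integrated against the increment without splitting off the large
  jumps.\<close>

lemma powr_Taylor:
  fixes \<alpha> :: real
  assumes "0 < \<alpha>"
  obtains C N where "0 \<le> C" and "3 \<le> N"
    and "\<And>d. - 1 \<le> d \<Longrightarrow> \<bar>(1 + d) powr \<alpha> - 1 - \<alpha> * d - \<alpha> * (\<alpha> - 1) / 2 * d\<^sup>2\<bar>
            \<le> C * (\<bar>d\<bar> ^ 3 + \<bar>d\<bar> ^ N)"
proof -
  obtain C0 where C0: "0 \<le> C0" "\<And>d. \<bar>d\<bar> \<le> 1/2 \<Longrightarrow>
      \<bar>(1 + d) powr \<alpha> - 1 - \<alpha> * d - \<alpha> * (\<alpha> - 1) / 2 * d\<^sup>2\<bar> \<le> C0 * \<bar>d\<bar> ^ 3"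
    using powr_Taylor_near[of \<alpha>] by blast
  define N where "N = max 3 (nat \<lceil>\<alpha>\<rceil>)"
  define C1 where "C1 = 3 ^ N + (1 + \<alpha> + \<alpha> * \<bar>\<alpha> - 1\<bar>) * 2 ^ N"
  have N: "3 \<le> N" "\<alpha> \<le> real N"
    unfolding N_def using real_nat_ceiling_ge[of \<alpha>] by linarith+
  have C1: "0 \<le> C1" using assms by (auto simp: C1_def intro!: add_nonneg_nonneg mult_nonneg_nonneg)
  show ?thesis
  proof (rule that[of "C0 + C1" N])
    fix d :: real
    assume d: "- 1 \<le> d"
    have nn: "0 \<le> C0 * \<bar>d\<bar> ^ N" "0 \<le> C1 * \<bar>d\<bar> ^ 3" "0 \<le> C0 * \<bar>d\<bar> ^ 3" "0 \<le> C1 * \<bar>d\<bar> ^ N"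
      using C0 C1 by auto
    show "\<bar>(1 + d) powr \<alpha> - 1 - \<alpha> * d - \<alpha> * (\<alpha> - 1) / 2 * d\<^sup>2\<bar> \<le> (C0 + C1) * (\<bar>d\<bar> ^ 3 + \<bar>d\<bar> ^ N)"
    proof (cases "\<bar>d\<bar> \<le> 1/2")
      case True
      then show ?thesis using C0(2)[OF True] nn by (simp only: distrib_left distrib_right)
    next
      case False
      have "\<bar>(1 + d) powr \<alpha> - 1 - \<alpha> * d - \<alpha> * (\<alpha> - 1) / 2 * d\<^sup>2\<bar> \<le> C1 * \<bar>d\<bar> ^ N"
        unfolding C1_def using False d N assms by (intro powr_Taylor_far) auto
      then show ?thesis using nn by (simp only: distrib_left distrib_right)
    qed
  qed (use C0 C1 N in auto)
qed

section \<open>Mean of a power of the embedded chain after one step\<close>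

context urn_noise
begin

definition powr_mean where "powr_mean \<alpha> z = measure_pmf.expectation (P z) (\<lambda>z'. real z' powr \<alpha>)"

text \<open>With \<open>\<delta> = (z' - z) / z\<close>, each moment of \<open>|\<delta>|\<close> of
  order at least 3 is \<open>O(z^(-3/2))\<close>, and the prefactor
  \<open>z powr (1 - \<alpha>) * z powr \<alpha> = z\<close> turns the remainder into
  \<open>O(1 / sqrt z)\<close>.\<close>

lemma powr_mean_expansion:
  assumes "0 < \<alpha>"
  obtains B where "\<And>z. 1 \<le> z \<Longrightarrow> integrable (P z) (\<lambda>z'. real z' powr \<alpha>)"
    and "\<And>z. 1 \<le> z \<Longrightarrow> \<bar>real z powr (1 - \<alpha>) * (powr_mean \<alpha> z - real z powr \<alpha>)
           - (\<alpha> * drift z + \<alpha> * (\<alpha> - 1) / 2 * (spread z / real z))\<bar> \<le> B / sqrt z"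
proof -
  obtain C N where C: "0 \<le> C" and N: "3 \<le> N"
    and T: "\<And>d. - 1 \<le> d \<Longrightarrow> \<bar>(1 + d) powr \<alpha> - 1 - \<alpha> * d - \<alpha> * (\<alpha> - 1) / 2 * d\<^sup>2\<bar>
            \<le> C * (\<bar>d\<bar> ^ 3 + \<bar>d\<bar> ^ N)"
    using powr_Taylor[OF assms] by blast
  define A where "A = (\<lambda>N::nat. 2 ^ N * (3 * fact N * 6 ^ N + noise_moment N))"
  have A: "0 \<le> A n" for n
    using noise_moment_nonneg[of n] by (simp add: A_def)
  let ?rem = "\<lambda>d. (1 + d) powr \<alpha> - 1 - \<alpha> * d - \<alpha> * (\<alpha> - 1) / 2 * d\<^sup>2"
  show ?thesis
  proof (rule that[of "C * (A 3 + A N)"])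
    fix z :: nat
    assume z: "1 \<le> z"
    define \<delta> where "\<delta> = (\<lambda>z'. (real z' - real z) / real z)"
    have \<delta>: "- 1 \<le> \<delta> z'" for z' using z by (simp add: \<delta>_def field_simps)
    define q where "q = (\<lambda>z'. (1 + \<delta> z') powr \<alpha>)"
    define \<rho> where "\<rho> = (\<lambda>z'. ?rem (\<delta> z'))"
    have pw: "(\<lambda>z'. real z' powr \<alpha>) = (\<lambda>z'. real z powr \<alpha> * q z')"
    proof
      fix z' :: nat
      have "real z' = real z * (1 + \<delta> z')" using z by (simp add: \<delta>_def field_simps)
      then show "real z' powr \<alpha> = real z powr \<alpha> * q z'"
        using \<delta>[of z'] by (simp add: powr_mult q_def)
    qed
    have i: "integrable (P z) (\<lambda>z'. \<bar>\<delta> z'\<bar> ^ n)" for n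
      using kernel_increment_power(1)[OF z, of n] by (simp add: \<delta>_def power_divide)
    have i1: "integrable (P z) \<delta>" and i2: "integrable (P z) (\<lambda>z'. (\<delta> z')\<^sup>2)"
      using integrable_kernel_increment[OF z] by (simp_all add: \<delta>_def power_divide)
    have T\<rho>: "\<bar>\<rho> z'\<bar> \<le> C * (\<bar>\<delta> z'\<bar> ^ 3 + \<bar>\<delta> z'\<bar> ^ N)" for z'
      unfolding \<rho>_def by (rule T[OF \<delta>])
    have ir: "integrable (P z) \<rho>"
      using T\<rho> C
      by (intro Bochner_Integration.integrable_bound[OF integrable_mult_right[OF Bochner_Integration.integrable_add[OF i[of 3] i[of N]], of C]])
         auto
    have sp: "q = (\<lambda>z'. 1 + \<alpha> * \<delta> z' + \<alpha> * (\<alpha> - 1) / 2 * (\<delta> z')\<^sup>2 + \<rho> z')"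
      by (simp add: q_def \<rho>_def)
    have ip: "integrable (P z) q"
      unfolding sp by (intro Bochner_Integration.integrable_add integrable_mult_right i1 i2 ir) simp
    show "integrable (P z) (\<lambda>z'. real z' powr \<alpha>)"
      unfolding pw by (intro integrable_mult_right ip)
    define R where "R = measure_pmf.expectation (P z) \<rho>"
    have "measure_pmf.expectation (P z) q
        = 1 + \<alpha> * measure_pmf.expectation (P z) \<delta>
          + \<alpha> * (\<alpha> - 1) / 2 * measure_pmf.expectation (P z) (\<lambda>z'. (\<delta> z')\<^sup>2) + R"
      unfolding R_def sp using i1 i2 ir by simp
    also have "measure_pmf.expectation (P z) \<delta> = drift z / real z"
      using integrable_kernel_increment(1)[OF z] by (simp add: \<delta>_def drift_def)
    also have "measure_pmf.expectation (P z) (\<lambda>z'. (\<delta> z')\<^sup>2) = spread z / (real z)\<^sup>2"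
      using integrable_kernel_increment(2)[OF z] by (simp add: \<delta>_def spread_def power_divide)
    finally have e: "powr_mean \<alpha> z = real z powr \<alpha> * (1 + \<alpha> * (drift z / real z)
        + \<alpha> * (\<alpha> - 1) / 2 * (spread z / (real z)\<^sup>2) + R)"
      unfolding powr_mean_def pw by simp
    have zz: "real z powr (1 - \<alpha>) * real z powr \<alpha> = real z"
      using z by (simp flip: powr_add)
    have "real z powr (1 - \<alpha>) * (powr_mean \<alpha> z - real z powr \<alpha>)
        = (real z powr (1 - \<alpha>) * real z powr \<alpha>) * (\<alpha> * (drift z / real z)
        + \<alpha> * (\<alpha> - 1) / 2 * (spread z / (real z)\<^sup>2) + R)"
      unfolding e by (simp add: algebra_simps)
    also have "\<dots> = \<alpha> * drift z + \<alpha> * (\<alpha> - 1) / 2 * (spread z / real z) + real z * R"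
      unfolding zz using z by (simp add: distrib_left power2_eq_square)
    finally have "\<bar>real z powr (1 - \<alpha>) * (powr_mean \<alpha> z - real z powr \<alpha>)
           - (\<alpha> * drift z + \<alpha> * (\<alpha> - 1) / 2 * (spread z / real z))\<bar> = real z * \<bar>R\<bar>"
      by (simp add: abs_mult)
    also have "\<dots> \<le> real z * (C * ((A 3 + A N) * (1 / sqrt z) ^ 3))"
    proof (intro mult_left_mono)
      have noise_mean: "measure_pmf.expectation (P z) (\<lambda>z'. \<bar>\<delta> z'\<bar> ^ n) \<le> A n * (1 / sqrt z) ^ 3" if n: "3 \<le> n" for n
      proof -
        have "measure_pmf.expectation (P z) (\<lambda>z'. \<bar>\<delta> z'\<bar> ^ n)
            = measure_pmf.expectation (P z) (\<lambda>z'. \<bar>real z' - real z\<bar> ^ n) / real z ^ n"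
          using kernel_increment_power(1)[OF z, of n] by (simp add: \<delta>_def power_divide)
        also have "\<dots> \<le> A n * sqrt z ^ n / real z ^ n"
          unfolding A_def using kernel_increment_power(2)[OF z, of n] by (intro divide_right_mono) auto
        also have "\<dots> = A n * (sqrt z / real z) ^ n" by (simp add: power_divide)
        also have "sqrt z / real z = 1 / sqrt z" using z by (simp add: real_div_sqrt field_simps)
        also have "(1 / sqrt z) ^ n \<le> (1 / sqrt z) ^ 3"
          using z n by (intro power_decreasing) auto
        finally show ?thesis using A[of n] by (simp add: mult_left_mono)
      qed
      have "\<bar>R\<bar> \<le> measure_pmf.expectation (P z) (\<lambda>z'. \<bar>\<rho> z'\<bar>)"
        unfolding R_def by (rule integral_abs_bound)
      also have "\<dots> \<le> measure_pmf.expectation (P z) (\<lambda>z'. C * (\<bar>\<delta> z'\<bar> ^ 3 + \<bar>\<delta> z'\<bar> ^ N))"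
        using T\<rho> by (intro integral_mono integrable_abs ir integrable_mult_right Bochner_Integration.integrable_add i)
      also have "\<dots> = C * (measure_pmf.expectation (P z) (\<lambda>z'. \<bar>\<delta> z'\<bar> ^ 3) + measure_pmf.expectation (P z) (\<lambda>z'. \<bar>\<delta> z'\<bar> ^ N))"
        using i by simp
      also have "\<dots> \<le> C * (A 3 * (1 / sqrt z) ^ 3 + A N * (1 / sqrt z) ^ 3)"
        using noise_mean[of 3] noise_mean[OF N] C by (intro mult_left_mono add_mono) auto
      finally show "\<bar>R\<bar> \<le> C * ((A 3 + A N) * (1 / sqrt z) ^ 3)" by (simp add: distrib_right)
    qed simp
    also have "\<dots> = C * (A 3 + A N) * (real z * (1 / sqrt z) ^ 3)" by simp
    also have "real z * (1 / sqrt z) ^ 3 = 1 / sqrt z"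
      using z by (simp add: power3_eq_cube)
    finally show "\<bar>real z powr (1 - \<alpha>) * (powr_mean \<alpha> z - real z powr \<alpha>)
           - (\<alpha> * drift z + \<alpha> * (\<alpha> - 1) / 2 * (spread z / real z))\<bar> \<le> C * (A 3 + A N) / sqrt z"
      by simp
  qed
qed

lemma integrable_kernel_powr:
  "0 < \<alpha> \<Longrightarrow> 1 \<le> z \<Longrightarrow> integrable (P z) (\<lambda>z'. real z' powr \<alpha>)"
  using powr_mean_expansion[of \<alpha>] by blast

lemma powr_mean_tendsto:
  assumes "0 < \<alpha>"
  shows "(\<lambda>z. real z powr (1 - \<alpha>) * (powr_mean \<alpha> z - real z powr \<alpha>)) \<longlonglongrightarrow> \<alpha> / 3 * (\<alpha> - (3 * noise_mean - 1))"
proof -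
  obtain B where B: "\<And>z. 1 \<le> z \<Longrightarrow> \<bar>real z powr (1 - \<alpha>) * (powr_mean \<alpha> z - real z powr \<alpha>)
           - (\<alpha> * drift z + \<alpha> * (\<alpha> - 1) / 2 * (spread z / real z))\<bar> \<le> B / sqrt z"
    using powr_mean_expansion[OF assms] by blast
  have "(\<lambda>z::nat. B / sqrt z) \<longlonglongrightarrow> 0" by real_asymp
  then have "(\<lambda>z. real z powr (1 - \<alpha>) * (powr_mean \<alpha> z - real z powr \<alpha>)
           - (\<alpha> * drift z + \<alpha> * (\<alpha> - 1) / 2 * (spread z / real z))) \<longlonglongrightarrow> 0"
    by (rule Lim_null_comparison[rotated]) (rule eventually_sequentiallyI[of 1], unfold real_norm_def, rule B)
  moreover have "(\<lambda>z. \<alpha> * drift z + \<alpha> * (\<alpha> - 1) / 2 * (spread z / real z))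
      \<longlonglongrightarrow> \<alpha> * (2 / 3 - noise_mean) + \<alpha> * (\<alpha> - 1) / 2 * (2 / 3)"
    by (intro tendsto_intros drift_tendsto spread_tendsto)
  ultimately have "(\<lambda>z. (real z powr (1 - \<alpha>) * (powr_mean \<alpha> z - real z powr \<alpha>)
           - (\<alpha> * drift z + \<alpha> * (\<alpha> - 1) / 2 * (spread z / real z)))
           + (\<alpha> * drift z + \<alpha> * (\<alpha> - 1) / 2 * (spread z / real z)))
      \<longlonglongrightarrow> 0 + (\<alpha> * (2 / 3 - noise_mean) + \<alpha> * (\<alpha> - 1) / 2 * (2 / 3))"
    by (rule tendsto_add)
  moreover have "0 + (\<alpha> * (2 / 3 - noise_mean) + \<alpha> * (\<alpha> - 1) / 2 * (2 / 3)) = \<alpha> / 3 * (\<alpha> - (3 * noise_mean - 1))"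
    by (simp add: field_simps)
  ultimately show ?thesis by (simp only: diff_add_cancel)
qed

lemma powr_mean_le_iff:
  assumes "1 \<le> z"
  shows "real z powr (1 - \<alpha>) * (powr_mean \<alpha> z - real z powr \<alpha>) \<le> w
     \<longleftrightarrow> powr_mean \<alpha> z \<le> real z powr \<alpha> + w * real z powr (\<alpha> - 1)"
    and "w \<le> real z powr (1 - \<alpha>) * (powr_mean \<alpha> z - real z powr \<alpha>)
     \<longleftrightarrow> real z powr \<alpha> + w * real z powr (\<alpha> - 1) \<le> powr_mean \<alpha> z"
proof -
  have p: "real z powr (1 - \<alpha>) = 1 / real z powr (\<alpha> - 1)"
    using assms by (simp add: powr_minus_divide[symmetric])
  have q: "0 < real z powr (\<alpha> - 1)" using assms by simp
  show "real z powr (1 - \<alpha>) * (powr_mean \<alpha> z - real z powr \<alpha>) \<le> w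
     \<longleftrightarrow> powr_mean \<alpha> z \<le> real z powr \<alpha> + w * real z powr (\<alpha> - 1)"
    unfolding p using q by (simp add: divide_le_eq) linarith
  show "w \<le> real z powr (1 - \<alpha>) * (powr_mean \<alpha> z - real z powr \<alpha>)
     \<longleftrightarrow> real z powr \<alpha> + w * real z powr (\<alpha> - 1) \<le> powr_mean \<alpha> z"
    unfolding p using q by (simp add: le_divide_eq) linarith
qed

text \<open>The probability of \<open>\<tau> > k\<close> from \<open>z\<close>, as
  \<open>emeasure_tau_gt\<close> shows. A start in 1 is not killed, since \<tau> counts visits from
  time 1 on.\<close>

primrec survival :: "nat \<Rightarrow> nat \<Rightarrow> real" where
  "survival 0 z = 1"
| "survival (Suc k) z = measure_pmf.expectation (P z) (\<lambda>z'. if z' = 1 then 0 else survival k z')"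

lemma survival_bounds: "0 \<le> survival k z \<and> survival k z \<le> 1"
proof (induction k arbitrary: z)
  case (Suc k)
  have "integrable (P z) (\<lambda>z'. if z' = 1 then 0 else survival k z')"
    using Suc by (intro measure_pmf.integrable_const_bound[where B=1]) auto
  then have "measure_pmf.expectation (P z) (\<lambda>z'. if z' = 1 then 0 else survival k z')
      \<le> measure_pmf.expectation (P z) (\<lambda>z'. 1)"
    using Suc by (intro integral_mono) auto
  moreover have "0 \<le> measure_pmf.expectation (P z) (\<lambda>z'. if z' = 1 then 0 else survival k z')"
    using Suc by (intro integral_nonneg_AE) auto
  ultimately show ?case by simp
qed simp

lemma integrable_survival:
  "integrable (P z) (\<lambda>z'. if z' = 1 then 0 else survival k z')"
  using survival_bounds by (intro measure_pmf.integrable_const_bound[where B=1]) auto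

end

section \<open>Bounds on the survival probability\<close>

context urn_noise
begin

text \<open>A noise of positive mean takes some value \<open>k \<ge> 1\<close>. If the quadrant is
  crossed without a raise, the restart is at \<open>max 1 (1 - k) = 1\<close>.\<close>

lemma pmf_kernel_1_pos:
  assumes "0 < noise_mean"
  shows "0 < pmf (P z) 1"
proof -
  have "\<exists>k\<in>set_pmf \<kappa>. 1 \<le> k"
  proof (rule ccontr)
    assume "\<not> ?thesis"
    then have "AE k in \<kappa>. real_of_int k \<le> 0"
      by (auto simp: AE_measure_pmf_iff)
    then have "noise_mean \<le> measure_pmf.expectation \<kappa> (\<lambda>k. 0)"
      unfolding noise_mean_def by (intro integral_mono_AE integrable_noise) auto
    with assms show False by simp
  qed
  then obtain k where k: "k \<in> set_pmf \<kappa>" "1 \<le> k" by blast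
  have "noisy_restart 0 k = 1" using k by (simp add: noisy_restart_def)
  then have "1 \<in> set_pmf (P z)"
    using k exit_law_start[of 0 z] by (force simp: urn_kernel_def)
  then show ?thesis by (simp add: pmf_positive_iff)
qed

text \<open>The exit law has full support, and for any noise value \<open>k\<close> an exit at
  \<open>b + |k|\<close> restarts above \<open>b\<close>. This lets the lower bound leave the region
  near 1 where its submartingale vanishes.\<close>

lemma kernel_unbounded:
  assumes "1 \<le> z"
  shows "\<exists>z'\<ge>b. 0 < pmf (P z) z'"
proof -
  obtain k where k: "k \<in> set_pmf \<kappa>" using set_pmf_not_empty[of \<kappa>] by blast
  obtain a where a: "z = Suc a" using assms by (cases z) auto
  define c where "c = b + nat \<bar>k\<bar>"
  have "c \<in> set_pmf (exit_law z 0)"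
    using exit_law_support[of 0 c a] a by simp
  then have "noisy_restart c k \<in> set_pmf (P z)"
    using k by (force simp: urn_kernel_def)
  moreover have "b \<le> noisy_restart c k"
    by (auto simp: noisy_restart_def c_def)
  ultimately show ?thesis by (auto simp: pmf_positive_iff)
qed

section \<open>Upper bound on survival\<close>

text \<open>One time step costs the bound \<open>(k + 1) powr (- \<alpha>)\<close> at most the
  relative amount \<open>N / (k + 2)\<close>: Bernoulli's inequality for the exponent rounded up to
  \<open>N\<close>.\<close>

lemma ratio_powr_ge:
  fixes \<alpha> :: real
  assumes "0 < \<alpha>" "\<alpha> \<le> real N" "1 \<le> N"
  shows "1 - real N / (real k + 2) \<le> ((real k + 1) / (real k + 2)) powr \<alpha>"
proof -
  define x where "x = 1 / (real k + 2)"
  have x: "0 < x" "x < 1" and e: "(real k + 1) / (real k + 2) = 1 - x"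
    by (auto simp: x_def field_simps)
  have "1 + real N * (- x) \<le> (1 + (- x)) ^ N"
    using x by (intro Bernoulli_inequality) auto
  also have "\<dots> = (1 - x) powr real N"
    using x by (simp add: powr_realpow)
  also have "\<dots> \<le> (1 - x) powr \<alpha>"
    using x assms by (intro powr_mono') auto
  finally show ?thesis unfolding e by (simp add: x_def)
qed

text \<open>
  The drift of \<open>z\<^sup>\<alpha>\<close> is negative only for large \<open>z\<close>. For small \<open>z\<close> the added constant \<open>A\<close> is lost
  with the probability of hitting \<open>1\<close>, which makes up for this.
\<close>

lemma killed_drift:
  assumes \<alpha>: "0 < \<alpha>" "\<alpha> < 3 * noise_mean - 1"
  obtains \<epsilon> A where "0 < \<epsilon>" "0 \<le> A" and "\<And>z. 1 \<le> z \<Longrightarrow>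
     integrable (P z) (\<lambda>z'. if z' = 1 then 0 else real z' powr \<alpha> + A)"
   and "\<And>z. 1 \<le> z \<Longrightarrow>
     measure_pmf.expectation (P z) (\<lambda>z'. if z' = 1 then 0 else real z' powr \<alpha> + A)
       \<le> real z powr \<alpha> + A - \<epsilon> * real z powr (\<alpha> - 1)"
proof -
  \<comment> \<open>Half the absolute value of the limiting drift coefficient.\<close>
  define \<epsilon> where "\<epsilon> = \<alpha> / 6 * (3 * noise_mean - 1 - \<alpha>)"
  have \<epsilon>: "0 < \<epsilon>" using \<alpha> by (auto simp: \<epsilon>_def)
  have noise_mean: "0 < noise_mean" using \<alpha> by linarith
  have "\<alpha> / 3 * (\<alpha> - (3 * noise_mean - 1)) < - \<epsilon>"
    using \<epsilon> by (simp add: \<epsilon>_def algebra_simps)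
  from order_tendstoD(2)[OF powr_mean_tendsto[OF \<alpha>(1)] this]
  obtain n where n: "\<And>z. n \<le> z \<Longrightarrow> real z powr (1 - \<alpha>) * (powr_mean \<alpha> z - real z powr \<alpha>) < - \<epsilon>"
    by (auto simp: eventually_sequentially)
  \<comment> \<open>An added constant of at least \<open>w z\<close> loses enough through the
    killing at 1 to cover the whole mean of the power at \<open>z\<close>. The sum over the finitely
    many small \<open>z\<close> serves all of them.\<close>
  define w where "w = (\<lambda>z. (powr_mean \<alpha> z + \<epsilon> * real z powr (\<alpha> - 1)) / pmf (P z) 1)"
  define A where "A = (\<Sum>z<n. w z)"
  have pm: "0 \<le> powr_mean \<alpha> z" for z
    unfolding powr_mean_def by (intro integral_nonneg_AE) auto
  have w: "0 \<le> w z" for z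
    using pm[of z] \<epsilon> pmf_kernel_1_pos[OF noise_mean, of z] by (auto simp: w_def)
  have A: "0 \<le> A" unfolding A_def by (intro sum_nonneg w)
  have wA: "w z \<le> A" if "z < n" for z
    unfolding A_def using that w by (intro member_le_sum) auto
  show ?thesis
  proof (rule that[OF \<epsilon> A])
    fix z :: nat
    assume z: "1 \<le> z"
    have ip: "integrable (P z) (\<lambda>z'. real z' powr \<alpha>)"
      by (rule integrable_kernel_powr[OF \<alpha>(1) z])
    have ii: "integrable (P z) (\<lambda>z'. indicator {1} z' :: real)"
      by (intro measure_pmf.integrable_const_bound[where B=1]) auto
    show ik: "integrable (P z) (\<lambda>z'. if z' = 1 then 0 else real z' powr \<alpha> + A)"
    proof (rule Bochner_Integration.integrable_bound)
      show "integrable (P z) (\<lambda>z'. real z' powr \<alpha> + A)"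
        using ip by simp
    qed (use A in simp_all)
    have "measure_pmf.expectation (P z) (\<lambda>z'. if z' = 1 then 0 else real z' powr \<alpha> + A)
       \<le> measure_pmf.expectation (P z) (\<lambda>z'. real z' powr \<alpha> + A - A * indicator {1} z')"
      using ip ii by (intro integral_mono ik) (auto simp: indicator_def)
    also have "\<dots> = powr_mean \<alpha> z + A - A * pmf (P z) 1"
      using ip ii by (simp add: powr_mean_def pmf.rep_eq)
    also have "\<dots> \<le> real z powr \<alpha> + A - \<epsilon> * real z powr (\<alpha> - 1)"
    proof (cases "z < n")
      case True
      from wA[OF True] have "powr_mean \<alpha> z + \<epsilon> * real z powr (\<alpha> - 1) \<le> A * pmf (P z) 1"
        using pmf_kernel_1_pos[OF noise_mean, of z] by (simp add: w_def divide_le_eq)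
      moreover have "0 \<le> real z powr \<alpha>" by simp
      ultimately show ?thesis by linarith
    next
      case False
      then have "powr_mean \<alpha> z \<le> real z powr \<alpha> + (- \<epsilon>) * real z powr (\<alpha> - 1)"
        using n[of z] powr_mean_le_iff(1)[OF z, of \<alpha> "- \<epsilon>"] by simp
      moreover have "0 \<le> A * pmf (P z) 1" using A by simp
      ultimately show ?thesis by simp
    qed
    finally show "measure_pmf.expectation (P z) (\<lambda>z'. if z' = 1 then 0 else real z' powr \<alpha> + A)
       \<le> real z powr \<alpha> + A - \<epsilon> * real z powr (\<alpha> - 1)" .
  qed
qed

text \<open>Induction on \<open>k\<close> with the bound
  \<open>C (z powr \<alpha> + A) / (k + 1) powr \<alpha>\<close>. For \<open>z\<close> at least of
  order \<open>k\<close> the bound is at least 1 and holds trivially. Below, the negative drift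
  outweighs the factor lost by one more time step.\<close>

lemma survival_upper:
  assumes \<alpha>: "0 < \<alpha>" "\<alpha> < 3 * noise_mean - 1"
  obtains C where "\<And>k z. 1 \<le> z \<Longrightarrow> survival k z \<le> C * real z powr \<alpha> / (real k + 1) powr \<alpha>"
proof -
  obtain \<epsilon> A where \<epsilon>: "0 < \<epsilon>" and A: "0 \<le> A"
   and ik: "\<And>z. 1 \<le> z \<Longrightarrow> integrable (P z) (\<lambda>z'. if z' = 1 then 0 else real z' powr \<alpha> + A)"
   and dr: "\<And>z. 1 \<le> z \<Longrightarrow>
     measure_pmf.expectation (P z) (\<lambda>z'. if z' = 1 then 0 else real z' powr \<alpha> + A)
       \<le> real z powr \<alpha> + A - \<epsilon> * real z powr (\<alpha> - 1)"
  proof (rule killed_drift[OF \<alpha>], goal_cases)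
    case (1 \<epsilon> A)
    from 1(2-5) show ?case by (rule 1(1))
  qed
  let ?f = "\<lambda>z::nat. real z powr \<alpha> + A"
  define N where "N = max 1 (nat \<lceil>\<alpha>\<rceil>)"
  have N: "1 \<le> N" "\<alpha> \<le> real N"
    unfolding N_def using real_nat_ceiling_ge[of \<alpha>] by linarith+
  \<comment> \<open>Chosen so that \<open>z \<le> \<eta> (k + 2)\<close> gives \<open>(1 + A) z powr
    \<alpha> * N / (k + 2) \<le> \<epsilon> z powr (\<alpha> - 1)\<close>.\<close>
  define \<eta> where "\<eta> = \<epsilon> / ((1 + A) * real N)"
  have \<eta>: "0 < \<eta>" using \<epsilon> A N by (simp add: \<eta>_def)
  define C where "C = max 1 (1 / \<eta> powr \<alpha>)"
  have C: "1 \<le> C" "1 / \<eta> powr \<alpha> \<le> C" by (auto simp: C_def)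
  have fz: "real z powr \<alpha> \<le> ?f z" "?f z \<le> (1 + A) * real z powr \<alpha>" "1 \<le> real z powr \<alpha>"
    if "1 \<le> z" for z
  proof -
    show "1 \<le> real z powr \<alpha>" using that \<alpha> by (intro ge_one_powr_ge_zero) auto
    then show "?f z \<le> (1 + A) * real z powr \<alpha>"
      using A mult_left_mono[of 1 "real z powr \<alpha>" A] by (simp add: distrib_right)
  qed (use A in simp)
  have main: "survival k z \<le> C * ?f z / (real k + 1) powr \<alpha>" if "1 \<le> z" for k z
    using that
  proof (induction k arbitrary: z)
    case 0
    then have "1 * 1 \<le> C * ?f z"
      using C fz[of z] by (intro mult_mono) auto
    then show ?case by simp
  next
    case (Suc k)
    note z = \<open>1 \<le> z\<close>
    let ?K = "real k + 2"
    have K: "real (Suc k) + 1 = ?K" by simp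
    show ?case
    proof (cases "\<eta> * ?K \<le> real z")
      case True
      have "1 = C * (1 / C)" using C by simp
      also have "1 / C \<le> \<eta> powr \<alpha>"
        using C \<eta> by (simp add: field_simps)
      also have "\<eta> powr \<alpha> \<le> (real z / ?K) powr \<alpha>"
        using True \<eta> \<alpha> by (intro powr_mono2) (auto simp: le_divide_eq)
      also have "(real z / ?K) powr \<alpha> = real z powr \<alpha> / ?K powr \<alpha>"
        by (simp add: powr_divide)
      also have "\<dots> \<le> ?f z / ?K powr \<alpha>"
        using A by (intro divide_right_mono) auto
      finally have "1 \<le> C * ?f z / ?K powr \<alpha>" using C by simp
      with survival_bounds[of "Suc k" z] show ?thesis unfolding K by linarith
    next
      case False
      have "survival (Suc k) z \<le> measure_pmf.expectation (P z)
          (\<lambda>z'. C / (real k + 1) powr \<alpha> * (if z' = 1 then 0 else ?f z'))"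
      proof -
        have "AE z' in P z. (if z' = 1 then 0 else survival k z') \<le> C / (real k + 1) powr \<alpha> * (if z' = 1 then 0 else ?f z')"
          using Suc.IH urn_kernel_ge_1 by (auto simp: AE_measure_pmf_iff)
        then show ?thesis
          using ik[OF z] integrable_survival by (simp only: survival.simps) (intro integral_mono_AE integrable_mult_right)
      qed
      also have "\<dots> = C / (real k + 1) powr \<alpha> * measure_pmf.expectation (P z) (\<lambda>z'. if z' = 1 then 0 else ?f z')"
        by simp
      also have "\<dots> \<le> C / (real k + 1) powr \<alpha> * (?f z - \<epsilon> * real z powr (\<alpha> - 1))"
        using dr[OF z] C by (intro mult_left_mono) auto
      also have "\<dots> \<le> C / (real k + 1) powr \<alpha> * (?f z * ((real k + 1) / ?K) powr \<alpha>)"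
      proof (intro mult_left_mono)
        have "real N * real z \<le> real N * (\<eta> * ?K)"
          using False N by (intro mult_left_mono) auto
        also have "\<dots> = \<epsilon> * ?K / (1 + A)"
          using N A by (simp add: \<eta>_def)
        finally have "real N * real z \<le> \<epsilon> * ?K / (1 + A)" .
        moreover have Z: "0 < (1 + A) * real z" using z A by simp
        ultimately have "real N * ((1 + A) * real z) \<le> \<epsilon> * ?K"
          using A by (simp add: le_divide_eq mult_ac)
        then have "real N / ?K \<le> \<epsilon> / ((1 + A) * real z)"
          by (subst pos_divide_le_eq, simp, subst times_divide_eq_left, subst pos_le_divide_eq[OF Z])
        then have "?f z * (real N / ?K) \<le> (1 + A) * real z powr \<alpha> * (\<epsilon> / ((1 + A) * real z))"
          using fz[OF z] A by (intro mult_mono) auto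
        also have "\<dots> = \<epsilon> * real z powr (\<alpha> - 1)"
          using A z by (simp add: powr_diff)
        finally have "?f z - \<epsilon> * real z powr (\<alpha> - 1) \<le> ?f z * (1 - real N / ?K)"
          by (simp add: right_diff_distrib)
        also have "\<dots> \<le> ?f z * ((real k + 1) / ?K) powr \<alpha>"
          using ratio_powr_ge[OF \<alpha>(1) N(2) N(1)] A by (intro mult_left_mono) auto
        finally show "?f z - \<epsilon> * real z powr (\<alpha> - 1) \<le> ?f z * ((real k + 1) / ?K) powr \<alpha>" .
      qed (use C in auto)
      also have "\<dots> = C * ?f z / ?K powr \<alpha>"
        by (simp add: powr_divide)
      finally show ?thesis unfolding K .
    qed
  qed
  show ?thesis
  proof (rule that[of "C * (1 + A)"])
    fix k z :: nat
    assume z: "1 \<le> z"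
    have "C * ?f z / (real k + 1) powr \<alpha> \<le> C * ((1 + A) * real z powr \<alpha>) / (real k + 1) powr \<alpha>"
      using fz[OF z] C by (intro divide_right_mono mult_left_mono) auto
    with main[OF z, of k] show "survival k z \<le> C * (1 + A) * real z powr \<alpha> / (real k + 1) powr \<alpha>"
      by simp
  qed
qed

section \<open>Lower bound on survival\<close>

lemma drift_spread_bounded:
  obtains B where "0 < B" "\<And>z. 1 \<le> z \<Longrightarrow> \<bar>drift z\<bar> \<le> B \<and> spread z \<le> B * real z"
proof -
  have "Bseq drift" "Bseq (\<lambda>z. spread z / real z)"
    using drift_tendsto spread_tendsto by (auto intro: convergent_imp_Bseq convergentI)
  then obtain B1 B2 where B: "0 < B1" "\<And>z. norm (drift z) \<le> B1" "0 < B2" "\<And>z. norm (spread z / real z) \<le> B2"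
    by (auto elim!: BseqE)
  show ?thesis
  proof (rule that[of "B1 + B2"])
    fix z :: nat assume z: "1 \<le> z"
    have "spread z / real z \<le> B1 + B2"
      using B(4)[of z] B(1) abs_ge_self[of "spread z / real z"] by simp
    then show "\<bar>drift z\<bar> \<le> B1 + B2 \<and> spread z \<le> (B1 + B2) * real z"
      using z B(2)[of z] B(3) by (simp add: divide_le_eq)
  qed (use B in auto)
qed

text \<open>
  \<open>1 + (z - x)\<^sup>2 / x\<^sup>2\<close> grows in mean by a factor of at most \<open>1 + O(1/x)\<close> per step, and is far from
  \<open>1\<close> at \<open>z = 1\<close>.
\<close>

lemma survival_ge_half:
  obtains K :: nat where "1 \<le> K" and "\<And>k x. 1 \<le> k \<Longrightarrow> K * k \<le> x \<Longrightarrow> 1/2 \<le> survival k x"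
proof -
  obtain B where B: "0 < B" "\<And>z. 1 \<le> z \<Longrightarrow> \<bar>drift z\<bar> \<le> B \<and> spread z \<le> B * real z"
    using drift_spread_bounded by blast
  \<comment> \<open>\<open>27 B\<close> gives
    \<open>\<rho>^k \<le> exp (3 B / K) \<le> exp (1/9) \<le> 9/8\<close>, and
    \<open>1 - 4 (9/8 - 1) = 1/2\<close>. The \<open>+ 2\<close> forces
    \<open>x \<ge> 2\<close>.\<close>
  define K where "K = nat \<lceil>27 * B\<rceil> + 2"
  have K: "27 * B \<le> real K" "2 \<le> K"
    unfolding K_def using real_nat_ceiling_ge[of "27 * B"] by auto
  show ?thesis
  proof (rule that[of K])
    fix k x :: nat
    assume k: "1 \<le> k" and x: "K * k \<le> x"
    have "2 * 1 \<le> K * k" using k K by (intro mult_mono) auto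
    with x have x2: "2 \<le> x" by simp
    then have rx: "2 \<le> real x" by simp
    define q where "q = (\<lambda>z::nat. (real z - real x)\<^sup>2 / (real x)\<^sup>2)"
    define \<rho> where "\<rho> = 1 + 3 * B / real x"
    have \<rho>: "1 \<le> \<rho>" using B rx by (simp add: \<rho>_def)
    have qe: "q = (\<lambda>z'. (real z - real x)\<^sup>2 / (real x)\<^sup>2 + 2 * (real z - real x) / (real x)\<^sup>2 * (real z' - real z)
        + (real z' - real z)\<^sup>2 / (real x)\<^sup>2)" for z
    proof
      fix z' :: nat
      have "(real z' - real x)\<^sup>2 = (real z - real x)\<^sup>2 + 2 * (real z - real x) * (real z' - real z) + (real z' - real z)\<^sup>2"
        by (simp add: power2_eq_square algebra_simps)
      then show "q z' = (real z - real x)\<^sup>2 / (real x)\<^sup>2 + 2 * (real z - real x) / (real x)\<^sup>2 * (real z' - real z)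
        + (real z' - real z)\<^sup>2 / (real x)\<^sup>2"
        by (simp add: q_def add_divide_distrib)
    qed
    have iq: "integrable (P z) q" if "1 \<le> z" for z
      unfolding qe[of z] using integrable_kernel_increment[OF that] by simp
    have q_step: "measure_pmf.expectation (P z) (\<lambda>z'. 1 + q z') \<le> \<rho> * (1 + q z)" if z: "1 \<le> z" for z
    proof -
      have "measure_pmf.expectation (P z) (\<lambda>z'. 1 + q z')
          = 1 + ((real z - real x)\<^sup>2 / (real x)\<^sup>2 + (2 * (real z - real x) / (real x)\<^sup>2) * drift z + spread z / (real x)\<^sup>2)"
        unfolding qe[of z] drift_def spread_def using integrable_kernel_increment[OF z] by simp
      also have "(real z - real x)\<^sup>2 / (real x)\<^sup>2 = q z" by (simp add: q_def)
      also have "1 + (q z + (2 * (real z - real x) / (real x)\<^sup>2) * drift z + spread z / (real x)\<^sup>2)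
          \<le> 1 + (q z + (2 * \<bar>real z - real x\<bar> / (real x)\<^sup>2) * B + B * real z / (real x)\<^sup>2)"
      proof -
        have "(2 * (real z - real x) / (real x)\<^sup>2) * drift z \<le> \<bar>(2 * (real z - real x) / (real x)\<^sup>2) * drift z\<bar>"
          by (rule abs_ge_self)
        also have "\<dots> = (2 * \<bar>real z - real x\<bar> / (real x)\<^sup>2) * \<bar>drift z\<bar>"
          by (simp only: abs_mult abs_divide abs_numeral abs_power2)
        also have "\<dots> \<le> (2 * \<bar>real z - real x\<bar> / (real x)\<^sup>2) * B"
          using B(2)[OF z] by (intro mult_left_mono) auto
        finally show ?thesis
          using B(2)[OF z] by (intro add_mono divide_right_mono) auto
      qed
      also have "\<dots> \<le> \<rho> * (1 + q z)"
      proof -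
        define r where "r = \<bar>real z - real x\<bar> / real x"
        have r2: "q z = r\<^sup>2" by (simp add: q_def r_def power_divide)
        have r: "0 \<le> r" by (simp add: r_def)
        have zx: "real z / real x \<le> 1 + r"
          using rx by (simp add: r_def field_simps)
        define s where "s = r\<^sup>2"
        have "2 * r \<le> 1 + s" "0 \<le> s"
          using sum_squares_bound[of 1 r] by (simp_all add: s_def)
        then have "2 * r + real z / real x \<le> 3 * (1 + s)"
          using zx by argo
        then have "2 * r + real z / real x \<le> 3 * (1 + r\<^sup>2)"
          by (simp only: s_def)
        then have "(B / real x) * (2 * r + real z / real x) \<le> (B / real x) * (3 * (1 + r\<^sup>2))"
          using B by (intro mult_left_mono) auto
        moreover have "(2 * \<bar>real z - real x\<bar> / (real x)\<^sup>2) * B + B * real z / (real x)\<^sup>2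
            = (B / real x) * (2 * r + real z / real x)"
          by (simp add: r_def power2_eq_square algebra_simps)
        moreover have "(1 + 3 * B / real x) * (1 + r\<^sup>2) = 1 + (r\<^sup>2 + (B / real x) * (3 * (1 + r\<^sup>2)))"
          by (simp add: distrib_right)
        ultimately show ?thesis
          unfolding r2 \<rho>_def by linarith
      qed
      finally show ?thesis .
    qed
    \<comment> \<open>As \<open>x \<ge> 2\<close>, the point 1 lies at distance at least
      \<open>x/2\<close> from \<open>x\<close>. So \<open>1 + q 1 \<ge> 5/4\<close>, and the lower
      bound \<open>5 - 4 (1 + q) \<rho>^j\<close> is at most 0 at the killed state.\<close>
    have q1: "1 \<le> 4 * q 1"
    proof -
      have "real x \<le> 2 * (real x - 1)" using rx by simp
      then have "(real x)\<^sup>2 \<le> (2 * (real x - 1))\<^sup>2" by (intro power_mono) auto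
      then have "(real x)\<^sup>2 \<le> 4 * (1 - real x)\<^sup>2"
        unfolding power_mult_distrib by (simp add: power2_commute)
      then show ?thesis using rx
        by (simp add: q_def le_divide_eq)
    qed
    have qnn: "0 \<le> q z" for z by (simp add: q_def)
    have main: "1 - 4 * ((1 + q z) * \<rho> ^ j - 1) \<le> survival j z" if "1 \<le> z" for j z
      using that
    proof (induction j arbitrary: z)
      case 0
      then show ?case using qnn[of z] by simp
    next
      case (Suc j)
      have "1 - 4 * ((1 + q z) * \<rho> ^ Suc j - 1) \<le> 5 - 4 * \<rho> ^ j * measure_pmf.expectation (P z) (\<lambda>z'. 1 + q z')"
        using mult_left_mono[OF q_step[OF Suc.prems], of "4 * \<rho> ^ j"] \<rho> by (simp add: algebra_simps)
      also have "\<dots> = measure_pmf.expectation (P z) (\<lambda>z'. 5 - 4 * \<rho> ^ j * (1 + q z'))"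
        using iq[OF Suc.prems] by simp
      also have "\<dots> \<le> measure_pmf.expectation (P z) (\<lambda>z'. if z' = 1 then 0 else survival j z')"
      proof (rule integral_mono_AE)
        show "integrable (P z) (\<lambda>z'. 5 - 4 * \<rho> ^ j * (1 + q z'))"
          using iq[OF Suc.prems] by simp
        show "AE z' in P z. 5 - 4 * \<rho> ^ j * (1 + q z') \<le> (if z' = 1 then 0 else survival j z')"
        proof (rule AE_pmfI)
          fix z' assume "z' \<in> set_pmf (P z)"
          then have z': "1 \<le> z'" by (rule urn_kernel_ge_1)
          show "5 - 4 * \<rho> ^ j * (1 + q z') \<le> (if z' = 1 then 0 else survival j z')"
          proof (cases "z' = 1")
            case True
            have "5 / 4 * 1 \<le> (1 + q 1) * \<rho> ^ j"
              using q1 \<rho> by (intro mult_mono one_le_power) auto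
            then show ?thesis using True by (simp add: mult_ac)
          next
            case False
            then show ?thesis using Suc.IH[OF z'] by (simp add: algebra_simps)
          qed
        qed
      qed (rule integrable_survival)
      finally show ?case by simp
    qed
    have "\<rho> ^ k \<le> exp (3 * B / real x) ^ k"
      unfolding \<rho>_def using B rx by (intro power_mono exp_ge_add_one_self) (auto intro!: add_nonneg_nonneg)
    also have "\<dots> = exp (3 * B * real k / real x)"
      by (simp add: exp_of_nat_mult[symmetric] mult_ac)
    also have "\<dots> \<le> exp (1 / 9)"
    proof -
      have "27 * B * real k \<le> real K * real k"
        using K by (intro mult_right_mono) auto
      also have "\<dots> \<le> real x" using x by (metis of_nat_le_iff of_nat_mult)
      finally show ?thesis using rx by (simp add: field_simps)
    qed
    also have "\<dots> \<le> 1 + 1/9 + (1/9)\<^sup>2" by (rule exp_bound) auto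
    also have "\<dots> \<le> 9 / 8" by (simp add: power2_eq_square)
    finally have "\<rho> ^ k \<le> 9 / 8" .
    moreover have "1 - 4 * (\<rho> ^ k - 1) \<le> survival k x"
      using main[of x k] x2 by (simp add: q_def)
    ultimately show "1/2 \<le> survival k x" by argo
  qed (use K in simp)
qed

lemma powr_drift_lower:
  assumes "0 < \<beta>" "3 * noise_mean - 1 < \<beta>"
  obtains \<epsilon> n where "0 < \<epsilon>"
    "\<And>z. 1 \<le> z \<Longrightarrow> n \<le> z \<Longrightarrow> real z powr \<beta> + \<epsilon> * real z powr (\<beta> - 1) \<le> powr_mean \<beta> z"
proof -
  define L where "L = \<beta> / 3 * (\<beta> - (3 * noise_mean - 1))"
  define \<epsilon> where "\<epsilon> = L / 2"
  have \<epsilon>: "0 < \<epsilon>" using assms by (auto simp: \<epsilon>_def L_def)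
  then have "\<epsilon> < \<beta> / 3 * (\<beta> - (3 * noise_mean - 1))"
    unfolding L_def[symmetric] by (simp add: \<epsilon>_def)
  from order_tendstoD(1)[OF powr_mean_tendsto[OF assms(1)] this]
  obtain n where n: "\<And>z. n \<le> z \<Longrightarrow> \<epsilon> < real z powr (1 - \<beta>) * (powr_mean \<beta> z - real z powr \<beta>)"
    by (auto simp: eventually_sequentially)
  show ?thesis
  proof (rule that[OF \<epsilon>])
    fix z :: nat assume z: "1 \<le> z" "n \<le> z"
    show "real z powr \<beta> + \<epsilon> * real z powr (\<beta> - 1) \<le> powr_mean \<beta> z"
      using n[OF z(2)] powr_mean_le_iff(2)[OF z(1), of \<epsilon> \<beta>] by simp
  qed
qed

lemma powr_drift_upper:
  assumes "0 < \<beta>"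
  obtains C n where "0 < C"
    "\<And>z. 1 \<le> z \<Longrightarrow> n \<le> z \<Longrightarrow> powr_mean \<beta> z \<le> real z powr \<beta> + C * real z powr (\<beta> - 1)"
proof -
  define C where "C = \<bar>\<beta> / 3 * (\<beta> - (3 * noise_mean - 1))\<bar> + 1"
  have C: "0 < C" by (auto simp: C_def intro: add_nonneg_pos)
  have "\<beta> / 3 * (\<beta> - (3 * noise_mean - 1)) < C"
    by (simp add: C_def abs_if)
  from order_tendstoD(2)[OF powr_mean_tendsto[OF assms(1)] this]
  obtain n where n: "\<And>z. n \<le> z \<Longrightarrow> real z powr (1 - \<beta>) * (powr_mean \<beta> z - real z powr \<beta>) < C"
    by (auto simp: eventually_sequentially)
  show ?thesis
  proof (rule that[OF C])
    fix z :: nat assume z: "1 \<le> z" "n \<le> z"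
    show "powr_mean \<beta> z \<le> real z powr \<beta> + C * real z powr (\<beta> - 1)"
      using n[OF z(2)] powr_mean_le_iff(1)[OF z(1), of \<beta> C] by simp
  qed
qed

text \<open>
  The term with exponent \<open>\<beta> + 1\<close> in \<open>h\<close> keeps the function bounded, so that overshoots above \<open>x\<close>
  do no harm; the constant \<open>A\<close> makes its positive part vanish where the drift is not under control.
\<close>

lemma survival_lower:
  assumes \<beta>: "0 < \<beta>" "3 * noise_mean - 1 < \<beta>" and z0: "1 \<le> z0"
  obtains c n0 where "0 < c" "\<And>n. n0 \<le> n \<Longrightarrow> c * real n powr (- \<beta>) \<le> survival (Suc n) z0"
proof -
  obtain K :: nat where K: "1 \<le> K" "\<And>k x. 1 \<le> k \<Longrightarrow> K * k \<le> x \<Longrightarrow> 1/2 \<le> survival k x"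
    using survival_ge_half by blast
  obtain \<epsilon> n1 where \<epsilon>: "0 < \<epsilon>" and lo:
    "\<And>z. 1 \<le> z \<Longrightarrow> n1 \<le> z \<Longrightarrow> real z powr \<beta> + \<epsilon> * real z powr (\<beta> - 1) \<le> powr_mean \<beta> z"
    using powr_drift_lower[OF \<beta>] by blast
  have \<beta>1: "0 < \<beta> + 1" using \<beta> by simp
  obtain D n2 where D: "0 < D" and up:
    "\<And>z. 1 \<le> z \<Longrightarrow> n2 \<le> z \<Longrightarrow> powr_mean (\<beta> + 1) z \<le> real z powr (\<beta> + 1) + D * real z powr (\<beta> + 1 - 1)"
    using powr_drift_upper[OF \<beta>1] by blast
  define z1 where "z1 = n1 + n2 + 1"
  \<comment> \<open>With this ratio the loss \<open>\<eta> / x * D * z powr \<beta>\<close> from the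
    correction term equals \<open>\<epsilon> / x * z powr \<beta>\<close>, which for
    \<open>z \<le> x\<close> is at most the gain
    \<open>\<epsilon> * z powr (\<beta> - 1)\<close>.\<close>
  define \<eta> where "\<eta> = \<epsilon> / D"
  have \<eta>: "0 < \<eta>" using \<epsilon> D by (simp add: \<eta>_def)
  define A where "A = real z1 powr \<beta>"
  \<comment> \<open>As \<open>h\<close> is at most \<open>\<eta> powr (- \<beta>)\<close>, this
    factor gives \<open>g \<le> 1/2\<close>, the survival probability that
    \<open>survival_ge_half\<close> guarantees from high levels.\<close>
  define c where "c = \<eta> powr \<beta> / 2"
  have c: "0 < c" using \<eta> by (simp add: c_def)
  define h where "h = (\<lambda>x (z::nat). x powr (- \<beta>) * (real z powr \<beta> - A - \<eta> / x * real z powr (\<beta> + 1)))"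
  define g where "g = (\<lambda>x z. c * max 0 (h x z))"
  have h_le: "h x z \<le> \<eta> powr (- \<beta>)" if x: "0 < x" and z: "1 \<le> z" for x z
  proof -
    have A: "0 \<le> A" by (simp add: A_def)
    have "real z powr (\<beta> + 1) = real z powr \<beta> * real z"
      using z by (simp add: powr_add)
    then have "h x z \<le> x powr (- \<beta>) * (real z powr \<beta> * (1 - \<eta> * real z / x))"
      unfolding h_def using A by (intro mult_left_mono) (simp_all add: algebra_simps)
    also have "\<dots> \<le> \<eta> powr (- \<beta>)"
    proof (cases "\<eta> * real z / x \<le> 1")
      case True
      then have "real z powr \<beta> \<le> (x / \<eta>) powr \<beta>"
        using x \<eta> \<beta> by (intro powr_mono2) (auto simp: field_simps)
      moreover have "real z powr \<beta> * (1 - \<eta> * real z / x) \<le> real z powr \<beta>"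
        using x \<eta> by (intro mult_left_le) auto
      ultimately have "x powr (- \<beta>) * (real z powr \<beta> * (1 - \<eta> * real z / x)) \<le> x powr (- \<beta>) * (x / \<eta>) powr \<beta>"
        by (intro mult_left_mono) auto
      also have "\<dots> = \<eta> powr (- \<beta>)"
        using x \<eta> by (simp add: powr_divide powr_minus field_simps)
      finally show ?thesis .
    next
      case False
      then have "real z powr \<beta> * (1 - \<eta> * real z / x) \<le> 0"
        by (intro mult_nonneg_nonpos) auto
      then have "x powr (- \<beta>) * (real z powr \<beta> * (1 - \<eta> * real z / x)) \<le> 0"
        by (rule mult_nonneg_nonpos[rotated]) simp
      also have "0 \<le> \<eta> powr (- \<beta>)" by simp
      finally show ?thesis .
    qed
    finally show ?thesis .
  qed
  have g_bounds: "0 \<le> g x z" "g x z \<le> 1/2" if "0 < x" "1 \<le> z" for x z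
  proof -
    show "0 \<le> g x z" using c by (simp add: g_def)
    have "max 0 (h x z) \<le> \<eta> powr (- \<beta>)" using h_le[OF that] by simp
    then have "g x z \<le> c * \<eta> powr (- \<beta>)"
      unfolding g_def using c by (intro mult_left_mono) auto
    also have "\<dots> = 1/2" using \<eta> by (simp add: c_def powr_minus)
    finally show "g x z \<le> 1/2" .
  qed
  have g_small: "g x z = 0" if "0 < x" "z \<le> z1" for x z
  proof -
    have "real z powr \<beta> \<le> A" unfolding A_def using that \<beta> by (intro powr_mono2) auto
    moreover have "0 \<le> \<eta> / x * real z powr (\<beta> + 1)" using that \<eta> by simp
    ultimately have "h x z \<le> 0"
      unfolding h_def by (intro mult_nonneg_nonpos) auto
    then show ?thesis by (simp add: g_def)
  qed
  have ig: "integrable (P z) (g x)" if "0 < x" for x z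
    using g_bounds[OF that] urn_kernel_ge_1[of _ \<kappa> z]
    by (intro measure_pmf.integrable_const_bound[where B="1/2"]) (auto simp: AE_measure_pmf_iff)
  \<comment> \<open>The submartingale inequality is needed only up to \<open>x\<close>; above that
    level \<open>survival_ge_half\<close> takes over.\<close>
  have g_sub: "g x z \<le> measure_pmf.expectation (P z) (g x)"
    if x: "0 < x" and z: "1 \<le> z" "real z \<le> x" for x z
  proof (cases "z \<le> z1")
    case True
    have "0 \<le> measure_pmf.expectation (P z) (g x)"
      using c by (intro integral_nonneg_AE) (simp add: g_def)
    then show ?thesis using g_small[OF x True] by simp
  next
    case False
    have i1: "integrable (P z) (\<lambda>z'. real z' powr \<beta>)" "integrable (P z) (\<lambda>z'. real z' powr (\<beta> + 1))"
      using \<beta> z by (auto intro: integrable_kernel_powr)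
    have ih: "integrable (P z) (h x)"
      unfolding h_def using i1 by (intro integrable_mult_right Bochner_Integration.integrable_diff) auto
    have "h x z \<le> x powr (- \<beta>) * (powr_mean \<beta> z - A - \<eta> / x * powr_mean (\<beta> + 1) z)"
      unfolding h_def
    proof (rule mult_left_mono)
      have l: "real z powr \<beta> + \<epsilon> * real z powr (\<beta> - 1) \<le> powr_mean \<beta> z"
        using False z by (intro lo) (auto simp: z1_def)
      have "\<eta> / x * powr_mean (\<beta> + 1) z \<le> \<eta> / x * (real z powr (\<beta> + 1) + D * real z powr \<beta>)"
        using up[of z] False z \<eta> x by (intro mult_left_mono) (auto simp: z1_def)
      also have "\<dots> = \<eta> / x * real z powr (\<beta> + 1) + \<epsilon> / x * real z powr \<beta>"
        using D by (simp add: \<eta>_def distrib_left)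
      also have "\<epsilon> / x * real z powr \<beta> \<le> \<epsilon> / real z * real z powr \<beta>"
        using z x \<epsilon> by (intro mult_right_mono divide_left_mono) auto
      also have "\<epsilon> / real z * real z powr \<beta> = \<epsilon> * real z powr (\<beta> - 1)"
        using z by (simp add: powr_diff)
      finally show "real z powr \<beta> - A - \<eta> / x * real z powr (\<beta> + 1) \<le> powr_mean \<beta> z - A - \<eta> / x * powr_mean (\<beta> + 1) z"
        using l by linarith
    qed simp
    also have "\<dots> = measure_pmf.expectation (P z) (h x)"
      unfolding h_def powr_mean_def using i1 by simp
    finally have "c * h x z \<le> measure_pmf.expectation (P z) (\<lambda>z'. c * h x z')"
      using c by simp
    also have "\<dots> \<le> measure_pmf.expectation (P z) (g x)"
      using c by (intro integral_mono ig[OF x] integrable_mult_right ih) (simp add: g_def)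
    finally have "c * h x z \<le> measure_pmf.expectation (P z) (g x)" .
    moreover have "0 \<le> measure_pmf.expectation (P z) (g x)"
      using c by (intro integral_nonneg_AE) (simp add: g_def)
    ultimately show ?thesis by (simp add: g_def max_def)
  qed
  \<comment> \<open>Here \<open>x = K n\<close> with \<open>n\<close> the whole time horizon, so
    from any point above \<open>x\<close> the remaining \<open>j \<le> n\<close> steps are survived
    with probability at least 1/2.\<close>
  have main: "g (real (K * n)) z \<le> survival j z" if n: "1 \<le> n" and j: "j \<le> n" and z: "1 \<le> z" for n j z
    using j z
  proof (induction j arbitrary: z)
    case 0
    have "0 < real (K * n)" using K(1) n by simp
    from g_bounds(2)[OF this 0(2)] show ?case by simp
  next
    case (Suc j)
    have x: "0 < real (K * n)" using K(1) n by simp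
    show ?case
    proof (cases "K * n \<le> z")
      case True
      have "K * Suc j \<le> z" using Suc.prems True by (intro order_trans[OF mult_le_mono2 True]) auto
      then have "1/2 \<le> survival (Suc j) z" by (intro K(2)) auto
      with g_bounds(2)[OF x Suc.prems(2)] show ?thesis by linarith
    next
      case False
      then have "real z \<le> real (K * n)" by (simp only: of_nat_le_iff)
      then have "g (real (K * n)) z \<le> measure_pmf.expectation (P z) (g (real (K * n)))"
        using Suc.prems by (intro g_sub[OF x]) auto
      also have "\<dots> \<le> measure_pmf.expectation (P z) (\<lambda>z'. if z' = 1 then 0 else survival j z')"
      proof (rule integral_mono_AE[OF ig[OF x] integrable_survival], rule AE_pmfI)
        fix z' assume "z' \<in> set_pmf (P z)"
        then have "1 \<le> z'" by (rule urn_kernel_ge_1)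
        then show "g (real (K * n)) z' \<le> (if z' = 1 then 0 else survival j z')"
          using Suc.IH[of z'] Suc.prems(1) g_small[OF x, of 1] by (auto simp: z1_def)
      qed
      finally show ?thesis by simp
    qed
  qed
  \<comment> \<open>The first step goes to a state \<open>s\<close> with
    \<open>s powr \<beta> \<ge> A + 1\<close>, so that \<open>h x s\<close> is positive for large
    \<open>x\<close>. This extra step is the reason for \<open>Suc n\<close> in the
    conclusion.\<close>
  obtain b :: nat where b: "real b \<ge> (A + 1) powr (1 / \<beta>)" using real_arch_simple by blast
  obtain s where s: "b \<le> s" "0 < pmf (P z0) s" using kernel_unbounded[OF z0] by blast
  have "A + 1 = ((A + 1) powr (1 / \<beta>)) powr \<beta>"
    using \<beta> by (simp add: powr_powr A_def add_nonneg_nonneg)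
  also have "\<dots> \<le> real s powr \<beta>"
    using b s \<beta> by (intro powr_mono2) auto
  finally have sA: "A + 1 \<le> real s powr \<beta>" .
  have s1: "1 < s"
  proof (rule ccontr)
    assume "\<not> 1 < s"
    then have "real s powr \<beta> \<le> real z1 powr \<beta>" using \<beta> by (intro powr_mono2) (auto simp: z1_def)
    with sA show False by (simp add: A_def)
  qed
  \<comment> \<open>For \<open>x \<ge> W\<close> the correction term at \<open>s\<close> is at most
    1/2, which leaves \<open>h x s \<ge> x powr (- \<beta>) / 2\<close>.\<close>
  define W where "W = 2 * \<eta> * real s powr (\<beta> + 1)"
  define c' where "c' = pmf (P z0) s * (c * (real K powr (- \<beta>) / 2))"
  show ?thesis
  proof (rule that[of c' "nat \<lceil>W\<rceil> + 1"])
    show "0 < c'" using s c K(1) by (simp add: c'_def)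
    fix n assume "nat \<lceil>W\<rceil> + 1 \<le> n"
    then have n: "1 \<le> n" "W \<le> real n" using real_nat_ceiling_ge[of W] by linarith+
    define x where "x = real (K * n)"
    have x: "0 < x" "W \<le> x"
    proof -
      show "0 < x" using K(1) n by (simp add: x_def)
      have "real n \<le> x" using K(1) by (simp add: x_def mult_le_cancel_right1)
      with n show "W \<le> x" by linarith
    qed
    have "\<eta> / x * real s powr (\<beta> + 1) \<le> 1/2"
      using x by (simp add: W_def field_simps)
    then have "x powr (- \<beta>) * (1/2) \<le> h x s"
      unfolding h_def using sA by (intro mult_left_mono) auto
    then have "c * (x powr (- \<beta>) * (1/2)) \<le> g x s"
      unfolding g_def using c by (intro mult_left_mono) auto
    also have "g x s \<le> survival n s"
      unfolding x_def using n s1 by (intro main) auto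
    finally have sv: "c * (x powr (- \<beta>) * (1/2)) \<le> survival n s" .
    have "c' * real n powr (- \<beta>) = pmf (P z0) s * (c * (x powr (- \<beta>) * (1/2)))"
      unfolding x_def c'_def by (simp add: powr_mult)
    also have "\<dots> \<le> pmf (P z0) s * survival n s"
      using sv by (intro mult_left_mono) auto
    also have "\<dots> = measure_pmf.expectation (P z0) (\<lambda>z'. survival n s * indicator {s} z')"
      by (simp add: pmf.rep_eq mult.commute)
    also have "\<dots> \<le> survival (Suc n) z0"
      using s1 survival_bounds[of n] unfolding survival.simps
      by (intro integral_mono integrable_survival measure_pmf.integrable_const_bound[where B=1])
         (auto simp: indicator_def)
    finally show "c' * real n powr (- \<beta>) \<le> survival (Suc n) z0" .
  qed
qed

end

section \<open>From the urn to the embedded chain\<close>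

definition restart_val :: "int \<times> int \<Rightarrow> nat" where
  "restart_val p = nat (max \<bar>fst p\<bar> \<bar>snd p\<bar>)"

definition on_axis :: "int \<times> int \<Rightarrow> bool" where
  "on_axis p \<longleftrightarrow> fst p * snd p = 0"

abbreviation (input) shift :: "(nat \<Rightarrow> 'b) \<Rightarrow> nat \<Rightarrow> 'b" where
  "shift s \<equiv> \<lambda>i. s (Suc i)"

definition next_axis :: "(nat \<Rightarrow> int \<times> int) \<Rightarrow> enat \<Rightarrow> enat" where
  "next_axis s t = Inf {enat n | n. t \<le> enat n \<and> on_axis (s n)}"

lemma succ_nu_Suc: "succ_nu s (Suc k) = eSuc (next_axis s (succ_nu s k))"
  by (simp add: next_axis_def on_axis_def)

lemma Inf_eSuc_image: "Inf (eSuc ` A) = eSuc (Inf A)"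
proof (cases "A = {}")
  case False
  then have "Inf A \<in> A"
    unfolding Inf_enat_def by (auto intro: LeastI)
  then show ?thesis
    by (intro antisym Inf_lower Inf_greatest) (auto intro: Inf_lower)
qed (simp add: top_enat_def)

lemma next_axis_shift: "next_axis s (eSuc t) = eSuc (next_axis (shift s) t)"
proof -
  have "{enat n | n. eSuc t \<le> enat n \<and> on_axis (s n)} = eSuc ` {enat n | n. t \<le> enat n \<and> on_axis (s (Suc n))}"
    (is "?A = ?B")
  proof
    show "?A \<subseteq> ?B"
    proof
      fix x assume "x \<in> ?A"
      then obtain n where n: "x = enat n" "eSuc t \<le> enat n" "on_axis (s n)" by blast
      then obtain n' where n': "n = Suc n'"
        by (cases n) (auto simp: enat_0)
      have "t \<le> enat n'" using n n' by (simp flip: eSuc_enat)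
      then show "x \<in> ?B" using n n' by (auto simp flip: eSuc_enat)
    qed
    show "?B \<subseteq> ?A"
    proof
      fix x assume "x \<in> ?B"
      then obtain n where n: "x = eSuc (enat n)" "t \<le> enat n" "on_axis (s (Suc n))" by blast
      then have "eSuc t \<le> enat (Suc n)" by (simp flip: eSuc_enat)
      with n show "x \<in> ?A" unfolding eSuc_enat by blast
    qed
  qed
  then show ?thesis by (simp add: next_axis_def Inf_eSuc_image)
qed

lemma next_axis_0: "next_axis s 0 = (if on_axis (s 0) then 0 else eSuc (next_axis (shift s) 0))"
proof (cases "on_axis (s 0)")
  case True
  then have "next_axis s 0 \<le> enat 0" unfolding next_axis_def by (intro Inf_lower) auto
  with True show ?thesis by (simp add: enat_0)
next
  case False
  have "{enat n | n. 0 \<le> enat n \<and> on_axis (s n)} = eSuc ` {enat n | n. 0 \<le> enat n \<and> on_axis (s (Suc n))}"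
    (is "?A = ?B")
  proof
    show "?A \<subseteq> ?B"
    proof
      fix x assume "x \<in> ?A"
      then obtain n where n: "x = enat n" "on_axis (s n)" by blast
      then obtain n' where "n = Suc n'" using False by (cases n) auto
      then show "x \<in> ?B" using n by (auto simp flip: eSuc_enat)
    qed
  qed (auto simp: eSuc_enat)
  then show ?thesis using False by (simp add: next_axis_def Inf_eSuc_image)
qed

text \<open>Removing the first state uses up one passage if it lies on the axis, as the first
  restart is then at time 1, and none otherwise (\<open>succ_nu_shift\<close>). This turns the
  passage times into a recursion along the path.\<close>

lemma succ_nu_shift_axis: "on_axis (s 0) \<Longrightarrow> succ_nu s (Suc j) = eSuc (succ_nu (shift s) j)"
proof (induction j)
  case 0
  then have "next_axis s 0 = 0" using next_axis_0[of s] by (simp only: if_True)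
  then show ?case by (simp only: succ_nu_Suc succ_nu.simps(1))
next
  case (Suc j)
  have "next_axis s (succ_nu s (Suc j)) = eSuc (next_axis (shift s) (succ_nu (shift s) j))"
    by (subst Suc.IH[OF Suc.prems]) (rule next_axis_shift)
  then have "eSuc (next_axis s (succ_nu s (Suc j))) = eSuc (succ_nu (shift s) (Suc j))"
    by (subst (2) succ_nu_Suc) (rule arg_cong[where f=eSuc])
  then show ?case
    by (subst succ_nu_Suc)
qed

lemma succ_nu_shift: "\<not> on_axis (s 0) \<Longrightarrow> succ_nu s (Suc j) = eSuc (succ_nu (shift s) (Suc j))"
proof (induction j)
  case 0
  then have "next_axis s 0 = eSuc (next_axis (shift s) 0)"
    using next_axis_0[of s] by (simp only: if_False)
  then show ?case by (simp only: succ_nu_Suc succ_nu.simps(1))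
next
  case (Suc j)
  have "next_axis s (succ_nu s (Suc j)) = eSuc (next_axis (shift s) (succ_nu (shift s) (Suc j)))"
    by (subst Suc.IH[OF Suc.prems]) (rule next_axis_shift)
  then have "eSuc (next_axis s (succ_nu s (Suc j))) = eSuc (succ_nu (shift s) (Suc (Suc j)))"
    by (subst (2) succ_nu_Suc) (rule arg_cong[where f=eSuc])
  then show ?case
    by (subst succ_nu_Suc)
qed

definition val_at :: "(nat \<Rightarrow> int \<times> int) \<Rightarrow> enat \<Rightarrow> nat" where
  "val_at s t = (case t of enat n \<Rightarrow> restart_val (s n) | \<infinity> \<Rightarrow> 0)"

lemma val_at_0: "val_at s 0 = restart_val (s 0)"
  by (simp add: val_at_def zero_enat_def)

lemma val_at_eSuc: "val_at s (eSuc t) = val_at (shift s) t"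
  by (cases t) (simp_all add: val_at_def eSuc_enat)

lemma embedded_eq_val_at: "1 \<le> j \<Longrightarrow> embedded z0 s j = val_at s (succ_nu s j)"
  by (cases "succ_nu s j") (simp_all add: embedded_def val_at_def restart_val_def)

text \<open>
  \<open>visits n k s\<close>: within \<open>n\<close> steps and at most \<open>k\<close> passages of the axis, some restart is at \<open>1\<close>.
\<close>

primrec visits :: "nat \<Rightarrow> nat \<Rightarrow> (nat \<Rightarrow> int \<times> int) \<Rightarrow> bool" where
  "visits 0 k s = False"
| "visits (Suc n) k s = (if on_axis (s 0)
     then (case k of 0 \<Rightarrow> False | Suc k' \<Rightarrow> restart_val (s 1) = 1 \<or> visits n k' (shift s))
     else visits n k (shift s))"

lemma visits_imp: "visits n k s \<Longrightarrow> \<exists>j. 1 \<le> j \<and> j \<le> k \<and> val_at s (succ_nu s j) = 1"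
proof (induction n arbitrary: k s)
  case (Suc n)
  show ?case
  proof (cases "on_axis (s 0)")
    case True
    with Suc.prems obtain k' where k': "k = Suc k'" "restart_val (s 1) = 1 \<or> visits n k' (shift s)"
      by (cases k) auto
    have "\<exists>j\<le>k'. val_at (shift s) (succ_nu (shift s) j) = 1"
      using k'(2)
    proof
      assume "restart_val (s 1) = 1"
      then show ?thesis by (intro exI[of _ 0]) (simp add: val_at_0)
    next
      assume "visits n k' (shift s)"
      from Suc.IH[OF this] show ?thesis by blast
    qed
    then obtain j where "j \<le> k'" "val_at s (succ_nu s (Suc j)) = 1"
      unfolding succ_nu_shift_axis[of s, OF True] val_at_eSuc by blast
    then show ?thesis using k' by (intro exI[of _ "Suc j"]) auto
  next
    case False
    with Suc.prems have "visits n k (shift s)" by simp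
    from Suc.IH[OF this] obtain j where j: "1 \<le> j" "j \<le> k" "val_at (shift s) (succ_nu (shift s) j) = 1"
      by blast
    then obtain j' where "j = Suc j'" by (cases j) auto
    then have "val_at s (succ_nu s j) = 1"
      using j succ_nu_shift[of s j', OF False] by (simp add: val_at_eSuc del: succ_nu.simps)
    then show ?thesis using j by blast
  qed
qed simp

text \<open>The restart time itself is a sufficient number of steps; it is positive, so
  \<open>n = 0\<close> cannot arise.\<close>

lemma visits_of_val_at:
  "succ_nu s (Suc j) = enat n \<Longrightarrow> Suc j \<le> k \<Longrightarrow> val_at s (succ_nu s (Suc j)) = 1 \<Longrightarrow> visits n k s"
proof (induction n arbitrary: k s j)
  case 0
  then show ?case by (simp add: enat_0)
next
  case (Suc n)
  show ?case
  proof (cases "on_axis (s 0)")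
    case True
    have e: "eSuc (succ_nu (shift s) j) = eSuc (enat n)"
      using Suc.prems(1) unfolding succ_nu_shift_axis[of s, OF True] eSuc_enat .
    then have n: "succ_nu (shift s) j = enat n" by simp
    have v: "val_at (shift s) (succ_nu (shift s) j) = 1"
      using Suc.prems(3) unfolding succ_nu_shift_axis[of s, OF True] val_at_eSuc .
    obtain k' where k: "k = Suc k'" using Suc.prems(2) by (cases k) auto
    show ?thesis
    proof (cases j)
      case 0
      with v have "restart_val (s 1) = 1" by (simp add: val_at_0)
      then show ?thesis using True k by simp
    next
      case (Suc j')
      have "visits n k' (shift s)"
        using n v Suc.prems(2) k unfolding Suc by (intro Suc.IH[of "shift s" j']) auto
      then show ?thesis using True k by simp
    qed
  next
    case False
    have n: "succ_nu (shift s) (Suc j) = enat n"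
      using Suc.prems(1) unfolding succ_nu_shift[of s, OF False] by (simp add: eSuc_enat[symmetric] del: succ_nu.simps)
    have v: "val_at (shift s) (succ_nu (shift s) (Suc j)) = 1"
      using Suc.prems(3) unfolding succ_nu_shift[of s, OF False] val_at_eSuc .
    show ?thesis using False Suc.IH[OF n Suc.prems(2) v] by simp
  qed
qed

text \<open>A restart that never happens has value 0 and is no visit to 1, so a visit within
  \<open>k\<close> passages occurs after finitely many steps. The event is thus a countable
  increasing union of events on finitely many states.\<close>

lemma tau_q_le_iff: "tau_q z0 s \<le> enat k \<longleftrightarrow> (\<exists>n. visits n k s)"
proof -
  have "tau_q z0 s \<le> enat k \<longleftrightarrow> (\<exists>j. 1 \<le> j \<and> j \<le> k \<and> embedded z0 s j = 1)"
  proof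
    assume t: "tau_q z0 s \<le> enat k"
    show "\<exists>j. 1 \<le> j \<and> j \<le> k \<and> embedded z0 s j = 1"
    proof (rule ccontr)
      assume no: "\<not> ?thesis"
      have "enat (Suc k) \<le> tau_q z0 s"
        unfolding tau_q_def
      proof (rule Inf_greatest)
        fix x assume "x \<in> {enat j | j. 1 \<le> j \<and> embedded z0 s j = 1}"
        then obtain j where "x = enat j" "1 \<le> j" "embedded z0 s j = 1" by blast
        with no have "\<not> j \<le> k" by blast
        with \<open>x = enat j\<close> show "enat (Suc k) \<le> x" by simp
      qed
      with t have "enat (Suc k) \<le> enat k" by (rule order_trans[rotated])
      then show False by simp
    qed
  next
    assume "\<exists>j. 1 \<le> j \<and> j \<le> k \<and> embedded z0 s j = 1"
    then obtain j where j: "1 \<le> j" "j \<le> k" "embedded z0 s j = 1" by blast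
    then have "tau_q z0 s \<le> enat j"
      unfolding tau_q_def by (intro Inf_lower) blast
    also have "enat j \<le> enat k" using j by simp
    finally show "tau_q z0 s \<le> enat k" .
  qed
  also have "\<dots> \<longleftrightarrow> (\<exists>j. 1 \<le> j \<and> j \<le> k \<and> val_at s (succ_nu s j) = 1)"
    by (auto simp: embedded_eq_val_at)
  also have "\<dots> \<longleftrightarrow> (\<exists>n. visits n k s)"
  proof
    assume "\<exists>j. 1 \<le> j \<and> j \<le> k \<and> val_at s (succ_nu s j) = 1"
    then obtain j where j: "1 \<le> j" "j \<le> k" "val_at s (succ_nu s j) = 1" by blast
    then obtain j' where j': "j = Suc j'" by (cases j) auto
    obtain n where "succ_nu s j = enat n"
      using j(3) by (cases "succ_nu s j") (auto simp: val_at_def)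
    then show "\<exists>n. visits n k s"
      using visits_of_val_at[of s j' n k] j unfolding j' by blast
  qed (use visits_imp in blast)
  finally show ?thesis .
qed

lemma visits_mono: "visits n k s \<Longrightarrow> visits (Suc n) k s"
proof (induction n arbitrary: k s)
  case (Suc n)
  have IH: "visits (Suc n) k' (shift s)" if "visits n k' (shift s)" for k'
    using Suc.IH that by blast
  with Suc.prems show ?case
    unfolding visits.simps(2)[of "Suc n"] visits.simps(2)[of n k s]
    by (auto simp del: visits.simps intro: IH split: if_splits nat.splits)
qed simp

section \<open>Probability of a visit within finitely many urn steps\<close>

primrec visit_prob :: "int pmf \<Rightarrow> nat \<Rightarrow> nat \<Rightarrow> int \<times> int \<Rightarrow> ennreal" where
  "visit_prob \<kappa> 0 k s = 0"
| "visit_prob \<kappa> (Suc n) k s = (if on_axis s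
     then (case k of 0 \<Rightarrow> 0 | Suc k' \<Rightarrow>
       \<integral>\<^sup>+ s'. (if restart_val s' = 1 then 1 else visit_prob \<kappa> n k' s') \<partial>urn_step \<kappa> s)
     else \<integral>\<^sup>+ s'. visit_prob \<kappa> n k s' \<partial>urn_step \<kappa> s)"

lemma pred_visits:
  assumes "\<And>i. S i \<in> measurable M (count_space UNIV)"
  shows "Measurable.pred M (\<lambda>\<omega>. visits n k (\<lambda>i. S i \<omega>))"
  using assms
proof (induction n arbitrary: k S)
  case (Suc n)
  note [measurable] = Suc.prems
  have [measurable]: "Measurable.pred M (\<lambda>\<omega>. visits n k (\<lambda>i. S (Suc i) \<omega>))" for k
    by (rule Suc.IH) (rule Suc.prems)
  show ?case by (cases k) simp_all
qed simp

locale urn_chain =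
  fixes M :: "'a measure" and K :: "'s::countable \<Rightarrow> 's pmf" and s0 :: 's and S :: "nat \<Rightarrow> 'a \<Rightarrow> 's"
  assumes chain: "markov_chain M K s0 S"
begin

sublocale prob_space M
  using chain by (simp add: markov_chain_def)

lemma measurable_S [measurable]: "S n \<in> measurable M (count_space UNIV)"
  using chain by (simp add: markov_chain_def)

definition history :: "nat \<Rightarrow> (nat \<Rightarrow> 's) \<Rightarrow> 'a \<Rightarrow> bool" where
  "history m h \<omega> \<longleftrightarrow> (\<forall>i\<le>m. S i \<omega> = h i)"

lemma pred_history [measurable]: "Measurable.pred M (history m h)"
  unfolding history_def by measurable

lemma history_Suc: "history (Suc m) (h(Suc m := s)) \<omega> \<longleftrightarrow> history m h \<omega> \<and> S (Suc m) \<omega> = s"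
  by (auto simp: history_def le_Suc_eq)

text \<open>The conditional probability says nothing about a history of probability 0, but then both
  sides vanish.\<close>

lemma emeasure_history_Suc:
  "emeasure M {\<omega> \<in> space M. history (Suc m) (h(Suc m := s)) \<omega>}
     = emeasure M {\<omega> \<in> space M. history m h \<omega>} * ennreal (pmf (K (h m)) s)"
proof (cases "prob {\<omega> \<in> space M. history m h \<omega>} > 0")
  case True
  then have "\<P>(\<omega> in M. S (Suc m) \<omega> = s \<bar> history m h \<omega>) = pmf (K (h m)) s"
    using chain by (simp add: markov_chain_def history_def)
  then have "prob {\<omega> \<in> space M. S (Suc m) \<omega> = s \<and> history m h \<omega>}
      = prob {\<omega> \<in> space M. history m h \<omega>} * pmf (K (h m)) s"
    using True by (simp add: cond_prob_def field_simps)
  then show ?thesis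
    by (simp add: history_Suc emeasure_eq_measure ennreal_mult'' conj_commute)
next
  case False
  then have z: "prob {\<omega> \<in> space M. history m h \<omega>} = 0"
    by (simp add: zero_less_measure_iff)
  have "prob {\<omega> \<in> space M. history (Suc m) (h(Suc m := s)) \<omega>} \<le> prob {\<omega> \<in> space M. history m h \<omega>}"
    by (intro finite_measure_mono) (auto simp: history_Suc)
  with z have "prob {\<omega> \<in> space M. history (Suc m) (h(Suc m := s)) \<omega>} = 0"
    by (simp add: measure_le_0_iff)
  with z show ?thesis by (simp add: emeasure_eq_measure)
qed

text \<open>Disjoint decomposition by the next state; \<open>f s\<close> plays the conditional
  probability of \<open>Q\<close> once that state is known.\<close>

lemma emeasure_history_step:
  assumes [measurable]: "Measurable.pred M Q"
    and step: "\<And>s. emeasure M {\<omega> \<in> space M. history (Suc m) (h(Suc m := s)) \<omega> \<and> Q \<omega>}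
        = emeasure M {\<omega> \<in> space M. history (Suc m) (h(Suc m := s)) \<omega>} * f s"
  shows "emeasure M {\<omega> \<in> space M. history m h \<omega> \<and> Q \<omega>}
     = emeasure M {\<omega> \<in> space M. history m h \<omega>} * (\<integral>\<^sup>+ s. f s \<partial>K (h m))"
proof -
  let ?A = "\<lambda>s. {\<omega> \<in> space M. history (Suc m) (h(Suc m := s)) \<omega> \<and> Q \<omega>}"
  have "{\<omega> \<in> space M. history m h \<omega> \<and> Q \<omega>} = (\<Union>s. ?A s)"
    by (auto simp: history_Suc)
  then have "emeasure M {\<omega> \<in> space M. history m h \<omega> \<and> Q \<omega>} = (\<integral>\<^sup>+ s. emeasure M (?A s) \<partial>count_space UNIV)"
    by (simp only:) (intro emeasure_UN_countable, auto simp: disjoint_family_on_def history_Suc)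
  also have "\<dots> = (\<integral>\<^sup>+ s. emeasure M {\<omega> \<in> space M. history m h \<omega>} * (ennreal (pmf (K (h m)) s) * f s) \<partial>count_space UNIV)"
    by (simp add: step emeasure_history_Suc mult.assoc)
  also have "\<dots> = emeasure M {\<omega> \<in> space M. history m h \<omega>} * (\<integral>\<^sup>+ s. f s \<partial>K (h m))"
    by (simp add: nn_integral_cmult nn_integral_measure_pmf)
  finally show ?thesis .
qed

end

text \<open>The induction on the number of steps runs over all times \<open>m\<close> and all
  histories up to \<open>m\<close> at once, because the Markov property conditions on full
  histories.\<close>

lemma emeasure_visits:
  assumes "markov_chain M (urn_step \<kappa>) s0 S"
  shows "emeasure M {\<omega> \<in> space M. visits n k (\<lambda>i. S i \<omega>)} = visit_prob \<kappa> n k s0"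
proof -
  interpret urn_chain M "urn_step \<kappa>" s0 S by unfold_locales (rule assms)
  have pv [measurable]: "Measurable.pred M (\<lambda>\<omega>. visits n k (\<lambda>i. S (m + i) \<omega>))" for m n k
    by (rule pred_visits) measurable
  have main: "emeasure M {\<omega> \<in> space M. history m h \<omega> \<and> visits n k (\<lambda>i. S (m + i) \<omega>)}
      = emeasure M {\<omega> \<in> space M. history m h \<omega>} * visit_prob \<kappa> n k (h m)" for m h
  proof (induction n arbitrary: k m h)
    case (Suc n)
    have IH: "emeasure M {\<omega> \<in> space M. history (Suc m) (h(Suc m := s)) \<omega> \<and> visits n k (\<lambda>i. S (m + Suc i) \<omega>)}
      = emeasure M {\<omega> \<in> space M. history (Suc m) (h(Suc m := s)) \<omega>} * visit_prob \<kappa> n k s" for k s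
      using Suc.IH[of "Suc m" "h(Suc m := s)" k] by (simp only: add_Suc add_Suc_right fun_upd_same)
    have pv' [measurable]: "Measurable.pred M (\<lambda>\<omega>. visits n k (\<lambda>i. S (m + Suc i) \<omega>))" for k
      using pv[of n k "Suc m"] by (simp only: add_Suc add_Suc_right)
    show ?case
    proof (cases "on_axis (h m)")
      case True
      show ?thesis
      proof (cases k)
        case 0
        have "{\<omega> \<in> space M. history m h \<omega> \<and> visits (Suc n) k (\<lambda>i. S (m + i) \<omega>)} = {}"
          using True 0 by (auto simp: history_def)
        then show ?thesis using True 0 by (simp only: emeasure_empty visit_prob.simps if_True nat.case mult_zero_right)
      next
        case (Suc k')
        let ?Q = "\<lambda>\<omega>. restart_val (S (Suc m) \<omega>) = 1 \<or> visits n k' (\<lambda>i. S (m + Suc i) \<omega>)"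
        have "{\<omega> \<in> space M. history m h \<omega> \<and> visits (Suc n) k (\<lambda>i. S (m + i) \<omega>)}
            = {\<omega> \<in> space M. history m h \<omega> \<and> ?Q \<omega>}"
          using True Suc by (auto simp: history_def)
        also have "emeasure M \<dots> = emeasure M {\<omega> \<in> space M. history m h \<omega>}
            * (\<integral>\<^sup>+ s'. (if restart_val s' = 1 then 1 else visit_prob \<kappa> n k' s') \<partial>urn_step \<kappa> (h m))"
        proof (rule emeasure_history_step)
          fix s
          show "emeasure M {\<omega> \<in> space M. history (Suc m) (h(Suc m := s)) \<omega> \<and> ?Q \<omega>}
             = emeasure M {\<omega> \<in> space M. history (Suc m) (h(Suc m := s)) \<omega>} * (if restart_val s = 1 then 1 else visit_prob \<kappa> n k' s)"
          proof (cases "restart_val s = 1")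
            case True
            then have "{\<omega> \<in> space M. history (Suc m) (h(Suc m := s)) \<omega> \<and> ?Q \<omega>}
                = {\<omega> \<in> space M. history (Suc m) (h(Suc m := s)) \<omega>}"
              by (auto simp: history_Suc)
            then show ?thesis using True by simp
          next
            case False
            then have "{\<omega> \<in> space M. history (Suc m) (h(Suc m := s)) \<omega> \<and> ?Q \<omega>}
                = {\<omega> \<in> space M. history (Suc m) (h(Suc m := s)) \<omega> \<and> visits n k' (\<lambda>i. S (m + Suc i) \<omega>)}"
              by (auto simp: history_Suc)
            then show ?thesis using False IH[of s k'] by simp
          qed
        qed measurable
        finally show ?thesis using True Suc by simp
      qed
    next
      case False
      have "{\<omega> \<in> space M. history m h \<omega> \<and> visits (Suc n) k (\<lambda>i. S (m + i) \<omega>)}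
          = {\<omega> \<in> space M. history m h \<omega> \<and> visits n k (\<lambda>i. S (m + Suc i) \<omega>)}"
        using False by (auto simp: history_def)
      also have "emeasure M \<dots> = emeasure M {\<omega> \<in> space M. history m h \<omega>}
          * (\<integral>\<^sup>+ s'. visit_prob \<kappa> n k s' \<partial>urn_step \<kappa> (h m))"
        by (rule emeasure_history_step[OF pv' IH])
      finally show ?thesis using False by simp
    qed
  qed simp
  have ae: "AE \<omega> in M. S 0 \<omega> = s0" using assms by (simp add: markov_chain_def)
  have "emeasure M {\<omega> \<in> space M. visits n k (\<lambda>i. S i \<omega>)}
      = emeasure M {\<omega> \<in> space M. history 0 (\<lambda>_. s0) \<omega> \<and> visits n k (\<lambda>i. S (0 + i) \<omega>)}"
    using pv[of n k 0] ae by (intro emeasure_eq_AE) (auto simp: history_def)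
  also have "\<dots> = emeasure M {\<omega> \<in> space M. history 0 (\<lambda>_. s0) \<omega>} * visit_prob \<kappa> n k s0"
    by (rule main)
  also have "emeasure M {\<omega> \<in> space M. history 0 (\<lambda>_. s0) \<omega>} = emeasure M (space M)"
    using ae by (intro emeasure_eq_AE) (auto simp: history_def)
  finally show ?thesis by (simp add: emeasure_space_1)
qed

section \<open>Reduction to one quadrant\<close>

text \<open>\<open>visit_prob\<close> with the symmetry under quarter turns divided out: a restart
  with value \<open>v\<close> lands at \<open>(v, 0)\<close>, whichever quadrant was left.\<close>

primrec quadrant_prob :: "int pmf \<Rightarrow> nat \<Rightarrow> nat \<Rightarrow> nat \<Rightarrow> nat \<Rightarrow> ennreal" where
  "quadrant_prob \<kappa> 0 k a c = 0"
| "quadrant_prob \<kappa> (Suc n) k a c = (case a of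
     0 \<Rightarrow> (case k of 0 \<Rightarrow> 0 | Suc k' \<Rightarrow>
       \<integral>\<^sup>+ j. (if noisy_restart c j = 1 then 1 else quadrant_prob \<kappa> n k' (noisy_restart c j) 0) \<partial>\<kappa>)
   | Suc a' \<Rightarrow> ennreal (real (Suc a') / real (Suc a' + c + 1)) * quadrant_prob \<kappa> n k (Suc a') (Suc c)
       + ennreal (real (c + 1) / real (Suc a' + c + 1)) * quadrant_prob \<kappa> n k a' c)"

text \<open>The four urn states that share the quadrant state \<open>(a, c)\<close>; a quarter turn
  permutes them.\<close>

definition rotations :: "nat \<Rightarrow> nat \<Rightarrow> (int \<times> int) set" where
  "rotations a c = {(int a, int c + 1), (- (int c + 1), int a), (- int a, - (int c + 1)), (int c + 1, - int a)}"

lemma nn_integral_urn_step_interior: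
  assumes "x \<noteq> 0" "y \<noteq> 0"
  shows "(\<integral>\<^sup>+ s. f s \<partial>urn_step \<kappa> (x, y))
    = ennreal (real_of_int \<bar>x\<bar> / real_of_int (\<bar>x\<bar> + \<bar>y\<bar>)) * f (x, y + sgn x)
    + ennreal (real_of_int \<bar>y\<bar> / real_of_int (\<bar>x\<bar> + \<bar>y\<bar>)) * f (x - sgn y, y)"
proof -
  define X Y where "X = real_of_int \<bar>x\<bar>" and "Y = real_of_int \<bar>y\<bar>"
  have XY: "0 < X" "0 < Y" and N: "real_of_int (\<bar>x\<bar> + \<bar>y\<bar>) = X + Y"
    using assms by (simp_all add: X_def Y_def)
  have p: "0 \<le> real_of_int \<bar>x\<bar> / real_of_int (\<bar>x\<bar> + \<bar>y\<bar>)" "real_of_int \<bar>x\<bar> / real_of_int (\<bar>x\<bar> + \<bar>y\<bar>) \<le> 1"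
    unfolding N X_def[symmetric] using XY by simp_all
  have q: "1 - real_of_int \<bar>x\<bar> / real_of_int (\<bar>x\<bar> + \<bar>y\<bar>) = real_of_int \<bar>y\<bar> / real_of_int (\<bar>x\<bar> + \<bar>y\<bar>)"
    unfolding N X_def[symmetric] Y_def[symmetric] using XY by (simp add: field_simps)
  have "(\<integral>\<^sup>+ s. f s \<partial>urn_step \<kappa> (x, y))
    = f (x, y + sgn x) * ennreal (real_of_int \<bar>x\<bar> / real_of_int (\<bar>x\<bar> + \<bar>y\<bar>))
    + f (x - sgn y, y) * ennreal (1 - real_of_int \<bar>x\<bar> / real_of_int (\<bar>x\<bar> + \<bar>y\<bar>))"
    using assms p by (simp add: urn_step_def)
  then show ?thesis
    unfolding q by (simp only: mult.commute)
qed

lemma visit_prob_rotations: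
  "s \<in> rotations a c \<Longrightarrow> visit_prob \<kappa> n k s = quadrant_prob \<kappa> n k a c"
proof (induction n arbitrary: k s a c)
  case (Suc n)
  show ?case
  proof (cases a)
    case 0
    then have ax: "on_axis s" using Suc.prems by (auto simp: rotations_def on_axis_def)
    show ?thesis
    proof (cases k)
      case (Suc k')
      \<comment> \<open>The restart state for noise \<open>j\<close>: at the axis the coordinate
        that was increasing becomes the decreasing one.\<close>
      obtain r where r: "urn_step \<kappa> s = map_pmf r \<kappa>" "\<And>j. r j \<in> rotations (noisy_restart c j) 0"
      proof -
        consider "s = (0, int c + 1)" | "s = (- (int c + 1), 0)" | "s = (0, - (int c + 1))" | "s = (int c + 1, 0)"
          using Suc.prems 0 by (auto simp: rotations_def)
        then show ?thesis
        proof cases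
          case 1
          show ?thesis
            by (rule that[of "\<lambda>j. (- 1, max 1 (int c + 1 - j))"])
               (simp_all add: 1 urn_step_def rotations_def noisy_restart_def add.commute)
        next
          case 2
          show ?thesis
            by (rule that[of "\<lambda>j. (- max 1 (int c + 1 - j), - 1)"])
               (simp_all add: 2 urn_step_def rotations_def noisy_restart_def add.commute)
        next
          case 3
          show ?thesis
            by (rule that[of "\<lambda>j. (1, - max 1 (int c + 1 - j))"])
               (simp_all add: 3 urn_step_def rotations_def noisy_restart_def add.commute)
        next
          case 4
          show ?thesis
            by (rule that[of "\<lambda>j. (max 1 (int c + 1 - j), 1)"])
               (simp_all add: 4 urn_step_def rotations_def noisy_restart_def add.commute)
        qed
      qed
      have rv: "restart_val (r j) = noisy_restart c j" for j
        using r(2)[of j] noisy_restart_ge_1[of c j] by (auto simp: rotations_def restart_val_def)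
      have ih: "visit_prob \<kappa> n k' (r j) = quadrant_prob \<kappa> n k' (noisy_restart c j) 0" for j
        by (rule Suc.IH[OF r(2)])
      show ?thesis
        using ax 0 Suc by (simp add: r(1) rv ih cong: if_cong)
    qed (use ax 0 in simp)
  next
    case (Suc a')
    obtain x y where s: "s = (x, y)" by (cases s)
    have ax: "\<not> on_axis s" using Suc.prems Suc by (auto simp: rotations_def on_axis_def)
    then have xy: "x \<noteq> 0" "y \<noteq> 0" by (auto simp: s on_axis_def)
    have e: "visit_prob \<kappa> (Suc n) k s = ennreal (real_of_int \<bar>x\<bar> / real_of_int (\<bar>x\<bar> + \<bar>y\<bar>)) * visit_prob \<kappa> n k (x, y + sgn x)
        + ennreal (real_of_int \<bar>y\<bar> / real_of_int (\<bar>x\<bar> + \<bar>y\<bar>)) * visit_prob \<kappa> n k (x - sgn y, y)"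
      using ax nn_integral_urn_step_interior[OF xy] by (simp add: s)
    define A B where "A = quadrant_prob \<kappa> n k (Suc a') (Suc c)" and "B = quadrant_prob \<kappa> n k a' c"
    have q: "quadrant_prob \<kappa> (Suc n) k a c = ennreal (real (Suc a') / real (Suc a' + c + 1)) * A
         + ennreal (real (c + 1) / real (Suc a' + c + 1)) * B"
      by (simp add: Suc A_def B_def)
    have A: "visit_prob \<kappa> n k s' = A" if "s' \<in> rotations (Suc a') (Suc c)" for s'
      unfolding A_def by (rule Suc.IH[OF that])
    have B: "visit_prob \<kappa> n k s' = B" if "s' \<in> rotations a' c" for s'
      unfolding B_def by (rule Suc.IH[OF that])
    consider "x = int a' + 1" "y = int c + 1" | "x = - (int c + 1)" "y = int a' + 1"
      | "x = - (int a' + 1)" "y = - (int c + 1)" | "x = int c + 1" "y = - (int a' + 1)"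
      using Suc.prems Suc s by (auto simp: rotations_def)
    then show ?thesis
    proof cases
      case 1
      have "visit_prob \<kappa> n k (x, y + sgn x) = A" "visit_prob \<kappa> n k (x - sgn y, y) = B"
        by (rule A, simp add: 1 rotations_def, rule B, simp add: 1 rotations_def)
      then show ?thesis unfolding e q by (simp add: 1 add_ac)
    next
      \<comment> \<open>In the second and fourth quadrants \<open>y\<close> is the decreasing
        coordinate, so the two outcomes exchange roles.\<close>
      case 2
      have "visit_prob \<kappa> n k (x, y + sgn x) = B" "visit_prob \<kappa> n k (x - sgn y, y) = A"
        by (rule B, simp add: 2 rotations_def, rule A, simp add: 2 rotations_def)
      then show ?thesis unfolding e q by (simp add: 2 add_ac)
    next
      case 3
      have "visit_prob \<kappa> n k (x, y + sgn x) = A" "visit_prob \<kappa> n k (x - sgn y, y) = B"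
        by (rule A, simp add: 3 rotations_def, rule B, simp add: 3 rotations_def)
      then show ?thesis unfolding e q by (simp add: 3 add_ac)
    next
      case 4
      have "visit_prob \<kappa> n k (x, y + sgn x) = B" "visit_prob \<kappa> n k (x - sgn y, y) = A"
        by (rule B, simp add: 4 rotations_def, rule A, simp add: 4 rotations_def)
      then show ?thesis unfolding e q by (simp add: 4 add_ac)
    qed
  qed
qed simp

lemma quadrant_prob_mono: "quadrant_prob \<kappa> n k a c \<le> quadrant_prob \<kappa> (Suc n) k a c"
proof (induction n arbitrary: k a c)
  case (Suc n)
  show ?case
    unfolding quadrant_prob.simps(2)[of \<kappa> "Suc n" k a c] quadrant_prob.simps(2)[of \<kappa> n k a c]
    by (auto simp del: quadrant_prob.simps split: nat.split
        intro!: nn_integral_mono add_mono mult_left_mono Suc.IH)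
qed simp

lemma incseq_quadrant_prob: "incseq (\<lambda>n. quadrant_prob \<kappa> n k a c)"
  by (rule incseq_SucI) (rule quadrant_prob_mono)

lemma quadrant_prob_le_1: "quadrant_prob \<kappa> n k a c \<le> 1"
proof (induction n arbitrary: k a c)
  case (Suc n)
  have 1: "ennreal p * quadrant_prob \<kappa> n k a c + ennreal q * quadrant_prob \<kappa> n k a' c' \<le> 1"
    if "0 \<le> p" "0 \<le> q" "p + q = 1" for p q a c a' c'
  proof -
    have "ennreal p * quadrant_prob \<kappa> n k a c + ennreal q * quadrant_prob \<kappa> n k a' c' \<le> ennreal p * 1 + ennreal q * 1"
      by (intro add_mono mult_left_mono Suc.IH) auto
    also have "\<dots> = 1" using that by (simp flip: ennreal_plus)
    finally show ?thesis .
  qed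
  have 2: "(\<integral>\<^sup>+ j. (if noisy_restart c j = 1 then 1 else quadrant_prob \<kappa> n k' (noisy_restart c j) 0) \<partial>\<kappa>) \<le> 1" for k'
  proof -
    have "(\<integral>\<^sup>+ j. (if noisy_restart c j = 1 then 1 else quadrant_prob \<kappa> n k' (noisy_restart c j) 0) \<partial>\<kappa>) \<le> (\<integral>\<^sup>+ j. 1 \<partial>\<kappa>)"
      by (intro nn_integral_mono) (auto intro: Suc.IH)
    then show ?thesis by simp
  qed
  show ?case
  proof (cases a)
    case 0
    show ?thesis
      by (cases k) (use 2 in \<open>simp_all only: 0 quadrant_prob.simps nat.case zero_le\<close>)
  next
    case (Suc a')
    have "real (Suc a') + real (c + 1) = real (Suc a' + c + 1)" by simp
    then have "real (Suc a') / real (Suc a' + c + 1) + real (c + 1) / real (Suc a' + c + 1) = 1"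
      unfolding add_divide_distrib[symmetric] by simp
    then show ?thesis
      unfolding Suc quadrant_prob.simps nat.case by (intro 1) auto
  qed
qed simp

section \<open>Hitting probabilities without a limit on the urn steps\<close>

definition hit_prob :: "int pmf \<Rightarrow> nat \<Rightarrow> nat \<Rightarrow> nat \<Rightarrow> ennreal" where
  "hit_prob \<kappa> k a c = (SUP n. quadrant_prob \<kappa> n k a c)"

lemma hit_prob_Suc: "hit_prob \<kappa> k a c = (SUP n. quadrant_prob \<kappa> (Suc n) k a c)"
proof -
  have "(\<lambda>n. quadrant_prob \<kappa> n k a c) \<longlonglongrightarrow> hit_prob \<kappa> k a c"
    unfolding hit_prob_def by (intro LIMSEQ_SUP incseq_quadrant_prob)
  then have "(\<lambda>n. quadrant_prob \<kappa> (Suc n) k a c) \<longlonglongrightarrow> hit_prob \<kappa> k a c"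
    by (rule LIMSEQ_Suc)
  moreover have "(\<lambda>n. quadrant_prob \<kappa> (Suc n) k a c) \<longlonglongrightarrow> (SUP n. quadrant_prob \<kappa> (Suc n) k a c)"
    by (intro LIMSEQ_SUP incseq_SucI quadrant_prob_mono)
  ultimately show ?thesis by (rule LIMSEQ_unique)
qed

text \<open>Inside a quadrant an urn step uses up no passage, so \<open>k\<close> is the same on
  both sides, and the monotone limit in the number of steps passes through the sum.\<close>

lemma harmonic_hit_prob: "harmonic_upto A (hit_prob \<kappa> k)"
  unfolding harmonic_upto_def
proof (intro allI impI)
  fix a c :: nat
  show "hit_prob \<kappa> k (Suc a) c = ennreal (real (Suc a) / real (Suc a + c + 1)) * hit_prob \<kappa> k (Suc a) (Suc c)
     + ennreal (real (c + 1) / real (Suc a + c + 1)) * hit_prob \<kappa> k a c"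
    unfolding hit_prob_Suc[of _ _ "Suc a" c] quadrant_prob.simps(2) nat.case
    unfolding hit_prob_def SUP_mult_left_ennreal
    by (rule ennreal_SUP_add) (auto simp: incseq_def intro!: mult_left_mono monoD[OF incseq_quadrant_prob])
qed

lemma hit_prob_le_1: "hit_prob \<kappa> k a c \<le> 1"
  unfolding hit_prob_def by (intro SUP_least quadrant_prob_le_1)

text \<open>
  That the walk leaves each quadrant almost surely enters only here: a bounded harmonic function
  is determined by its values on the axis.
\<close>

lemma nn_integral_hit_prob: "(\<integral>\<^sup>+ c. hit_prob \<kappa> k 0 c \<partial>exit_law z 0) = hit_prob \<kappa> k z 0"
proof (rule harmonic_exit_law[OF harmonic_hit_prob order_refl])
  fix a c :: nat
  have "(\<lambda>n. ennreal (surv (Suc a) c n)) \<longlonglongrightarrow> ennreal 0"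
    by (intro tendsto_ennrealI surv_tendsto)
  then have l: "(\<lambda>n. ennreal (surv (Suc a) c n)) \<longlonglongrightarrow> 0" by simp
  show "(\<lambda>n. ennreal (surv (Suc a) c n) * hit_prob \<kappa> k (Suc a) (c + n)) \<longlonglongrightarrow> 0"
  proof (rule tendsto_sandwich[OF _ _ tendsto_const l])
    show "\<forall>\<^sub>F n in sequentially. ennreal (surv (Suc a) c n) * hit_prob \<kappa> k (Suc a) (c + n) \<le> ennreal (surv (Suc a) c n)"
      using hit_prob_le_1 by (intro always_eventually allI) (metis mult.right_neutral mult_left_mono zero_le)
  qed simp
qed

lemma hit_prob_axis: "hit_prob \<kappa> (Suc k) 0 c =
  (\<integral>\<^sup>+ j. (if noisy_restart c j = 1 then 1 else hit_prob \<kappa> k (noisy_restart c j) 0) \<partial>\<kappa>)"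
proof -
  have "hit_prob \<kappa> (Suc k) 0 c =
      (SUP n. \<integral>\<^sup>+ j. (if noisy_restart c j = 1 then 1 else quadrant_prob \<kappa> n k (noisy_restart c j) 0) \<partial>\<kappa>)"
    by (simp add: hit_prob_Suc)
  also have "\<dots> = (\<integral>\<^sup>+ j. (SUP n. if noisy_restart c j = 1 then 1 else quadrant_prob \<kappa> n k (noisy_restart c j) 0) \<partial>\<kappa>)"
    by (rule nn_integral_monotone_convergence_SUP[symmetric])
       (auto simp: incseq_def le_fun_def intro: monoD[OF incseq_quadrant_prob])
  also have "\<dots> = (\<integral>\<^sup>+ j. (if noisy_restart c j = 1 then 1 else hit_prob \<kappa> k (noisy_restart c j) 0) \<partial>\<kappa>)"
    by (intro nn_integral_cong) (simp add: hit_prob_def)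
  finally show ?thesis .
qed

context urn_noise
begin

text \<open>Averaging the recursion on the axis over the exit law reproduces the kernel
  \<open>P\<close>, since exit position and noise are independent. The count \<open>k\<close> of
  passages thereby becomes the time of the embedded chain.\<close>

lemma hit_prob_eq: "hit_prob \<kappa> k z 0 = ennreal (1 - survival k z)"
proof (induction k arbitrary: z)
  case 0
  have "quadrant_prob \<kappa> n 0 a c = 0" for n a c
    by (induction n arbitrary: a c) (auto split: nat.split)
  then show ?case by (simp add: hit_prob_def)
next
  case (Suc k)
  let ?f = "\<lambda>z'. if z' = 1 then 0 else survival k z'"
  have "hit_prob \<kappa> (Suc k) z 0 = (\<integral>\<^sup>+ c. hit_prob \<kappa> (Suc k) 0 c \<partial>exit_law z 0)"
    by (rule nn_integral_hit_prob[symmetric])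
  also have "\<dots> = (\<integral>\<^sup>+ z'. (if z' = 1 then 1 else hit_prob \<kappa> k z' 0) \<partial>P z)"
    by (simp add: hit_prob_axis urn_kernel_def nn_integral_pair_pmf' cong: if_cong)
  also have "\<dots> = (\<integral>\<^sup>+ z'. ennreal (1 - ?f z') \<partial>P z)"
    by (intro nn_integral_cong) (simp add: Suc.IH)
  also have "\<dots> = ennreal (measure_pmf.expectation (P z) (\<lambda>z'. 1 - ?f z'))"
    using survival_bounds[of k] integrable_survival[of z k]
    by (intro nn_integral_eq_integral) auto
  also have "measure_pmf.expectation (P z) (\<lambda>z'. 1 - ?f z') = 1 - survival (Suc k) z"
    using integrable_survival[of z k] by simp
  finally show ?case .
qed

section \<open>Tail and moments of the hitting time\<close>

text \<open>The start \<open>(z0, 1)\<close> is the quadrant state \<open>a = z0\<close>,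
  \<open>c = 0\<close>, just like a restart with value \<open>z0\<close>; the rest is continuity
  along the increasing union over the number of steps.\<close>

lemma emeasure_tau_le:
  assumes "noisy_urn M \<kappa> z0 S"
  shows "{\<omega> \<in> space M. tau_q z0 (\<lambda>n. S n \<omega>) \<le> enat k} \<in> sets M"
    and "emeasure M {\<omega> \<in> space M. tau_q z0 (\<lambda>n. S n \<omega>) \<le> enat k} = ennreal (1 - survival k z0)"
proof -
  have mc: "markov_chain M (urn_step \<kappa>) (int z0, 1) S"
    using assms by (simp add: noisy_urn_def)
  let ?A = "\<lambda>n. {\<omega> \<in> space M. visits n k (\<lambda>i. S i \<omega>)}"
  have meas: "?A n \<in> sets M" for n
    using pred_visits[of S M n k] mc by (simp add: markov_chain_def pred_def)
  have eq: "{\<omega> \<in> space M. tau_q z0 (\<lambda>n. S n \<omega>) \<le> enat k} = (\<Union>n. ?A n)"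
    by (auto simp: tau_q_le_iff)
  show "{\<omega> \<in> space M. tau_q z0 (\<lambda>n. S n \<omega>) \<le> enat k} \<in> sets M"
    unfolding eq using meas by blast
  have "emeasure M (\<Union>n. ?A n) = (SUP n. emeasure M (?A n))"
  proof (rule SUP_emeasure_incseq[symmetric])
    show "incseq ?A" using visits_mono by (intro incseq_SucI) blast
  qed (use meas in blast)
  also have "\<dots> = (SUP n. quadrant_prob \<kappa> n k z0 0)"
    by (simp add: emeasure_visits[OF mc] visit_prob_rotations[of _ z0 0] rotations_def)
  also have "\<dots> = ennreal (1 - survival k z0)"
    unfolding hit_prob_def[symmetric] by (rule hit_prob_eq)
  finally show "emeasure M {\<omega> \<in> space M. tau_q z0 (\<lambda>n. S n \<omega>) \<le> enat k} = ennreal (1 - survival k z0)"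
    unfolding eq .
qed

lemma emeasure_tau_gt:
  assumes "noisy_urn M \<kappa> z0 S"
  shows "{\<omega> \<in> space M. enat k < tau_q z0 (\<lambda>n. S n \<omega>)} \<in> sets M"
    and "emeasure M {\<omega> \<in> space M. enat k < tau_q z0 (\<lambda>n. S n \<omega>)} = ennreal (survival k z0)"
proof -
  interpret prob_space M
    using assms by (simp add: noisy_urn_def markov_chain_def)
  note le = emeasure_tau_le[OF assms, of k]
  have eq: "{\<omega> \<in> space M. enat k < tau_q z0 (\<lambda>n. S n \<omega>)} = space M - {\<omega> \<in> space M. tau_q z0 (\<lambda>n. S n \<omega>) \<le> enat k}"
    by auto
  show "{\<omega> \<in> space M. enat k < tau_q z0 (\<lambda>n. S n \<omega>)} \<in> sets M"
    unfolding eq using le(1) by blast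
  have "emeasure M {\<omega> \<in> space M. enat k < tau_q z0 (\<lambda>n. S n \<omega>)} = 1 - ennreal (1 - survival k z0)"
    unfolding eq using le by (simp add: emeasure_compl emeasure_space_1)
  also have "\<dots> = ennreal (survival k z0)"
    using survival_bounds[of k z0] ennreal_minus[of "1 - survival k z0" 1] by simp
  finally show "emeasure M {\<omega> \<in> space M. enat k < tau_q z0 (\<lambda>n. S n \<omega>)} = ennreal (survival k z0)" .
qed

text \<open>Markov's inequality: the moment is at least \<open>n powr p\<close> times the
  probability of \<open>\<tau> > n + 1\<close>, hence at least of order
  \<open>n powr (p - \<beta>)\<close> with \<open>\<beta> < p\<close>, and this is
  unbounded.\<close>

lemma tau_moment_infinite:
  assumes urn: "noisy_urn M \<kappa> z0 S" and z0: "1 \<le> z0" and p: "0 < p" "3 * noise_mean - 1 < p"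
  shows "(\<integral>\<^sup>+ \<omega>. enat_powr (tau_q z0 (\<lambda>n. S n \<omega>)) p \<partial>M) = \<infinity>"
proof -
  \<comment> \<open>Midway between the critical exponent and \<open>p\<close>; the maximum with 0
    keeps \<beta> positive.\<close>
  define \<beta> where "\<beta> = (max 0 (3 * noise_mean - 1) + p) / 2"
  have \<beta>: "0 < \<beta>" "3 * noise_mean - 1 < \<beta>" "\<beta> < p" using p by (auto simp: \<beta>_def max_def)
  obtain c n0 where c: "0 < c" and lo: "\<And>n. n0 \<le> n \<Longrightarrow> c * real n powr (- \<beta>) \<le> survival (Suc n) z0"
    using survival_lower[OF \<beta>(1,2) z0] by blast
  let ?I = "\<integral>\<^sup>+ \<omega>. enat_powr (tau_q z0 (\<lambda>n. S n \<omega>)) p \<partial>M"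
  have bound: "ennreal (c * real n powr (p - \<beta>)) \<le> ?I" if n: "n0 \<le> n" for n
  proof -
    let ?A = "{\<omega> \<in> space M. enat (Suc n) < tau_q z0 (\<lambda>i. S i \<omega>)}"
    have "ennreal (c * real n powr (p - \<beta>)) \<le> ennreal (real n powr p * survival (Suc n) z0)"
    proof (rule ennreal_leI)
      have "c * real n powr (p - \<beta>) = real n powr p * (c * real n powr (- \<beta>))"
        by (simp add: powr_diff powr_minus field_simps)
      also have "\<dots> \<le> real n powr p * survival (Suc n) z0"
        using lo[OF n] by (intro mult_left_mono) auto
      finally show "c * real n powr (p - \<beta>) \<le> real n powr p * survival (Suc n) z0" .
    qed
    also have "\<dots> = ennreal (real n powr p) * emeasure M ?A"
      unfolding emeasure_tau_gt(2)[OF urn] by (rule ennreal_mult') simp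
    also have "\<dots> = (\<integral>\<^sup>+ \<omega>. ennreal (real n powr p) * indicator ?A \<omega> \<partial>M)"
      by (rule nn_integral_cmult_indicator[symmetric]) (rule emeasure_tau_gt(1)[OF urn])
    also have "\<dots> \<le> ?I"
    proof (rule nn_integral_mono)
      fix \<omega>
      show "ennreal (real n powr p) * indicator ?A \<omega> \<le> enat_powr (tau_q z0 (\<lambda>n. S n \<omega>)) p"
        using p by (cases "tau_q z0 (\<lambda>n. S n \<omega>)")
          (auto simp: indicator_def enat_powr_def intro!: ennreal_leI powr_mono2)
    qed
    finally show ?thesis .
  qed
  have "filterlim (\<lambda>n. c * real n powr (p - \<beta>)) at_top sequentially"
    using c \<beta> by real_asymp
  then have "((\<lambda>n. ennreal (c * real n powr (p - \<beta>))) \<longlongrightarrow> \<infinity>) sequentially"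
    by (simp add: ennreal_tendsto_top_eq_at_top)
  then have "\<infinity> \<le> ?I"
    by (rule tendsto_upperbound) (auto intro!: eventually_sequentiallyI[of n0] bound)
  then show ?thesis by (simp add: top_unique)
qed

text \<open>For \<open>p \<le> 0\<close> the powers are at most 1. For \<open>p > 0\<close> the tail
  is summed over powers of two: the probability of \<open>\<tau> > 2^j\<close> is
  \<open>O(2^(-j \<alpha>))\<close> with \<open>\<alpha> > p\<close>, against the weight
  \<open>2^((j + 1) p)\<close>.\<close>

lemma tau_moment_finite:
  assumes urn: "noisy_urn M \<kappa> z0 S" and z0: "1 \<le> z0" and p: "p < 3 * noise_mean - 1" and noise_mean: "1 / 3 \<le> noise_mean"
  shows "(\<integral>\<^sup>+ \<omega>. enat_powr (tau_q z0 (\<lambda>n. S n \<omega>)) p \<partial>M) < \<infinity>"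
proof -
  interpret prob_space M
    using urn by (simp add: noisy_urn_def markov_chain_def)
  show ?thesis
  proof (cases "p \<le> 0")
    case True
    have "enat_powr t p \<le> 1" for t
    proof (cases t)
      case (enat n)
      have "real n powr p \<le> 1"
      \<comment> \<open>\<open>0 powr p = 0\<close> for every \<open>p\<close>, so 0 does no harm
        under a negative exponent.\<close>
      proof (cases "n = 0")
        case False
        then have "real n powr p \<le> real n powr 0" using True by (intro powr_mono) auto
        with False show ?thesis by simp
      qed simp
      then show ?thesis by (simp add: enat enat_powr_def)
    qed (use True in \<open>simp add: enat_powr_def\<close>)
    then have "(\<integral>\<^sup>+ \<omega>. enat_powr (tau_q z0 (\<lambda>n. S n \<omega>)) p \<partial>M) \<le> (\<integral>\<^sup>+ \<omega>. 1 \<partial>M)"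
      by (intro nn_integral_mono) auto
    also have "\<dots> < \<infinity>" by (simp add: emeasure_space_1)
    finally show ?thesis .
  next
    case False
    then have p0: "0 < p" by simp
    define \<alpha> where "\<alpha> = (p + (3 * noise_mean - 1)) / 2"
    have \<alpha>: "0 < \<alpha>" "\<alpha> < 3 * noise_mean - 1" "p < \<alpha>" using p p0 by (auto simp: \<alpha>_def)
    obtain C where C: "\<And>k z. 1 \<le> z \<Longrightarrow> survival k z \<le> C * real z powr \<alpha> / (real k + 1) powr \<alpha>"
      using survival_upper[OF \<alpha>(1,2)] by blast
    define D where "D = C * real z0 powr \<alpha>"
    have D: "survival k z0 \<le> D / (real k + 1) powr \<alpha>" for k
      using C[OF z0] by (simp add: D_def)
    have D1: "1 \<le> D" using D[of 0] by simp
    let ?A = "\<lambda>j. {\<omega> \<in> space M. enat (2 ^ j) < tau_q z0 (\<lambda>i. S i \<omega>)}"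
    let ?w = "\<lambda>j::nat. ennreal (2 powr ((real j + 1) * p))"
    \<comment> \<open>only the dyadic level just below \<open>t\<close> is needed\<close>
    have pt: "enat_powr t p \<le> 1 + (\<Sum>j. ?w j * (if enat (2 ^ j) < t then 1 else 0))" for t
    proof (cases t)
      case (enat n)
      show ?thesis
      proof (cases "n \<le> 1")
        case True
        then have "real n powr p \<le> 1" using p0 by (cases "n = 0") (auto simp: le_Suc_eq)
        then have "enat_powr t p \<le> 1" by (simp add: enat enat_powr_def)
        then show ?thesis by (rule order_trans) simp
      next
        case False
        have ex: "\<exists>j. n \<le> 2 ^ j" using less_exp[of n] less_imp_le by blast
        define i where "i = (LEAST j. n \<le> 2 ^ j)"
        have i: "n \<le> 2 ^ i" unfolding i_def by (rule LeastI_ex[OF ex])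
        with False obtain j where j: "i = Suc j" by (cases i) auto
        have "\<not> n \<le> 2 ^ j" using not_less_Least[of j "\<lambda>j. n \<le> 2 ^ j"] j by (simp add: i_def)
        then have lt: "enat (2 ^ j) < t" by (simp add: enat)
        have "real n \<le> 2 powr (real j + 1)"
        proof -
          have "real n \<le> real (2 ^ Suc j)" using i j by (simp only: of_nat_le_iff)
          also have "\<dots> = 2 powr (real (Suc j))" by (simp only: powr_realpow of_nat_power of_nat_numeral zero_less_numeral)
          finally show ?thesis by (simp add: add.commute)
        qed
        then have "real n powr p \<le> (2 powr (real j + 1)) powr p"
          using p0 by (intro powr_mono2) auto
        then have "enat_powr t p \<le> ?w j * (if enat (2 ^ j) < t then 1 else 0)"
          using lt by (simp add: enat enat_powr_def powr_powr ennreal_leI)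
        also have "\<dots> = (\<Sum>j\<in>{j}. ?w j * (if enat (2 ^ j) < t then 1 else 0))" by simp
        also have "\<dots> \<le> (\<Sum>j. ?w j * (if enat (2 ^ j) < t then 1 else 0))"
          by (intro sum_le_suminf) auto
        finally show ?thesis by (rule order_trans) simp
      qed
    next
      case infinity
      \<comment> \<open>Every indicator is 1 and every weight at least 1, so the series
        diverges.\<close>
      have "(\<Sum>j. ?w j * (if enat (2 ^ j) < t then 1 else 0)) = \<infinity>"
      proof -
        have le: "of_nat n \<le> (\<Sum>j. ?w j * (if enat (2 ^ j) < t then 1 else 0))" for n :: nat
        proof -
          have "of_nat n = (\<Sum>j<n. 1 :: ennreal)" by simp
          also have "\<dots> \<le> (\<Sum>j<n. ?w j * (if enat (2 ^ j) < t then 1 else 0))"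
            using p0 by (intro sum_mono) (auto simp: infinity intro!: ge_one_powr_ge_zero)
          also have "\<dots> \<le> (\<Sum>j. ?w j * (if enat (2 ^ j) < t then 1 else 0))"
            by (intro sum_le_suminf) auto
          finally show ?thesis .
        qed
        show ?thesis
        proof (rule ccontr)
          assume "(\<Sum>j. ?w j * (if enat (2 ^ j) < t then 1 else 0)) \<noteq> \<infinity>"
          then obtain n :: nat where "(\<Sum>j. ?w j * (if enat (2 ^ j) < t then 1 else 0)) < of_nat n"
            using ennreal_Ex_less_of_nat by (auto simp: less_top)
          with le[of n] show False by (rule leD[THEN notE])
        qed
      qed
      then show ?thesis by simp
    qed
    define r where "r = 2 powr (p - \<alpha>)"
    have r: "0 < r" "r < 1"
      using \<alpha> powr_less_mono[of "p - \<alpha>" 0 2] by (simp_all add: r_def)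
    have "(\<integral>\<^sup>+ \<omega>. enat_powr (tau_q z0 (\<lambda>n. S n \<omega>)) p \<partial>M)
        \<le> (\<integral>\<^sup>+ \<omega>. 1 + (\<Sum>j. ?w j * indicator (?A j) \<omega>) \<partial>M)"
    proof (rule nn_integral_mono)
      fix \<omega> assume "\<omega> \<in> space M"
      then have "indicator (?A j) \<omega> = (if enat (2 ^ j) < tau_q z0 (\<lambda>n. S n \<omega>) then 1 else (0::ennreal))" for j
        by (simp add: indicator_def)
      then show "enat_powr (tau_q z0 (\<lambda>n. S n \<omega>)) p \<le> 1 + (\<Sum>j. ?w j * indicator (?A j) \<omega>)"
        using pt[of "tau_q z0 (\<lambda>n. S n \<omega>)"] by simp
    qed
    also have "\<dots> = 1 + (\<Sum>j. ?w j * emeasure M (?A j))"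
      using emeasure_tau_gt(1)[OF urn]
      by (subst nn_integral_add) (auto simp: nn_integral_suminf nn_integral_cmult_indicator emeasure_space_1)
    also have "\<dots> \<le> 1 + (\<Sum>j. ennreal (2 powr p * D * r ^ j))"
    proof (intro add_left_mono suminf_le)
      fix j
      have "?w j * emeasure M (?A j) = ennreal (2 powr ((real j + 1) * p) * survival (2 ^ j) z0)"
        unfolding emeasure_tau_gt(2)[OF urn] by (rule ennreal_mult'[symmetric]) simp
      also have "\<dots> \<le> ennreal (2 powr p * D * r ^ j)"
      proof (rule ennreal_leI)
        have "survival (2 ^ j) z0 \<le> D / (real (2 ^ j) + 1) powr \<alpha>" by (rule D)
        also have "\<dots> \<le> D / (2 powr real j) powr \<alpha>"
        proof (intro divide_left_mono mult_pos_pos)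
          show "(2 powr real j) powr \<alpha> \<le> (real (2 ^ j) + 1) powr \<alpha>"
            using \<alpha> by (intro powr_mono2) (auto simp: powr_realpow)
          have "0 < real (2 ^ j) + 1" by (rule add_nonneg_pos) auto
          then show "0 < (real (2 ^ j) + 1) powr \<alpha>" by (simp only: powr_gt_zero)
        qed (use D1 in auto)
        also have "\<dots> = D * 2 powr (- (real j * \<alpha>))"
          by (simp add: powr_powr powr_minus field_simps)
        finally have "2 powr ((real j + 1) * p) * survival (2 ^ j) z0
            \<le> 2 powr ((real j + 1) * p) * (D * 2 powr (- (real j * \<alpha>)))"
          by (intro mult_left_mono) auto
        also have "\<dots> = D * 2 powr ((real j + 1) * p + - (real j * \<alpha>))"
          by (simp only: powr_add mult_ac)
        also have "(real j + 1) * p + - (real j * \<alpha>) = p + (p - \<alpha>) * real j"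
          by (simp add: algebra_simps)
        also have "D * 2 powr (p + (p - \<alpha>) * real j) = 2 powr p * D * r ^ j"
          unfolding r_def by (simp add: powr_add powr_powr[symmetric] powr_realpow)
        finally show "2 powr ((real j + 1) * p) * survival (2 ^ j) z0 \<le> 2 powr p * D * r ^ j" .
      qed
      finally show "?w j * emeasure M (?A j) \<le> ennreal (2 powr p * D * r ^ j)" .
    qed auto
    also have "(\<Sum>j. ennreal (2 powr p * D * r ^ j)) = ennreal (\<Sum>j. 2 powr p * D * r ^ j)"
      using r D1 by (intro suminf_ennreal2 summable_mult summable_geometric) auto
    also have "1 + \<dots> < \<infinity>" by (simp add: ennreal_add_eq_top less_top)
    finally show ?thesis .
  qed
qed

end

theorem theorem2p5:
  fixes M :: "'a measure" and S :: "nat \<Rightarrow> 'a \<Rightarrow> int \<times> int"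
    and \<kappa> :: "int pmf" and z0 :: nat
  assumes exp_moment:
      "\<exists>\<theta>>0. integrable (measure_pmf \<kappa>) (\<lambda>k. exp (\<theta> * real_of_int \<bar>k\<bar>))"
    and mean: "measure_pmf.expectation \<kappa> real_of_int \<ge> 1 / 3"
    and z0: "z0 \<ge> 1"
    and urn: "noisy_urn M \<kappa> z0 S"
  shows "(\<forall>p::real. p < 3 * measure_pmf.expectation \<kappa> real_of_int - 1 \<longrightarrow>
            (\<integral>\<^sup>+ \<omega>. enat_powr (tau_q z0 (\<lambda>n. S n \<omega>)) p \<partial>M) < \<infinity>) \<and>
         (\<forall>p::real. p > 3 * measure_pmf.expectation \<kappa> real_of_int - 1 \<longrightarrow>
            (\<integral>\<^sup>+ \<omega>. enat_powr (tau_q z0 (\<lambda>n. S n \<omega>)) p \<partial>M) = \<infinity>)"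
proof -
  interpret urn_noise \<kappa> by unfold_locales (rule exp_moment)
  have noise_mean: "measure_pmf.expectation \<kappa> real_of_int = noise_mean" by (simp add: noise_mean_def)
  \<comment> \<open>\<open>E \<kappa> \<ge> 1/3\<close> makes the critical exponent nonnegative, so
    every \<open>p\<close> above it is positive, as \<open>tau_moment_infinite\<close>
    requires.\<close>
  show ?thesis
    using tau_moment_finite[OF urn z0] tau_moment_infinite[OF urn z0] mean unfolding noise_mean by auto
qed

end
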